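(* Let $\mathcal{M}$ be a connected finite-dimensional smooth manifold. Let $V_0\colon[0,\infty)\to(0,\infty)$ be continuous and nondecreasing such that $$\int_0^\infty \frac{dx}{\sqrt{V_0(x)}}=+\infty.$$ If $g$ is a complete Riemannian metric on $\mathcal{M}$, and $\mu\in\Omega^1(\mathcal{M})$ is a smooth one-form satisfying $$1+\|\mu^\sharp(p)\|_g^2 \le V_0(d_g(p,x_0))\qquad\text{for all } p\in\mathcal{M},$$ for some $x_0\in\mathcal{M}$, then $$g_\mu = g-\frac{\mu\otimes\mu}{1+\|\mu^\sharp\|_g^2}$$ is a complete Riemannian metric on $\mathcal{M}$.
   Context: For a Riemannian metric $g$ on $\mathcal{M}$, $\|\cdot\|_g$ is the induced norm on tangent spaces, $d_g$ is the Riemannian distance function, and $\mu^\sharp$ is the vector field determined by $g(\mu^\sharp,Y)=\mu(Y)$ for all vector fields $Y$. A Riemannian metric is called complete if it is geodesically complete, i.e. every unit-speed geodesic extends to all of $\mathbb{R}$; by Hopf--Rinow this is equivalent to completeness of the metric space $(\mathcal{M},d_g)$. *)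

theory Defs
  imports "HOL-Analysis.Analysis"
begin

section \<open>Smooth maps on open subsets of the model space\<close>

text \<open>Manifolds are modelled on a set S, which is either a whole Euclidean space (UNIV) or the
  zero space {0}. The second case is there because types of class euclidean_space have positive
  dimension. Derivatives are therefore taken within S and in the directions of S; for S = UNIV these
  are the ordinary derivatives. The set U is meant to be open in S.\<close>

primrec Ck_on ::
  "nat \<Rightarrow> 'e::euclidean_space set \<Rightarrow> 'e set \<Rightarrow> ('e \<Rightarrow> 'f::real_normed_vector) \<Rightarrow> bool" where
  "Ck_on 0 S U f \<longleftrightarrow> continuous_on U f"
| "Ck_on (Suc k) S U f \<longleftrightarrow>
     (\<forall>x\<in>U. f differentiable (at x within S)) \<and>
     (\<forall>v\<in>S. Ck_on k S U (\<lambda>x. frechet_derivative f (at x within S) v))"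

definition smooth_on ::
  "'e::euclidean_space set \<Rightarrow> 'e set \<Rightarrow> ('e \<Rightarrow> 'f::real_normed_vector) \<Rightarrow> bool" where
  "smooth_on S U f \<longleftrightarrow> (\<forall>k. Ck_on k S U f)"


section \<open>Smooth manifolds\<close>

text \<open>The underlying set of the manifold is a whole type. The atlas A is any smooth atlas, not
  necessarily maximal.\<close>

type_synonym ('a, 'e) chart = "'a set \<times> ('a \<Rightarrow> 'e)"

abbreviation chart_dom :: "('a, 'e) chart \<Rightarrow> 'a set" where
  "chart_dom c \<equiv> fst c"

abbreviation chart_map :: "('a, 'e) chart \<Rightarrow> 'a \<Rightarrow> 'e" where
  "chart_map c \<equiv> snd c"

abbreviation chart_image :: "('a, 'e) chart \<Rightarrow> 'e set" where
  "chart_image c \<equiv> chart_map c ` chart_dom c"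

definition chart_inv :: "('a, 'e) chart \<Rightarrow> 'e \<Rightarrow> 'a" where
  "chart_inv c = inv_into (chart_dom c) (chart_map c)"

definition transition :: "('a, 'e) chart \<Rightarrow> ('a, 'e) chart \<Rightarrow> 'e \<Rightarrow> 'e" where
  "transition c d = chart_map d \<circ> chart_inv c"

definition smooth_manifold ::
  "'e::euclidean_space set \<Rightarrow> ('a::{t2_space, second_countable_topology}, 'e) chart set \<Rightarrow> bool" where
  "smooth_manifold S A \<longleftrightarrow>
     (S = UNIV \<or> S = {0}) \<and>
     (\<Union>c\<in>A. chart_dom c) = UNIV \<and>
     (\<forall>c\<in>A. open (chart_dom c) \<and> openin (top_of_set S) (chart_image c) \<and>
            homeomorphism (chart_dom c) (chart_image c) (chart_map c) (chart_inv c)) \<and>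
     (\<forall>c\<in>A. \<forall>d\<in>A.
        smooth_on S (chart_map c ` (chart_dom c \<inter> chart_dom d)) (transition c d))"


section \<open>Tangent vectors and tensor fields\<close>

text \<open>A reference chart is chosen around each point p, and the tangent space at p is identified
  with S through it. A vector with coordinates u in another chart c around p corresponds to the
  image of u under the derivative at p of the transition map from c to the reference chart.\<close>

definition chart_at :: "('a, 'e) chart set \<Rightarrow> 'a \<Rightarrow> ('a, 'e) chart" where
  "chart_at A p = (SOME c. c \<in> A \<and> p \<in> chart_dom c)"

definition to_tangent ::
  "'e::euclidean_space set \<Rightarrow> ('a, 'e) chart set \<Rightarrow> ('a, 'e) chart \<Rightarrow> 'a \<Rightarrow> 'e \<Rightarrow> 'e" where
  "to_tangent S A c p u =
     frechet_derivative (transition c (chart_at A p)) (at (chart_map c p) within S) u"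

definition metric_in_chart ::
  "'e::euclidean_space set \<Rightarrow> ('a, 'e) chart set \<Rightarrow> ('a, 'e) chart \<Rightarrow> ('a \<Rightarrow> 'e \<Rightarrow> 'e \<Rightarrow> real) \<Rightarrow>
     'e \<Rightarrow> 'e \<Rightarrow> 'e \<Rightarrow> real" where
  "metric_in_chart S A c g x u v =
     (let p = chart_inv c x in g p (to_tangent S A c p u) (to_tangent S A c p v))"

definition one_form_in_chart ::
  "'e::euclidean_space set \<Rightarrow> ('a, 'e) chart set \<Rightarrow> ('a, 'e) chart \<Rightarrow> ('a \<Rightarrow> 'e \<Rightarrow> real) \<Rightarrow>
     'e \<Rightarrow> 'e \<Rightarrow> real" where
  "one_form_in_chart S A c \<mu> x u = (let p = chart_inv c x in \<mu> p (to_tangent S A c p u))"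

text \<open>For S = {0} the values of g p and \<open>\<mu>\<close> p outside S have no meaning and are never used;
  (bi)linearity on the whole type only excludes irrelevant extensions.\<close>

definition riemannian_metric ::
  "'e::euclidean_space set \<Rightarrow> ('a, 'e) chart set \<Rightarrow> ('a \<Rightarrow> 'e \<Rightarrow> 'e \<Rightarrow> real) \<Rightarrow> bool" where
  "riemannian_metric S A g \<longleftrightarrow>
     (\<forall>p. bilinear (g p)) \<and>
     (\<forall>p. \<forall>u\<in>S. \<forall>v\<in>S. g p u v = g p v u) \<and>
     (\<forall>p. \<forall>v\<in>S. v \<noteq> 0 \<longrightarrow> g p v v > 0) \<and>
     (\<forall>c\<in>A. \<forall>u\<in>S. \<forall>v\<in>S. smooth_on S (chart_image c) (\<lambda>x. metric_in_chart S A c g x u v))"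

definition smooth_one_form ::
  "'e::euclidean_space set \<Rightarrow> ('a, 'e) chart set \<Rightarrow> ('a \<Rightarrow> 'e \<Rightarrow> real) \<Rightarrow> bool" where
  "smooth_one_form S A \<mu> \<longleftrightarrow>
     (\<forall>p. linear (\<mu> p)) \<and>
     (\<forall>c\<in>A. \<forall>u\<in>S. smooth_on S (chart_image c) (\<lambda>x. one_form_in_chart S A c \<mu> x u))"

definition tangent_norm :: "('a \<Rightarrow> 'e \<Rightarrow> 'e \<Rightarrow> real) \<Rightarrow> 'a \<Rightarrow> 'e \<Rightarrow> real" where
  "tangent_norm g p v = sqrt (g p v v)"

definition sharp ::
  "'e::euclidean_space set \<Rightarrow> ('a \<Rightarrow> 'e \<Rightarrow> 'e \<Rightarrow> real) \<Rightarrow> ('a \<Rightarrow> 'e \<Rightarrow> real) \<Rightarrow> 'a \<Rightarrow> 'e" where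
  "sharp S g \<mu> p = (THE z. z \<in> S \<and> (\<forall>w\<in>S. g p z w = \<mu> p w))"

definition perturbed_metric ::
  "'e::euclidean_space set \<Rightarrow> ('a \<Rightarrow> 'e \<Rightarrow> 'e \<Rightarrow> real) \<Rightarrow> ('a \<Rightarrow> 'e \<Rightarrow> real) \<Rightarrow>
     'a \<Rightarrow> 'e \<Rightarrow> 'e \<Rightarrow> real" where
  "perturbed_metric S g \<mu> p u v =
     g p u v - \<mu> p u * \<mu> p v / (1 + (tangent_norm g p (sharp S g \<mu> p))\<^sup>2)"


section \<open>Riemannian distance\<close>

definition velocity :: "('a, 'e::euclidean_space) chart set \<Rightarrow> (real \<Rightarrow> 'a) \<Rightarrow> real \<Rightarrow> 'e" where
  "velocity A \<gamma> t = vector_derivative (chart_map (chart_at A (\<gamma> t)) \<circ> \<gamma>) (at t)"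

definition C1_curve ::
  "('a::topological_space, 'e::euclidean_space) chart set \<Rightarrow> real \<Rightarrow> real \<Rightarrow> (real \<Rightarrow> 'a) \<Rightarrow> bool" where
  "C1_curve A a b \<gamma> \<longleftrightarrow>
     continuous_on {a..b} \<gamma> \<and>
     (\<forall>c\<in>A. \<exists>D. (\<forall>t\<in>{a..b}. \<gamma> t \<in> chart_dom c \<longrightarrow>
                    ((chart_map c \<circ> \<gamma>) has_vector_derivative D t) (at t within {a..b})) \<and>
                continuous_on {t\<in>{a..b}. \<gamma> t \<in> chart_dom c} D)"

definition piecewise_C1_path ::
  "('a::topological_space, 'e::euclidean_space) chart set \<Rightarrow> (real \<Rightarrow> 'a) \<Rightarrow> bool" where
  "piecewise_C1_path A \<gamma> \<longleftrightarrow>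
     path \<gamma> \<and>
     (\<exists>K. finite K \<and>
        (\<forall>a b. 0 \<le> a \<and> a < b \<and> b \<le> 1 \<and> {a<..<b} \<inter> K = {} \<longrightarrow> C1_curve A a b \<gamma>))"

definition riemannian_length ::
  "('a, 'e::euclidean_space) chart set \<Rightarrow> ('a \<Rightarrow> 'e \<Rightarrow> 'e \<Rightarrow> real) \<Rightarrow> (real \<Rightarrow> 'a) \<Rightarrow> real" where
  "riemannian_length A g \<gamma> = integral {0..1} (\<lambda>t. tangent_norm g (\<gamma> t) (velocity A \<gamma> t))"

definition riemannian_dist ::
  "('a::topological_space, 'e::euclidean_space) chart set \<Rightarrow> ('a \<Rightarrow> 'e \<Rightarrow> 'e \<Rightarrow> real) \<Rightarrow>
     'a \<Rightarrow> 'a \<Rightarrow> real" where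
  "riemannian_dist A g p q =
     Inf {riemannian_length A g \<gamma> | \<gamma>.
            piecewise_C1_path A \<gamma> \<and> pathstart \<gamma> = p \<and> pathfinish \<gamma> = q}"


section \<open>Geodesics and completeness\<close>

definition metric_deriv ::
  "'e::euclidean_space set \<Rightarrow> ('e \<Rightarrow> 'e \<Rightarrow> 'e \<Rightarrow> real) \<Rightarrow> 'e \<Rightarrow> 'e \<Rightarrow> 'e \<Rightarrow> 'e \<Rightarrow> real" where
  "metric_deriv S G x u v w = frechet_derivative (\<lambda>y. G y v w) (at x within S) u"

text \<open>The Levi-Civita connection of a metric G in coordinates: \<open>christoffel S G x u v\<close> is the
  vector with components \<open>\<Gamma>\<close>(k,i,j) u(i) v(j) summed over i and j, determined by the Koszul formula
  for constant vector fields.\<close>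

definition christoffel ::
  "'e::euclidean_space set \<Rightarrow> ('e \<Rightarrow> 'e \<Rightarrow> 'e \<Rightarrow> real) \<Rightarrow> 'e \<Rightarrow> 'e \<Rightarrow> 'e \<Rightarrow> 'e" where
  "christoffel S G x u v =
     (THE z. z \<in> S \<and>
        (\<forall>w\<in>S. G x z w =
           (metric_deriv S G x u v w + metric_deriv S G x v u w - metric_deriv S G x w u v) / 2))"

definition geodesic_on ::
  "'e::euclidean_space set \<Rightarrow> ('a::topological_space, 'e) chart set \<Rightarrow>
     ('a \<Rightarrow> 'e \<Rightarrow> 'e \<Rightarrow> real) \<Rightarrow> real set \<Rightarrow> (real \<Rightarrow> 'a) \<Rightarrow> bool" where
  "geodesic_on S A g I \<gamma> \<longleftrightarrow>
     continuous_on I \<gamma> \<and>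
     (\<forall>c\<in>A. \<exists>D. \<forall>t\<in>I. \<gamma> t \<in> chart_dom c \<longrightarrow>
        ((chart_map c \<circ> \<gamma>) has_vector_derivative D t) (at t) \<and>
        (D has_vector_derivative
           - christoffel S (metric_in_chart S A c g) (chart_map c (\<gamma> t)) (D t) (D t)) (at t))"

definition geodesically_complete ::
  "'e::euclidean_space set \<Rightarrow> ('a::topological_space, 'e) chart set \<Rightarrow>
     ('a \<Rightarrow> 'e \<Rightarrow> 'e \<Rightarrow> real) \<Rightarrow> bool" where
  "geodesically_complete S A g \<longleftrightarrow>
     (\<forall>I \<gamma>. open I \<and> is_interval I \<and> I \<noteq> {} \<and> geodesic_on S A g I \<gamma> \<and>
            (\<forall>t\<in>I. tangent_norm g (\<gamma> t) (velocity A \<gamma> t) = 1) \<longrightarrow>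
        (\<exists>\<delta>. geodesic_on S A g UNIV \<delta> \<and> (\<forall>t\<in>I. \<delta> t = \<gamma> t)))"

end

theory Submission
  imports Defs
begin

text \<open>
  Let d be the distance of g. By the Cauchy-Schwarz inequality the perturbed metric is at least
  \<open>g / (1 + |\<mu>\<^sup>\<sharp>|\<^sup>2)\<close>, so a curve of unit speed for the perturbed metric has g-speed at most
  \<open>sqrt (V0 (d(-, x0)))\<close> (\<open>perturbed_ge\<close>). Its distance \<open>\<rho>\<close> from x0 therefore grows at most like a
  solution of \<open>\<rho>' = sqrt (V0 \<rho>)\<close>, and divergence of the integral of \<open>1 / sqrt V0\<close> excludes that
  such a solution becomes infinite in finite time (\<open>growth_bound\<close>, \<open>unbounded_antiderivative\<close>). So in
  finite time a unit-speed geodesic of the perturbed metric stays in a ball of d. Since g is complete,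
  this ball is compact (\<open>Hopf_Rinow_bounded_compact\<close>), and a geodesic that stays in a compact set until
  a finite time can be continued beyond it (\<open>geodesic_extend_right\<close>); a maximal extension is thus
  defined for all times (\<open>geodesically_complete_if_confined\<close>).

  Compactness of balls is proved by the argument of Cohn-Vossen. At the critical radius, curves that
  are nearly shortest cluster at a distance-preserving curve towards an ideal limit point
  (\<open>Cauchy_at_critical_radius\<close>), and completeness, a statement about geodesics, applies to it once it
  is known to be smooth. This regularity is the heart of the matter (\<open>isometric_curve_geodesic\<close>). In
  coordinates the squared distance of two points is given by the metric at one of them up to a
  third-order error (\<open>local_distance\<close>). The parallelogram identity then bounds the second differences
  of a distance-preserving curve by a multiple of \<open>h sqrt h\<close>, which makes the curve continuously differentiable
  (\<open>second_difference_imp_C1\<close>); and since it minimizes the energy, the first variation and the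
  du Bois-Reymond lemma give the geodesic equation (\<open>first_variation\<close>, \<open>du_Bois_Reymond\<close>).

  Continuing a geodesic requires solving the geodesic equation in a chart and knowing that a solution in
  one chart is a solution in every other one (\<open>ode_exists_right\<close>, \<open>geod_at_one_chart\<close>). Smoothness
  of the perturbed metric holds because in a chart the vector dual to \<open>\<mu>\<close> solves a linear system with
  smooth coefficients (\<open>solution_Ck_on\<close>). In dimension zero there are no curves of unit speed, and
  completeness is trivial (\<open>zero_manifold_complete\<close>).
\<close>

section \<open>Symmetric bilinear forms\<close>

lemma bilinear_expand:
  fixes B :: "'e::euclidean_space \<Rightarrow> 'e \<Rightarrow> real"
  assumes "bilinear B"
  shows "B u v = (\<Sum>i\<in>Basis. \<Sum>j\<in>Basis. (u \<bullet> i) * (v \<bullet> j) * B i j)"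
proof -
  have "B u v = B (\<Sum>i\<in>Basis. (u \<bullet> i) *\<^sub>R i) (\<Sum>j\<in>Basis. (v \<bullet> j) *\<^sub>R j)"
    by (simp add: euclidean_representation)
  also have "\<dots> = (\<Sum>(i,j)\<in>Basis \<times> Basis. B ((u \<bullet> i) *\<^sub>R i) ((v \<bullet> j) *\<^sub>R j))"
    by (rule bilinear_sum[OF assms])
  also have "\<dots> = (\<Sum>(i,j)\<in>Basis \<times> Basis. (u \<bullet> i) * (v \<bullet> j) * B i j)"
    by (intro sum.cong) (auto simp: bilinear_lmul[OF assms] bilinear_rmul[OF assms])
  finally show ?thesis by (simp add: sum.cartesian_product)
qed

lemma linear_expand:
  fixes \<phi> :: "'e::euclidean_space \<Rightarrow> real"
  assumes "linear \<phi>"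
  shows "\<phi> w = (\<Sum>i\<in>Basis. (w \<bullet> i) * \<phi> i)"
proof -
  have "\<phi> w = \<phi> (\<Sum>i\<in>Basis. (w \<bullet> i) *\<^sub>R i)" by (simp add: euclidean_representation)
  also have "\<dots> = (\<Sum>i\<in>Basis. (w \<bullet> i) * \<phi> i)"
    by (simp add: linear_sum[OF assms] linear_scale[OF assms])
  finally show ?thesis .
qed

lemma coord_sum_inner:
  fixes w :: "'e::euclidean_space"
  shows "(\<Sum>i\<in>Basis. f i *\<^sub>R i) \<bullet> w = (\<Sum>i\<in>Basis. (w \<bullet> i) * f i)"
  unfolding inner_sum_left by (rule sum.cong) (simp_all add: inner_commute)

definition inner_form :: "('e::euclidean_space \<Rightarrow> 'e \<Rightarrow> real) \<Rightarrow> bool" where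
  "inner_form B \<longleftrightarrow> bilinear B \<and> (\<forall>u v. B u v = B v u) \<and> (\<forall>v. v \<noteq> 0 \<longrightarrow> B v v > 0)"

lemma inner_formD:
  assumes "inner_form B"
  shows "bilinear B" "B u v = B v u" "v \<noteq> 0 \<Longrightarrow> B v v > 0" "B v v \<ge> 0"
proof -
  show b: "bilinear B" and "B u v = B v u" and *: "v \<noteq> 0 \<Longrightarrow> B v v > 0"
    using assms by (auto simp: inner_form_def)
  show "B v v \<ge> 0" using * bilinear_lzero[OF b] by (cases "v = 0") (auto intro: less_imp_le)
qed

lemma bilinear_linear1: "bilinear B \<Longrightarrow> linear (\<lambda>u. B u w)"
  by (simp add: bilinear_def)

lemma bilinear_linear2: "bilinear B \<Longrightarrow> linear (\<lambda>w. B u w)"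
  by (simp add: bilinear_def)

text \<open>The finite-dimensional Riesz representation. It makes sense of the definite descriptions by which
  the vector dual to a one-form and the Christoffel symbols are defined.\<close>

lemma inner_form_riesz:
  fixes B :: "'e::euclidean_space \<Rightarrow> 'e \<Rightarrow> real"
  assumes B: "inner_form B" and \<phi>: "linear \<phi>"
  shows "\<exists>!z. \<forall>w. B z w = \<phi> w"
proof -
  note bl = inner_formD(1)[OF B]
  define T where "T z = (\<Sum>i\<in>Basis. B z i *\<^sub>R i)" for z
  have lT: "linear T"
    unfolding T_def
    by (rule linearI)
       (simp_all add: bilinear_ladd[OF bl] bilinear_lmul[OF bl] scaleR_add_left sum.distrib scaleR_sum_right)
  have TB: "T z \<bullet> w = B z w" for z w
    unfolding T_def linear_expand[OF bilinear_linear2[OF bl], of z w] by (rule coord_sum_inner)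
  have "inj T"
    unfolding linear_injective_0[OF lT]
  proof (intro allI impI)
    fix z assume "T z = 0"
    then have "B z z = 0" using TB[of z z] by simp
    then show "z = 0" using inner_formD(3)[OF B, of z] by auto
  qed
  then have "surj T" using linear_injective_imp_surjective[OF lT] by auto
  then obtain z where z: "T z = (\<Sum>i\<in>Basis. \<phi> i *\<^sub>R i)" by (metis surjD)
  have "B z w = \<phi> w" for w
    using TB[of z w] unfolding z linear_expand[OF \<phi>, of w] coord_sum_inner by simp
  moreover have "z1 = z2" if "\<forall>w. B z1 w = \<phi> w" "\<forall>w. B z2 w = \<phi> w" for z1 z2
  proof -
    have "B (z1 - z2) (z1 - z2) = 0" using that by (simp add: bilinear_lsub[OF bl])
    then show ?thesis using inner_formD(3)[OF B, of "z1 - z2"] by auto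
  qed
  ultimately show ?thesis by blast
qed

lemma inner_form_Cauchy_Schwarz:
  assumes B: "inner_form B"
  shows "(B u v)\<^sup>2 \<le> B u u * B v v"
proof (cases "v = 0")
  case True
  then show ?thesis using bilinear_rzero[OF inner_formD(1)[OF B]] by simp
next
  case False
  note bl = inner_formD(1)[OF B]
  have vv: "B v v > 0" using inner_formD(3)[OF B False] .
  define t where "t = B u v / B v v"
  have "0 \<le> B (u - t *\<^sub>R v) (u - t *\<^sub>R v)" by (rule inner_formD(4)[OF B])
  also have "\<dots> = B u u - 2 * t * B u v + t\<^sup>2 * B v v"
    by (simp add: bilinear_lsub[OF bl] bilinear_rsub[OF bl] bilinear_lmul[OF bl] bilinear_rmul[OF bl]
        inner_formD(2)[OF B, of v u] power2_eq_square algebra_simps)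
  also have "\<dots> = B u u - (B u v)\<^sup>2 / B v v"
    using vv unfolding t_def by (simp add: field_simps power2_eq_square)
  finally show ?thesis using vv by (simp add: field_simps)
qed

lemma inner_form_parallelogram:
  assumes B: "inner_form B"
  shows "B (a - b) (a - b) = 2 * B a a + 2 * B b b - B (a + b) (a + b)"
  using inner_formD(1,2)[OF B]
  by (simp add: bilinear_lsub bilinear_rsub bilinear_ladd bilinear_radd)

lemma inner_form_sqrt_ge_linear:
  assumes B: "inner_form B"
  shows "B v u \<le> sqrt (B v v) * sqrt (B u u)"
  using real_le_rsqrt[OF inner_form_Cauchy_Schwarz[OF B, of v u]] by (simp add: real_sqrt_mult)

section \<open>Derivatives and continuity of families of forms\<close>

text \<open>The product rule for a form that varies together with its two arguments. All derivatives of
  metric coefficients along curves and under changes of charts are instances of it.\<close>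

lemma has_derivative_form:
  fixes F :: "'p::real_normed_vector \<Rightarrow> 'e::euclidean_space \<Rightarrow> 'e \<Rightarrow> real"
  assumes T: "open T" "t \<in> T" and bl: "\<And>s. s \<in> T \<Longrightarrow> bilinear (F s)"
    and F: "\<And>u v. ((\<lambda>s. F s u v) has_derivative (\<lambda>k. DF k u v)) (at t)"
    and Q: "(Q has_derivative Q') (at t)" and R: "(R has_derivative R') (at t)"
  shows "((\<lambda>s. F s (Q s) (R s)) has_derivative
           (\<lambda>k. DF k (Q t) (R t) + F t (Q' k) (R t) + F t (Q t) (R' k))) (at t)"
proof -
  have ex: "F s u v = (\<Sum>i\<in>Basis. \<Sum>j\<in>Basis. (u \<bullet> i) * (v \<bullet> j) * F s i j)" if "s \<in> T" for s u v
    by (rule bilinear_expand[OF bl[OF that]])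
  have "((\<lambda>s. \<Sum>i\<in>Basis. \<Sum>j\<in>Basis. (Q t \<bullet> i) * (R t \<bullet> j) * F s i j) has_derivative
      (\<lambda>k. \<Sum>i\<in>Basis. \<Sum>j\<in>Basis. (Q t \<bullet> i) * (R t \<bullet> j) * DF k i j)) (at t)"
    by (intro has_derivative_sum has_derivative_mult_right F)
  then have "((\<lambda>s. F s (Q t) (R t)) has_derivative
      (\<lambda>k. \<Sum>i\<in>Basis. \<Sum>j\<in>Basis. (Q t \<bullet> i) * (R t \<bullet> j) * DF k i j)) (at t)"
    by (rule has_derivative_transform_within_open[OF _ T]) (rule ex[symmetric])
  then have DF: "(\<Sum>i\<in>Basis. \<Sum>j\<in>Basis. (Q t \<bullet> i) * (R t \<bullet> j) * DF k i j) = DF k (Q t) (R t)" for k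
    by (rule fun_cong[OF has_derivative_unique[OF _ F]])
  have "((\<lambda>s. \<Sum>i\<in>Basis. \<Sum>j\<in>Basis. (Q s \<bullet> i) * (R s \<bullet> j) * F s i j) has_derivative
      (\<lambda>k. \<Sum>i\<in>Basis. \<Sum>j\<in>Basis. (Q t \<bullet> i) * (R t \<bullet> j) * DF k i j +
           (Q' k \<bullet> i) * (R t \<bullet> j) * F t i j + (Q t \<bullet> i) * (R' k \<bullet> j) * F t i j)) (at t)"
  proof (intro has_derivative_sum)
    fix i j :: 'e
    have 1: "((\<lambda>s. Q s \<bullet> i) has_derivative (\<lambda>k. Q' k \<bullet> i)) (at t)"
      and 2: "((\<lambda>s. R s \<bullet> j) has_derivative (\<lambda>k. R' k \<bullet> j)) (at t)"
      by (intro has_derivative_inner_left Q R)+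
    show "((\<lambda>s. (Q s \<bullet> i) * (R s \<bullet> j) * F s i j) has_derivative
      (\<lambda>k. (Q t \<bullet> i) * (R t \<bullet> j) * DF k i j +
           (Q' k \<bullet> i) * (R t \<bullet> j) * F t i j + (Q t \<bullet> i) * (R' k \<bullet> j) * F t i j)) (at t)"
      by (rule has_derivative_eq_rhs[OF has_derivative_mult[OF has_derivative_mult[OF 1 2] F]])
         (simp add: fun_eq_iff algebra_simps)
  qed
  then have "((\<lambda>s. F s (Q s) (R s)) has_derivative
      (\<lambda>k. \<Sum>i\<in>Basis. \<Sum>j\<in>Basis. (Q t \<bullet> i) * (R t \<bullet> j) * DF k i j +
           (Q' k \<bullet> i) * (R t \<bullet> j) * F t i j + (Q t \<bullet> i) * (R' k \<bullet> j) * F t i j)) (at t)"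
    by (rule has_derivative_transform_within_open[OF _ T]) (rule ex[symmetric])
  then show ?thesis
    unfolding sum.distrib DF ex[OF T(2), symmetric] .
qed

lemma continuous_on_form:
  fixes F :: "'p::topological_space \<Rightarrow> 'e::euclidean_space \<Rightarrow> 'e \<Rightarrow> real"
  assumes bl: "\<And>s. s \<in> T \<Longrightarrow> bilinear (F s)"
    and F: "\<And>u v. continuous_on T (\<lambda>s. F s u v)"
    and Q: "continuous_on T Q" and R: "continuous_on T R"
  shows "continuous_on T (\<lambda>s. F s (Q s) (R s))"
proof -
  have "continuous_on T (\<lambda>s. \<Sum>i\<in>Basis. \<Sum>j\<in>Basis. (Q s \<bullet> i) * (R s \<bullet> j) * F s i j)"
    by (intro continuous_intros F Q R)
  then show ?thesis
    by (rule continuous_on_eq) (simp add: bilinear_expand[OF bl, symmetric])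
qed

text \<open>Compactness of the unit sphere makes a continuous family of inner products uniformly
  definite over a compact parameter set.\<close>

lemma forms_uniformly_definite:
  fixes G :: "'p::topological_space \<Rightarrow> 'e::euclidean_space \<Rightarrow> 'e \<Rightarrow> real"
  assumes K: "compact K" and G: "\<And>x. x \<in> K \<Longrightarrow> inner_form (G x)"
    and c: "\<And>u v. continuous_on K (\<lambda>x. G x u v)"
  obtains l L where "0 < l" "l \<le> L" "\<And>x u. x \<in> K \<Longrightarrow> l * (norm u)\<^sup>2 \<le> G x u u"
    "\<And>x u. x \<in> K \<Longrightarrow> G x u u \<le> L * (norm u)\<^sup>2"
proof (cases "K = {}")
  case True
  then show ?thesis using that[of 1 1] by simp
next
  case False
  let ?S = "K \<times> sphere (0::'e) 1"
  have cS: "compact ?S" by (intro compact_Times K) auto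
  have ne: "?S \<noteq> {}" using False vector_choose_size[of 1] by fastforce
  have co: "continuous_on ?S (\<lambda>p. G (fst p) (snd p) (snd p))"
  proof (rule continuous_on_form[where F = "\<lambda>p. G (fst p)" and Q = snd and R = snd])
    show "bilinear (G (fst s))" if "s \<in> ?S" for s using that inner_formD(1)[OF G] by auto
    show "continuous_on ?S (\<lambda>s. G (fst s) u v)" for u v
      by (rule continuous_on_compose2[OF c]) (auto intro: continuous_intros)
  qed (auto intro: continuous_intros)
  obtain p where p: "p \<in> ?S" "\<forall>y\<in>?S. G (fst p) (snd p) (snd p) \<le> G (fst y) (snd y) (snd y)"
    using continuous_attains_inf[OF cS ne co] by auto
  obtain q where q: "q \<in> ?S" "\<forall>y\<in>?S. G (fst y) (snd y) (snd y) \<le> G (fst q) (snd q) (snd q)"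
    using continuous_attains_sup[OF cS ne co] by auto
  let ?l = "G (fst p) (snd p) (snd p)" and ?L = "G (fst q) (snd q) (snd q)"
  have "snd p \<noteq> 0" using p(1) by auto
  then have l: "0 < ?l" using inner_formD(3)[OF G] p(1) by auto
  have hom: "G x u u = (norm u)\<^sup>2 * G x (u /\<^sub>R norm u) (u /\<^sub>R norm u)" if "x \<in> K" "u \<noteq> 0" for x u
    using that bilinear_lmul[OF inner_formD(1)[OF G]] bilinear_rmul[OF inner_formD(1)[OF G]]
    by (simp add: power2_eq_square field_simps)
  have z: "G x 0 0 = 0" if "x \<in> K" for x using bilinear_lzero[OF inner_formD(1)[OF G[OF that]]] .
  have sph: "(x, u /\<^sub>R norm u) \<in> ?S" if "x \<in> K" "u \<noteq> 0" for x u using that by simp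
  show ?thesis
  proof (rule that[OF l])
    show "?l \<le> ?L" using p q by auto
    show "?l * (norm u)\<^sup>2 \<le> G x u u" if "x \<in> K" for x u
    proof (cases "u = 0")
      case False
      have "?l \<le> G x (u /\<^sub>R norm u) (u /\<^sub>R norm u)" using p(2) sph[OF that False] by force
      then show ?thesis unfolding hom[OF that False]
        by (metis mult.commute mult_left_mono zero_le_power2)
    qed (simp add: z[OF that])
    show "G x u u \<le> ?L * (norm u)\<^sup>2" if "x \<in> K" for x u
    proof (cases "u = 0")
      case False
      have "G x (u /\<^sub>R norm u) (u /\<^sub>R norm u) \<le> ?L" using q(2) sph[OF that False] by force
      then show ?thesis unfolding hom[OF that False]
        by (metis mult.commute mult_left_mono zero_le_power2)
    qed (simp add: z[OF that])
  qed
qed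

lemma has_derivative_zero_mult:
  fixes a :: "'p::real_normed_vector \<Rightarrow> real" and b :: "'p \<Rightarrow> real"
  assumes a: "(a has_derivative a') (at x)" "a x = 0" and b: "isCont b x" "b x = 0"
  shows "((\<lambda>y. a y * b y) has_derivative (\<lambda>h. 0)) (at x)"
proof -
  obtain e where e: "\<And>h. a (x + h) = a x + a' h + e h" "(\<lambda>h. norm (e h) / norm h) \<midarrow>0\<rightarrow> 0"
  proof -
    have "(\<lambda>h. norm (a (x + h) - a x - a' h) / norm h) \<midarrow>0\<rightarrow> 0"
      using a(1) unfolding has_derivative_at by simp
    then show ?thesis by (intro that[of "\<lambda>h. a (x + h) - a x - a' h"]) auto
  qed
  have bl: "bounded_linear a'" using a(1) by (rule has_derivative_bounded_linear)
  then obtain K where K: "\<And>h. norm (a' h) \<le> norm h * K" using bounded_linear.bounded by blast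
  have b0: "(\<lambda>h. b (x + h)) \<midarrow>0\<rightarrow> 0" using b unfolding isCont_def by (metis LIM_offset_zero)
  have bd: "norm (a (x + h) * b (x + h)) / norm h \<le> (K + norm (e h) / norm h) * norm (b (x + h))"
    if "h \<noteq> 0" for h
  proof -
    have "norm (a (x + h)) \<le> norm h * K + norm (e h)"
      unfolding e(1) a(2) using norm_triangle_ineq[of "a' h" "e h"] K[of h] by simp
    then have "norm (a (x + h)) / norm h \<le> K + norm (e h) / norm h"
      using that by (simp add: field_simps)
    then have "norm (a (x + h)) / norm h * norm (b (x + h)) \<le> (K + norm (e h) / norm h) * norm (b (x + h))"
      by (rule mult_right_mono) simp
    then show ?thesis by (simp add: abs_mult)
  qed
  have "(\<lambda>h. (K + norm (e h) / norm h) * norm (b (x + h))) \<midarrow>0\<rightarrow> (K + 0) * norm (0::real)"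
    by (intro tendsto_intros e(2) b0)
  then have lim: "(\<lambda>h. (K + norm (e h) / norm h) * norm (b (x + h))) \<midarrow>0\<rightarrow> 0" by simp
  have "(\<lambda>h. norm (a (x + h) * b (x + h)) / norm h) \<midarrow>0\<rightarrow> 0"
    by (rule Lim_null_comparison[OF _ lim]) (use bd in \<open>auto simp: eventually_at_filter\<close>)
  then show ?thesis using a(2) unfolding has_derivative_at by simp
qed

text \<open>The increment of a solution z satisfies G y (z y - z x) = N y, where N vanishes at x; uniform
  definiteness of the forms bounds the increment by N.\<close>

lemma solution_continuous:
  fixes G :: "'p::t2_space \<Rightarrow> 'e::euclidean_space \<Rightarrow> 'e \<Rightarrow> real"
  assumes T: "open T" "x \<in> T" and bl: "\<And>y. y \<in> T \<Longrightarrow> bilinear (G y)"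
    and l: "0 < l" "\<And>y u. y \<in> T \<Longrightarrow> l * (norm u)\<^sup>2 \<le> G y u u"
    and G: "\<And>u v. isCont (\<lambda>y. G y u v) x" and m: "\<And>w. isCont (\<lambda>y. m y w) x"
    and z: "\<And>y w. y \<in> T \<Longrightarrow> G y (z y) w = m y w"
  shows "isCont z x"
proof -
  define N where "N y i = m y i - G y (z x) i" for y i
  have N0: "N x i = 0" for i using z[OF T(2)] by (simp add: N_def)
  have bd: "norm (z y - z x) \<le> (\<Sum>i\<in>Basis. \<bar>N y i\<bar>) / l" if y: "y \<in> T" for y
  proof (cases "z y = z x")
    case True then show ?thesis using l(1) by (simp add: sum_nonneg)
  next
    case False
    let ?\<Delta> = "z y - z x"
    have "l * (norm ?\<Delta>)\<^sup>2 \<le> G y ?\<Delta> ?\<Delta>" by (rule l(2)[OF y])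
    also have "\<dots> = (\<Sum>i\<in>Basis. (?\<Delta> \<bullet> i) * G y ?\<Delta> i)"
      by (rule linear_expand[OF bilinear_linear2[OF bl[OF y]]])
    also have "\<dots> = (\<Sum>i\<in>Basis. (?\<Delta> \<bullet> i) * N y i)"
      by (simp add: N_def bilinear_lsub[OF bl[OF y]] z[OF y])
    also have "\<dots> \<le> (\<Sum>i\<in>Basis. norm ?\<Delta> * \<bar>N y i\<bar>)"
    proof (rule sum_mono)
      fix i :: 'e assume "i \<in> Basis"
      have "(?\<Delta> \<bullet> i) * N y i \<le> \<bar>?\<Delta> \<bullet> i\<bar> * \<bar>N y i\<bar>" by (metis abs_ge_self abs_mult)
      also have "\<dots> \<le> norm ?\<Delta> * \<bar>N y i\<bar>" by (intro mult_right_mono Basis_le_norm \<open>i \<in> Basis\<close>) auto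
      finally show "(?\<Delta> \<bullet> i) * N y i \<le> norm ?\<Delta> * \<bar>N y i\<bar>" .
    qed
    finally have "norm ?\<Delta> * (l * norm ?\<Delta>) \<le> norm ?\<Delta> * (\<Sum>i\<in>Basis. \<bar>N y i\<bar>)"
      by (simp add: sum_distrib_left power2_eq_square algebra_simps)
    moreover have "norm ?\<Delta> > 0" using False by simp
    ultimately have "l * norm ?\<Delta> \<le> (\<Sum>i\<in>Basis. \<bar>N y i\<bar>)" by (meson mult_le_cancel_left_pos)
    then show ?thesis using l(1) by (simp add: field_simps)
  qed
  have "isCont (\<lambda>y. (\<Sum>i\<in>Basis. \<bar>N y i\<bar>) / l) x"
    unfolding N_def using l(1) by (intro continuous_intros G m) auto
  then have lim: "((\<lambda>y. (\<Sum>i\<in>Basis. \<bar>N y i\<bar>) / l) \<longlongrightarrow> 0) (at x)"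
    unfolding isCont_def by (simp add: N0)
  have "((\<lambda>y. z y - z x) \<longlongrightarrow> 0) (at x)"
    by (rule Lim_null_comparison[OF _ lim], rule eventually_at_topological[THEN iffD2])
       (use T bd in blast)
  then show ?thesis unfolding isCont_def by (simp add: Lim_null[of z])
qed

text \<open>The increment of the solution is the image, under the inverse J of the form at x, of a
  differentiable term n minus a sum q of products of two factors that both vanish at x, so that q
  contributes nothing to the derivative.\<close>

lemma solution_differentiable:
  fixes G :: "'p::real_normed_vector \<Rightarrow> 'e::euclidean_space \<Rightarrow> 'e \<Rightarrow> real"
  assumes T: "open T" "x \<in> T" and bl: "\<And>y. y \<in> T \<Longrightarrow> bilinear (G y)" and Gx: "inner_form (G x)"
    and G: "\<And>u v. ((\<lambda>y. G y u v) has_derivative DG u v) (at x)"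
    and m: "\<And>w. ((\<lambda>y. m y w) has_derivative m' w) (at x)"
    and z: "\<And>y w. y \<in> T \<Longrightarrow> G y (z y) w = m y w" and zc: "isCont z x"
  shows "\<exists>z'. (z has_derivative z') (at x)"
proof -
  define J where "J a = (THE z. \<forall>w. G x z w = a \<bullet> w)" for a
  have J: "G x (J a) w = a \<bullet> w" for a w
  proof -
    have "\<exists>!z. \<forall>w. G x z w = a \<bullet> w"
      by (rule inner_form_riesz[OF Gx]) (simp add: bounded_linear.linear bounded_linear_inner_right)
    from theI'[OF this] show ?thesis unfolding J_def by blast
  qed
  have Ju: "J a = z'" if "\<And>w. G x z' w = a \<bullet> w" for a z'
  proof -
    have "\<exists>!z. \<forall>w. G x z w = a \<bullet> w"
      by (rule inner_form_riesz[OF Gx]) (simp add: bounded_linear.linear bounded_linear_inner_right)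
    then show ?thesis using J that by blast
  qed
  note blx = bl[OF T(2)]
  have "linear J"
    by (rule linearI; rule Ju)
       (simp_all add: bilinear_ladd[OF blx] bilinear_lmul[OF blx] J inner_add_left)
  then have J_bl: "bounded_linear J" by (simp add: linear_conv_bounded_linear)
  define n where "n y = (\<Sum>i\<in>Basis. (m y i - G y (z x) i) *\<^sub>R i)" for y
  define q where "q y = (\<Sum>i\<in>Basis. (\<Sum>j\<in>Basis. (G y j i - G x j i) * ((z y - z x) \<bullet> j)) *\<^sub>R i)" for y
  have eq: "z y = z x + J (n y) - J (q y)" if y: "y \<in> T" for y
  proof -
    have "J (n y - q y) = z y - z x"
    proof (rule Ju)
      fix w
      have 1: "n y \<bullet> w = m y w - G y (z x) w"
        unfolding n_def coord_sum_inner z[OF y, symmetric] bilinear_lsub[OF bl[OF y], symmetric]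
        by (rule linear_expand[OF bilinear_linear2[OF bl[OF y]], symmetric])
      have 2: "q y \<bullet> w = G y (z y - z x) w - G x (z y - z x) w"
        unfolding q_def coord_sum_inner bilinear_expand[OF bl[OF y], of "z y - z x" w]
          bilinear_expand[OF blx, of "z y - z x" w] sum_subtractf[symmetric]
        unfolding sum_distrib_left by (subst sum.swap) (simp add: algebra_simps)
      show "G x (z y - z x) w = (n y - q y) \<bullet> w"
        unfolding inner_diff_left 1 2 using z[OF y, of w] by (simp add: bilinear_lsub[OF bl[OF y]])
    qed
    then show ?thesis using linear_diff[OF \<open>linear J\<close>, of "n y" "q y"] by (simp add: algebra_simps)
  qed
  have q': "(q has_derivative (\<lambda>h. \<Sum>i\<in>Basis. (\<Sum>j\<in>(Basis::'e set). 0) *\<^sub>R i)) (at x)"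
    unfolding q_def
  proof (intro has_derivative_sum has_derivative_scaleR_left)
    fix i j :: 'e
    show "((\<lambda>y. (G y j i - G x j i) * ((z y - z x) \<bullet> j)) has_derivative (\<lambda>h. 0)) (at x)"
    proof (rule has_derivative_zero_mult[where a = "\<lambda>y. G y j i - G x j i" and a' = "DG j i"])
      show "((\<lambda>y. G y j i - G x j i) has_derivative DG j i) (at x)"
        using has_derivative_diff[OF G has_derivative_const] by simp
      show "isCont (\<lambda>y. (z y - z x) \<bullet> j) x" by (intro continuous_intros zc)
    qed auto
  qed
  have n': "(n has_derivative (\<lambda>h. \<Sum>i\<in>Basis. (m' i h - DG (z x) i h) *\<^sub>R i)) (at x)"
    unfolding n_def by (intro has_derivative_sum has_derivative_scaleR_left has_derivative_diff m G)
  have "((\<lambda>y. z x + J (n y) - J (q y)) has_derivative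
     (\<lambda>h. 0 + J (\<Sum>i\<in>Basis. (m' i h - DG (z x) i h) *\<^sub>R i) - J (\<Sum>i\<in>Basis. (\<Sum>j\<in>(Basis::'e set). 0) *\<^sub>R i))) (at x)"
    by (intro has_derivative_diff has_derivative_add has_derivative_const
        bounded_linear.has_derivative[OF J_bl] n' q')
  then have "(z has_derivative
     (\<lambda>h. 0 + J (\<Sum>i\<in>Basis. (m' i h - DG (z x) i h) *\<^sub>R i) - J (\<Sum>i\<in>Basis. (\<Sum>j\<in>(Basis::'e set). 0) *\<^sub>R i))) (at x)"
    by (rule has_derivative_transform_within_open[OF _ T]) (use eq in auto)
  then show ?thesis by blast
qed

section \<open>Calculus of finitely often differentiable functions\<close>

lemma Ck_on_cong:
  assumes U: "open U" and eq: "\<And>x. x \<in> U \<Longrightarrow> f x = g x" and f: "Ck_on k UNIV U f"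
  shows "Ck_on k UNIV U g"
  using eq f
proof (induction k arbitrary: f g)
  case 0
  then show ?case using continuous_on_eq by force
next
  case (Suc k)
  have diff: "(f has_derivative frechet_derivative f (at x)) (at x)" if "x \<in> U" for x
    using Suc.prems(2) that frechet_derivative_works by auto
  have gd: "(g has_derivative frechet_derivative f (at x)) (at x)" if "x \<in> U" for x
    by (rule has_derivative_transform_within_open[OF diff[OF that] U that]) (use Suc.prems(1) in auto)
  then have fd: "frechet_derivative g (at x) = frechet_derivative f (at x)" if "x \<in> U" for x
    using that frechet_derivative_at by metis
  have "Ck_on k UNIV U (\<lambda>x. frechet_derivative g (at x) v)" for v
    by (rule Suc.IH[of "\<lambda>x. frechet_derivative f (at x) v"]) (use fd Suc.prems(2) in auto)
  then show ?case using gd by (auto simp: differentiable_def)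
qed

lemma Ck_on_SucI:
  assumes U: "open U" and f: "\<And>x. x \<in> U \<Longrightarrow> (f has_derivative f' x) (at x)"
    and f': "\<And>v. Ck_on k UNIV U (\<lambda>x. f' x v)"
  shows "Ck_on (Suc k) UNIV U f"
proof -
  have "frechet_derivative f (at x) = f' x" if "x \<in> U" for x
    using frechet_derivative_at[OF f[OF that]] by simp
  then have "Ck_on k UNIV U (\<lambda>x. frechet_derivative f (at x) v)" for v
    using Ck_on_cong[OF U _ f'[of v]] by simp
  then show ?thesis using f by (auto simp: differentiable_def)
qed

lemma Ck_on_SucD:
  assumes "Ck_on (Suc k) UNIV U f" "x \<in> U"
  shows "(f has_derivative frechet_derivative f (at x)) (at x)"
  using assms frechet_derivative_works by auto

lemma Ck_on_lower: "Ck_on (Suc k) UNIV U f \<Longrightarrow> Ck_on k UNIV U f"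
proof (induction k arbitrary: f)
  case 0
  then show ?case
    by (auto intro!: continuous_at_imp_continuous_on differentiable_imp_continuous_within)
next
  case (Suc k)
  have "Ck_on k UNIV U (\<lambda>x. frechet_derivative f (at x) v)" for v
    by (rule Suc.IH) (use Suc.prems in auto)
  then show ?case using Suc.prems by auto
qed

lemma Ck_on_continuous: "Ck_on k UNIV U f \<Longrightarrow> continuous_on U f"
proof (induction k)
  case (Suc k)
  then show ?case using Ck_on_lower by blast
qed simp

lemma Ck_on_const: "open U \<Longrightarrow> Ck_on k UNIV U (\<lambda>x. c)"
proof (induction k arbitrary: c)
  case (Suc k)
  show ?case by (rule Ck_on_SucI[OF Suc.prems, where f' = "\<lambda>x v. 0"]) (auto intro: Suc)
qed simp

lemma Ck_on_add:
  assumes "open U"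
  shows "Ck_on k UNIV U f \<Longrightarrow> Ck_on k UNIV U g \<Longrightarrow> Ck_on k UNIV U (\<lambda>x. f x + g x)"
proof (induction k arbitrary: f g)
  case (Suc k)
  show ?case
    by (rule Ck_on_SucI[OF assms has_derivative_add[OF Ck_on_SucD[OF Suc.prems(1)] Ck_on_SucD[OF Suc.prems(2)]]])
       (use Suc in auto)
qed (auto intro: continuous_intros)

lemma Ck_on_linear:
  assumes "open U" "bounded_linear T"
  shows "Ck_on k UNIV U f \<Longrightarrow> Ck_on k UNIV U (\<lambda>x. T (f x))"
proof (induction k arbitrary: f)
  case 0
  then show ?case using bounded_linear.continuous_on[OF assms(2)] by auto
next
  case (Suc k)
  show ?case
    by (rule Ck_on_SucI[OF assms(1) bounded_linear.has_derivative[OF assms(2) Ck_on_SucD[OF Suc.prems(1)]]])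
       (use Suc in auto)
qed

lemma Ck_on_mult:
  fixes f g :: "'e::euclidean_space \<Rightarrow> real"
  assumes "open U"
  shows "Ck_on k UNIV U f \<Longrightarrow> Ck_on k UNIV U g \<Longrightarrow> Ck_on k UNIV U (\<lambda>x. f x * g x)"
proof (induction k arbitrary: f g)
  case (Suc k)
  show ?case
    by (rule Ck_on_SucI[OF assms has_derivative_mult[OF Ck_on_SucD[OF Suc.prems(1)] Ck_on_SucD[OF Suc.prems(2)]]];
        (intro Ck_on_add assms Suc.IH)?)
       (use Suc.prems Ck_on_lower in auto)
qed (auto intro: continuous_intros)

lemma Ck_on_minus:
  assumes "open U"
  shows "Ck_on k UNIV U f \<Longrightarrow> Ck_on k UNIV U (\<lambda>x. - f x)"
  by (rule Ck_on_linear[OF assms bounded_linear_minus[OF bounded_linear_ident]])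

lemma Ck_on_diff:
  assumes "open U"
  shows "Ck_on k UNIV U f \<Longrightarrow> Ck_on k UNIV U g \<Longrightarrow> Ck_on k UNIV U (\<lambda>x. f x - g x)"
  using Ck_on_add[OF assms, of k f "\<lambda>x. - g x"] Ck_on_minus[OF assms, of k g] by simp

lemma Ck_on_sum:
  assumes "open U"
  shows "(\<And>i. i \<in> I \<Longrightarrow> Ck_on k UNIV U (f i)) \<Longrightarrow> Ck_on k UNIV U (\<lambda>x. \<Sum>i\<in>I. f i x)"
  by (induction I rule: infinite_finite_induct) (auto intro: Ck_on_const Ck_on_add assms)

lemma Ck_on_inverse:
  fixes f :: "'e::euclidean_space \<Rightarrow> real"
  assumes U: "open U" and nz: "\<And>x. x \<in> U \<Longrightarrow> f x \<noteq> 0"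
  shows "Ck_on k UNIV U f \<Longrightarrow> Ck_on k UNIV U (\<lambda>x. inverse (f x))"
proof (induction k)
  case 0
  then show ?case using nz by (auto intro: continuous_intros)
next
  case (Suc k)
  note IH = Suc.IH[OF Ck_on_lower[OF Suc.prems]]
  show ?case
  proof (rule Ck_on_SucI[OF U])
    show "((\<lambda>x. inverse (f x)) has_derivative
       (\<lambda>v. - (inverse (f x) * frechet_derivative f (at x) v * inverse (f x)))) (at x)" if "x \<in> U" for x
      by (rule Deriv.has_derivative_inverse[OF nz[OF that] Ck_on_SucD[OF Suc.prems that]])
    show "Ck_on k UNIV U (\<lambda>x. - (inverse (f x) * frechet_derivative f (at x) v * inverse (f x)))" for v
      using Suc.prems by (intro Ck_on_minus Ck_on_mult U IH) auto
  qed
qed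

text \<open>Differentiating the linear system satisfied by z gives a system of the same kind for each
  directional derivative of z, so the regularity of z follows by induction.\<close>

lemma solution_Ck_on:
  fixes G :: "'e::euclidean_space \<Rightarrow> 'e \<Rightarrow> 'e \<Rightarrow> real"
  assumes U: "open U" and G: "\<And>y. y \<in> U \<Longrightarrow> inner_form (G y)"
    and Gk: "\<And>j u v. Ck_on j UNIV U (\<lambda>y. G y u v)"
  shows "(\<And>w. Ck_on k UNIV U (\<lambda>y. m y w)) \<Longrightarrow> (\<And>y w. y \<in> U \<Longrightarrow> G y (z y) w = m y w) \<Longrightarrow>
    Ck_on k UNIV U z"
proof (induction k arbitrary: m z)
  case 0
  note bl = inner_formD(1)[OF G]
  have "isCont z x" if x: "x \<in> U" for x
  proof -
    obtain e where e: "e > 0" "cball x e \<subseteq> U" using U x open_contains_cball by blast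
    obtain l L where l: "0 < l" "l \<le> (L::real)" "\<And>y u. y \<in> cball x e \<Longrightarrow> l * (norm u)\<^sup>2 \<le> G y u u"
      by (rule forms_uniformly_definite[of "cball x e" G])
         (use e G continuous_on_subset[OF Ck_on_continuous[OF Gk] e(2)] in auto)
    show ?thesis
    proof (rule solution_continuous[of "ball x e" x G l m z])
      show "isCont (\<lambda>y. G y u v) x" "isCont (\<lambda>y. m y w) x" for u v w
        using Ck_on_continuous[OF Gk] Ck_on_continuous[OF 0(1)] U x continuous_on_eq_continuous_at by blast+
      show "bilinear (G y)" "G y (z y) w = m y w" if "y \<in> ball x e" for y w
        using that e bl 0(2) ball_subset_cball by blast+
    qed (use e l in auto)
  qed
  then show ?case by (simp add: continuous_at_imp_continuous_on)
next
  case (Suc k)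
  note bl = inner_formD(1)[OF G]
  have zk: "Ck_on k UNIV U z" using Suc.IH[of m z] Ck_on_lower Suc.prems by blast
  have zd: "\<exists>z'. (z has_derivative z') (at x)" if x: "x \<in> U" for x
  proof (rule solution_differentiable[where G = G and m = m and x = x, OF U x])
    show "inner_form (G x)" by (rule G[OF x])
    show "bilinear (G y)" if "y \<in> U" for y by (rule bl[OF that])
    show "isCont z x" using Ck_on_continuous[OF zk] U x continuous_on_eq_continuous_at by blast
    show "((\<lambda>y. G y u v) has_derivative frechet_derivative (\<lambda>y. G y u v) (at x)) (at x)" for u v
      by (rule Ck_on_SucD[OF Gk x])
    show "((\<lambda>y. m y w) has_derivative frechet_derivative (\<lambda>y. m y w) (at x)) (at x)" for w
      by (rule Ck_on_SucD[OF Suc.prems(1) x])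
  qed (use Suc.prems in auto)
  then have zd': "(z has_derivative frechet_derivative z (at x)) (at x)" if "x \<in> U" for x
    using that frechet_derivative_works differentiable_def by blast
  define M where "M v y w = frechet_derivative (\<lambda>y. m y w) (at y) v -
     (\<Sum>i\<in>Basis. \<Sum>j\<in>Basis. (z y \<bullet> i) * (w \<bullet> j) * frechet_derivative (\<lambda>y. G y i j) (at y) v)" for v y w
  have eq: "G x (frechet_derivative z (at x) v) w = M v x w" if x: "x \<in> U" for v x w
  proof -
    define DG where "DG k u v = frechet_derivative (\<lambda>y. G y u v) (at x) k" for k u v
    have GD: "((\<lambda>y. G y u v) has_derivative (\<lambda>k. DG k u v)) (at x)" for u v
      unfolding DG_def using Ck_on_SucD[OF Gk x] by simp
    have "((\<lambda>y. G y u v) has_derivative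
        (\<lambda>k. \<Sum>i\<in>Basis. \<Sum>j\<in>Basis. (u \<bullet> i) * (v \<bullet> j) * DG k i j)) (at x)" for u v
    proof (rule has_derivative_transform_within_open[OF _ U x])
      show "((\<lambda>y. \<Sum>i\<in>Basis. \<Sum>j\<in>Basis. (u \<bullet> i) * (v \<bullet> j) * G y i j) has_derivative
        (\<lambda>k. \<Sum>i\<in>Basis. \<Sum>j\<in>Basis. (u \<bullet> i) * (v \<bullet> j) * DG k i j)) (at x)"
        by (intro has_derivative_sum has_derivative_mult_right GD)
    qed (rule bilinear_expand[OF bl, symmetric])
    then have exD: "DG k u v = (\<Sum>i\<in>Basis. \<Sum>j\<in>Basis. (u \<bullet> i) * (v \<bullet> j) * DG k i j)" for k u v
      by (rule fun_cong[OF has_derivative_unique[OF GD]])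
    have 1: "((\<lambda>y. G y (z y) w) has_derivative
       (\<lambda>k. DG k (z x) w + G x (frechet_derivative z (at x) k) w + G x (z x) 0)) (at x)"
      by (rule has_derivative_form[OF U x bl GD zd'[OF x] has_derivative_const])
    have 2: "((\<lambda>y. G y (z y) w) has_derivative frechet_derivative (\<lambda>y. m y w) (at x)) (at x)"
      by (rule has_derivative_transform_within_open[OF Ck_on_SucD[OF Suc.prems(1) x] U x])
         (use Suc.prems in auto)
    show ?thesis
      using fun_cong[OF has_derivative_unique[OF 1 2], of v]
      unfolding M_def exD[of v "z x" w] bilinear_rzero[OF bl[OF x]] by (simp add: DG_def)
  qed
  have "Ck_on k UNIV U (\<lambda>x. frechet_derivative z (at x) v)" for v
  proof (rule Suc.IH[of "M v"])
    show "Ck_on k UNIV U (\<lambda>y. M v y w)" for w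
      unfolding M_def
    proof (intro Ck_on_diff Ck_on_sum Ck_on_mult U Ck_on_const)
      show "Ck_on k UNIV U (\<lambda>x. frechet_derivative (\<lambda>y. m y w) (at x) v)" using Suc.prems(1)[of w] by auto
      show "Ck_on k UNIV U (\<lambda>x. frechet_derivative (\<lambda>y. G y i j) (at x) v)" for i j
        using Gk[of "Suc k" i j] by auto
      show "Ck_on k UNIV U (\<lambda>x. z x \<bullet> i)" for i
        by (rule Ck_on_linear[OF U bounded_linear_inner_left zk])
    qed
  qed (rule eq)
  then show ?case using zd by (auto simp: differentiable_def)
qed

lemma mean_value_pair:
  fixes f f' :: "real \<Rightarrow> real"
  assumes "0 < s" "\<And>t. 0 \<le> t \<Longrightarrow> t \<le> s \<Longrightarrow> (f has_real_derivative f' t) (at t)"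
  shows "\<exists>t\<in>{0..s}. f s - f 0 = s * f' t"
  using MVT2[of 0 s f f'] assms by fastforce

text \<open>The second difference quotient is symmetric in u and v, and by the mean value theorem, applied
  first in the direction u and then in the direction v, it is a value of the iterated derivative; this
  gives Schwarz's theorem below.\<close>

lemma second_difference_mean_value:
  fixes f :: "'e::euclidean_space \<Rightarrow> real"
  assumes C: "Ck_on 2 UNIV U f" and s: "0 < s"
    and sub: "\<And>a b. 0 \<le> a \<Longrightarrow> a \<le> s \<Longrightarrow> 0 \<le> b \<Longrightarrow> b \<le> s \<Longrightarrow> x + a *\<^sub>R u + b *\<^sub>R v \<in> U"
  shows "\<exists>a\<in>{0..s}. \<exists>b\<in>{0..s}.
     f (x + s *\<^sub>R u + s *\<^sub>R v) - f (x + s *\<^sub>R u) - f (x + s *\<^sub>R v) + f x =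
     s\<^sup>2 * frechet_derivative (\<lambda>y. frechet_derivative f (at y) u) (at (x + a *\<^sub>R u + b *\<^sub>R v)) v"
proof -
  have C1: "Ck_on (Suc 0) UNIV U (\<lambda>y. frechet_derivative f (at y) u)" and C2: "Ck_on (Suc (Suc 0)) UNIV U f"
    using C by (auto simp: numeral_2_eq_2)
  have der: "((\<lambda>a. f (x + a *\<^sub>R u + b *\<^sub>R v)) has_real_derivative
      frechet_derivative f (at (x + a *\<^sub>R u + b *\<^sub>R v)) u) (at a)"
    if "0 \<le> a" "a \<le> s" "0 \<le> b" "b \<le> s" for a b
  proof -
    have fd: "(f has_derivative frechet_derivative f (at (x + a *\<^sub>R u + b *\<^sub>R v))) (at (x + a *\<^sub>R u + b *\<^sub>R v))"
      using Ck_on_SucD[OF C2] sub that by auto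
    have "((\<lambda>a. f (x + a *\<^sub>R u + b *\<^sub>R v)) has_derivative
       (\<lambda>h. frechet_derivative f (at (x + a *\<^sub>R u + b *\<^sub>R v)) (h *\<^sub>R u))) (at a)"
      by (rule has_derivative_compose[where f = "\<lambda>a. x + a *\<^sub>R u + b *\<^sub>R v", OF _ fd]) (auto intro!: derivative_eq_intros)
    then show ?thesis
      unfolding has_field_derivative_def linear_scale[OF has_derivative_linear[OF fd]] real_scaleR_def
      by (rule has_derivative_eq_rhs) (simp add: fun_eq_iff)
  qed
  have "\<exists>a\<in>{0..s}.
    (f (x + s *\<^sub>R u + s *\<^sub>R v) - f (x + s *\<^sub>R u + 0 *\<^sub>R v)) - (f (x + 0 *\<^sub>R u + s *\<^sub>R v) - f (x + 0 *\<^sub>R u + 0 *\<^sub>R v)) =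
     s * (frechet_derivative f (at (x + a *\<^sub>R u + s *\<^sub>R v)) u - frechet_derivative f (at (x + a *\<^sub>R u + 0 *\<^sub>R v)) u)"
  proof (rule mean_value_pair[OF s, of "\<lambda>a. f (x + a *\<^sub>R u + s *\<^sub>R v) - f (x + a *\<^sub>R u + 0 *\<^sub>R v)"])
    show "((\<lambda>a. f (x + a *\<^sub>R u + s *\<^sub>R v) - f (x + a *\<^sub>R u + 0 *\<^sub>R v)) has_real_derivative
      frechet_derivative f (at (x + a *\<^sub>R u + s *\<^sub>R v)) u - frechet_derivative f (at (x + a *\<^sub>R u + 0 *\<^sub>R v)) u) (at a)"
      if "0 \<le> a" "a \<le> s" for a
      by (rule DERIV_diff; rule der) (use that s in auto)
  qed
  then obtain a where a: "a \<in> {0..s}"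
    "(f (x + s *\<^sub>R u + s *\<^sub>R v) - f (x + s *\<^sub>R u + 0 *\<^sub>R v)) - (f (x + 0 *\<^sub>R u + s *\<^sub>R v) - f (x + 0 *\<^sub>R u + 0 *\<^sub>R v)) =
     s * (frechet_derivative f (at (x + a *\<^sub>R u + s *\<^sub>R v)) u - frechet_derivative f (at (x + a *\<^sub>R u + 0 *\<^sub>R v)) u)"
    by blast
  have der2: "((\<lambda>b. frechet_derivative f (at (x + a *\<^sub>R u + b *\<^sub>R v)) u) has_real_derivative
      frechet_derivative (\<lambda>y. frechet_derivative f (at y) u) (at (x + a *\<^sub>R u + b *\<^sub>R v)) v) (at b)"
    if "0 \<le> b" "b \<le> s" for b
  proof -
    let ?g = "\<lambda>y. frechet_derivative f (at y) u"
    have fd: "(?g has_derivative frechet_derivative ?g (at (x + a *\<^sub>R u + b *\<^sub>R v))) (at (x + a *\<^sub>R u + b *\<^sub>R v))"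
      using Ck_on_SucD[OF C1] sub that a by auto
    have "((\<lambda>b. ?g (x + a *\<^sub>R u + b *\<^sub>R v)) has_derivative
       (\<lambda>h. frechet_derivative ?g (at (x + a *\<^sub>R u + b *\<^sub>R v)) (h *\<^sub>R v))) (at b)"
      by (rule has_derivative_compose[where f = "\<lambda>b. x + a *\<^sub>R u + b *\<^sub>R v", OF _ fd]) (auto intro!: derivative_eq_intros)
    then show ?thesis
      unfolding has_field_derivative_def linear_scale[OF has_derivative_linear[OF fd]] real_scaleR_def
      by (rule has_derivative_eq_rhs) (simp add: fun_eq_iff)
  qed
  obtain b where b: "b \<in> {0..s}"
    "frechet_derivative f (at (x + a *\<^sub>R u + s *\<^sub>R v)) u - frechet_derivative f (at (x + a *\<^sub>R u + 0 *\<^sub>R v)) u =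
     s * frechet_derivative (\<lambda>y. frechet_derivative f (at y) u) (at (x + a *\<^sub>R u + b *\<^sub>R v)) v"
    using mean_value_pair[OF s, of "\<lambda>b. frechet_derivative f (at (x + a *\<^sub>R u + b *\<^sub>R v)) u", OF der2] by blast
  show ?thesis
    by (rule bexI[OF _ a(1)], rule bexI[OF _ b(1)]) (use a(2) b(2) in \<open>simp add: power2_eq_square\<close>)
qed

lemma second_derivative_limit:
  fixes f :: "'e::euclidean_space \<Rightarrow> real"
  assumes U: "open U" "x \<in> U" and C: "Ck_on 2 UNIV U f"
  shows "((\<lambda>s. (f (x + s *\<^sub>R u + s *\<^sub>R v) - f (x + s *\<^sub>R u) - f (x + s *\<^sub>R v) + f x) / s\<^sup>2) \<longlongrightarrow>
     frechet_derivative (\<lambda>y. frechet_derivative f (at y) u) (at x) v) (at_right 0)"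
proof (rule tendstoI)
  fix e :: real assume e: "e > 0"
  let ?h = "\<lambda>y. frechet_derivative (\<lambda>y. frechet_derivative f (at y) u) (at y) v"
  have "continuous_on U ?h" using C by (auto simp: numeral_2_eq_2)
  then have "isCont ?h x" using U continuous_on_eq_continuous_at by blast
  then obtain d0 where d0: "d0 > 0" "\<And>y. dist y x < d0 \<Longrightarrow> dist (?h y) (?h x) < e"
    using e unfolding continuous_at_eps_delta by blast
  obtain d1 where d1: "d1 > 0" "ball x d1 \<subseteq> U" using U open_contains_ball by blast
  define \<delta> where "\<delta> = min d0 d1 / (norm u + norm v + 1)"
  have \<delta>: "\<delta> > 0" using d0 d1 unfolding \<delta>_def by (auto intro!: divide_pos_pos add_nonneg_pos)
  have near: "dist (x + a *\<^sub>R u + b *\<^sub>R v) x < min d0 d1"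
    if "0 \<le> a" "a \<le> s" "0 \<le> b" "b \<le> s" "s < \<delta>" for a b s
  proof -
    have "dist (x + a *\<^sub>R u + b *\<^sub>R v) x \<le> a * norm u + b * norm v"
      using norm_triangle_ineq[of "a *\<^sub>R u" "b *\<^sub>R v"] that by (simp add: dist_norm)
    also have "\<dots> \<le> s * norm u + s * norm v"
      using that by (intro add_mono mult_right_mono) auto
    also have "\<dots> \<le> s * (norm u + norm v + 1)" using that by (simp add: algebra_simps)
    also have "\<dots> < \<delta> * (norm u + norm v + 1)"
      using that by (intro mult_strict_right_mono add_nonneg_pos) auto
    also have "\<dots> = min d0 d1" unfolding \<delta>_def using add_nonneg_pos[of "norm u + norm v" 1] by auto
    finally show ?thesis .
  qed
  have "dist ((f (x + s *\<^sub>R u + s *\<^sub>R v) - f (x + s *\<^sub>R u) - f (x + s *\<^sub>R v) + f x) / s\<^sup>2) (?h x) < e"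
    if s: "0 < s" "s < \<delta>" for s
  proof -
    have "\<exists>a\<in>{0..s}. \<exists>b\<in>{0..s}.
      f (x + s *\<^sub>R u + s *\<^sub>R v) - f (x + s *\<^sub>R u) - f (x + s *\<^sub>R v) + f x = s\<^sup>2 * ?h (x + a *\<^sub>R u + b *\<^sub>R v)"
      by (rule second_difference_mean_value[OF C s(1)])
         (use near s d1 in \<open>force simp: dist_commute\<close>)
    then obtain a b where ab: "a \<in> {0..s}" "b \<in> {0..s}"
      "f (x + s *\<^sub>R u + s *\<^sub>R v) - f (x + s *\<^sub>R u) - f (x + s *\<^sub>R v) + f x = s\<^sup>2 * ?h (x + a *\<^sub>R u + b *\<^sub>R v)"
      by blast
    show ?thesis unfolding ab(3) using d0(2)[of "x + a *\<^sub>R u + b *\<^sub>R v"] near[of a s b] ab s by simp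
  qed
  then show "\<forall>\<^sub>F s in at_right 0. dist ((f (x + s *\<^sub>R u + s *\<^sub>R v) - f (x + s *\<^sub>R u) - f (x + s *\<^sub>R v) + f x) / s\<^sup>2) (?h x) < e"
    unfolding eventually_at_right_field using \<delta> by auto
qed

lemma second_derivative_symmetric_real:
  fixes f :: "'e::euclidean_space \<Rightarrow> real"
  assumes U: "open U" "x \<in> U" and C: "Ck_on 2 UNIV U f"
  shows "frechet_derivative (\<lambda>y. frechet_derivative f (at y) u) (at x) v =
         frechet_derivative (\<lambda>y. frechet_derivative f (at y) v) (at x) u"
proof (rule tendsto_unique[OF _ second_derivative_limit[OF U C, of u v]])
  show "((\<lambda>s. (f (x + s *\<^sub>R u + s *\<^sub>R v) - f (x + s *\<^sub>R u) - f (x + s *\<^sub>R v) + f x) / s\<^sup>2) \<longlongrightarrow>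
     frechet_derivative (\<lambda>y. frechet_derivative f (at y) v) (at x) u) (at_right 0)"
    using second_derivative_limit[OF U C, of v u] by (simp add: algebra_simps)
qed simp

lemma frechet_derivative_inner:
  assumes "(f has_derivative f') (at y)"
  shows "frechet_derivative (\<lambda>y. f y \<bullet> i) (at y) u = f' u \<bullet> i"
  using frechet_derivative_at[OF has_derivative_inner_left[OF assms, of i]] by metis

lemma second_derivative_symmetric:
  fixes f :: "'e::euclidean_space \<Rightarrow> 'f::euclidean_space"
  assumes U: "open U" "x \<in> U" and C: "Ck_on 2 UNIV U f"
  shows "frechet_derivative (\<lambda>y. frechet_derivative f (at y) u) (at x) v =
         frechet_derivative (\<lambda>y. frechet_derivative f (at y) v) (at x) u"
proof (rule euclidean_eqI)
  fix i :: 'f assume "i \<in> Basis"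
  have C2: "Ck_on (Suc (Suc 0)) UNIV U f" using C by (simp add: numeral_2_eq_2)
  have C1: "Ck_on (Suc 0) UNIV U (\<lambda>y. frechet_derivative f (at y) u)" for u
    using C by (auto simp: numeral_2_eq_2)
  have 1: "frechet_derivative (\<lambda>y. f y \<bullet> i) (at y) u = frechet_derivative f (at y) u \<bullet> i" if "y \<in> U" for y u
    by (rule frechet_derivative_inner[OF Ck_on_SucD[OF C2 that]])
  have 2: "frechet_derivative (\<lambda>y. frechet_derivative (\<lambda>y. f y \<bullet> i) (at y) u) (at x) v =
      frechet_derivative (\<lambda>y. frechet_derivative f (at y) u) (at x) v \<bullet> i" for u v
  proof -
    have "((\<lambda>y. frechet_derivative (\<lambda>y. f y \<bullet> i) (at y) u) has_derivative
       (\<lambda>v. frechet_derivative (\<lambda>y. frechet_derivative f (at y) u) (at x) v \<bullet> i)) (at x)"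
      by (rule has_derivative_transform_within_open[OF has_derivative_inner_left[OF Ck_on_SucD[OF C1 U(2)]] U])
         (simp add: 1)
    from frechet_derivative_at[OF this] show ?thesis by metis
  qed
  show "frechet_derivative (\<lambda>y. frechet_derivative f (at y) u) (at x) v \<bullet> i =
        frechet_derivative (\<lambda>y. frechet_derivative f (at y) v) (at x) u \<bullet> i"
    using second_derivative_symmetric_real[OF U Ck_on_linear[OF U(1) bounded_linear_inner_left C], of i u v]
    by (simp add: 2)
qed

lemma Ck_on_Lipschitz:
  fixes f :: "'e::euclidean_space \<Rightarrow> real"
  assumes C: "Ck_on 1 UNIV U f" and K: "compact K" "convex K" "K \<subseteq> U"
  obtains L where "0 \<le> L" "\<And>x y. x \<in> K \<Longrightarrow> y \<in> K \<Longrightarrow> \<bar>f x - f y\<bar> \<le> L * norm (x - y)"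
proof -
  have C': "Ck_on (Suc 0) UNIV U f" using C by simp
  have "\<exists>M. \<forall>x\<in>K. \<bar>frechet_derivative f (at x) i\<bar> \<le> M" for i
  proof -
    have "continuous_on K (\<lambda>x. frechet_derivative f (at x) i)"
      using C' K(3) by (auto intro: continuous_on_subset)
    then have "bounded ((\<lambda>x. frechet_derivative f (at x) i) ` K)"
      using K(1) compact_continuous_image compact_imp_bounded by blast
    then show ?thesis unfolding bounded_iff by auto
  qed
  then obtain M where M: "\<And>i x. x \<in> K \<Longrightarrow> \<bar>frechet_derivative f (at x) i\<bar> \<le> M i" by metis
  define L where "L = (\<Sum>i\<in>Basis. \<bar>M i\<bar>)"
  have on: "onorm (frechet_derivative f (at x)) \<le> L" if x: "x \<in> K" for x
  proof (rule onorm_le)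
    fix u
    have lin: "linear (frechet_derivative f (at x))"
      using has_derivative_linear[OF Ck_on_SucD[OF C']] x K by auto
    have "\<bar>frechet_derivative f (at x) u\<bar> \<le> (\<Sum>i\<in>Basis. \<bar>(u \<bullet> i) * frechet_derivative f (at x) i\<bar>)"
      unfolding linear_expand[OF lin, of u] by (rule sum_abs)
    also have "\<dots> \<le> (\<Sum>i\<in>Basis. norm u * \<bar>M i\<bar>)"
      unfolding abs_mult
      by (intro sum_mono mult_mono Basis_le_norm order_trans[OF M[OF x] abs_ge_self]) auto
    finally show "norm (frechet_derivative f (at x) u) \<le> L * norm u"
      by (simp add: L_def sum_distrib_left mult.commute)
  qed
  show ?thesis
  proof (rule that[of L])
    show "0 \<le> L" by (simp add: L_def sum_nonneg)
    show "\<bar>f x - f y\<bar> \<le> L * norm (x - y)" if "x \<in> K" "y \<in> K" for x y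
    proof -
      have "(f has_derivative frechet_derivative f (at z)) (at z within K)" if "z \<in> K" for z
        using has_derivative_at_withinI[OF Ck_on_SucD[OF C']] that K(3) by blast
      from differentiable_bound[OF K(2) this on that(2,1)] show ?thesis
        by (simp add: abs_minus_commute norm_minus_commute)
    qed
  qed
qed

section \<open>Charts and tangent vectors\<close>

locale smooth_mfd =
  fixes A :: "('a::{t2_space, second_countable_topology}, 'e::euclidean_space) chart set"
  assumes mfd: "smooth_manifold UNIV A"
begin

lemma
  assumes "c \<in> A"
  shows open_dom: "open (chart_dom c)" and open_image: "open (chart_image c)"
    and homeo: "homeomorphism (chart_dom c) (chart_image c) (chart_map c) (chart_inv c)"
    and cont_chart: "continuous_on (chart_dom c) (chart_map c)"
    and cont_inv: "continuous_on (chart_image c) (chart_inv c)"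
proof -
  show "open (chart_dom c)" "open (chart_image c)"
    and h: "homeomorphism (chart_dom c) (chart_image c) (chart_map c) (chart_inv c)"
    using mfd assms unfolding smooth_manifold_def by auto
  show "continuous_on (chart_dom c) (chart_map c)" "continuous_on (chart_image c) (chart_inv c)"
    using h unfolding homeomorphism_def by auto
qed

lemma inv_chart: "c \<in> A \<Longrightarrow> p \<in> chart_dom c \<Longrightarrow> chart_inv c (chart_map c p) = p"
  using homeo unfolding homeomorphism_def by blast

lemma chart_inv_inv: "c \<in> A \<Longrightarrow> x \<in> chart_image c \<Longrightarrow> chart_map c (chart_inv c x) = x"
  using homeo unfolding homeomorphism_def by blast

lemma inv_in_dom: "c \<in> A \<Longrightarrow> x \<in> chart_image c \<Longrightarrow> chart_inv c x \<in> chart_dom c"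
  using inv_chart by fastforce

lemma chart_exists: "\<exists>c\<in>A. p \<in> chart_dom c"
  using mfd unfolding smooth_manifold_def by blast

lemma chart_at: "chart_at A p \<in> A" "p \<in> chart_dom (chart_at A p)"
  using someI_ex[OF chart_exists[of p, unfolded Bex_def]] unfolding chart_at_def by blast+

lemma isCont_chart: "c \<in> A \<Longrightarrow> p \<in> chart_dom c \<Longrightarrow> isCont (chart_map c) p"
  using cont_chart open_dom continuous_on_eq_continuous_at by blast

abbreviation overlap where "overlap c d \<equiv> chart_map c ` (chart_dom c \<inter> chart_dom d)"

lemma open_overlap: assumes "c \<in> A" "d \<in> A" shows "open (overlap c d)"
proof -
  have "overlap c d = chart_image c \<inter> chart_inv c -` chart_dom d"
    using inv_chart[OF assms(1)] by (auto simp: image_iff)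
  then show ?thesis
    using continuous_open_preimage[OF cont_inv open_image open_dom] assms by metis
qed

lemma transition_Ck: "c \<in> A \<Longrightarrow> d \<in> A \<Longrightarrow> Ck_on k UNIV (overlap c d) (transition c d)"
  using mfd unfolding smooth_manifold_def smooth_on_def by blast

lemma transition_chart: "c \<in> A \<Longrightarrow> p \<in> chart_dom c \<Longrightarrow> transition c d (chart_map c p) = chart_map d p"
  by (simp add: transition_def inv_chart)

text \<open>The derivative of a transition map, which transforms the coordinates of tangent vectors.\<close>

definition dtr where "dtr c d x = frechet_derivative (transition c d) (at x)"

lemma transition_deriv:
  assumes "c \<in> A" "d \<in> A" "p \<in> chart_dom c" "p \<in> chart_dom d"
  shows "(transition c d has_derivative dtr c d (chart_map c p)) (at (chart_map c p))"
  unfolding dtr_def by (rule Ck_on_SucD[OF transition_Ck[OF assms(1,2)]]) (use assms in auto)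

lemma linear_dtr:
  "c \<in> A \<Longrightarrow> d \<in> A \<Longrightarrow> p \<in> chart_dom c \<Longrightarrow> p \<in> chart_dom d \<Longrightarrow> linear (dtr c d (chart_map c p))"
  using transition_deriv has_derivative_linear by blast

lemma dtr_chain:
  assumes "c \<in> A" "d \<in> A" "e \<in> A" "p \<in> chart_dom c" "p \<in> chart_dom d" "p \<in> chart_dom e"
  shows "dtr c e (chart_map c p) u = dtr d e (chart_map d p) (dtr c d (chart_map c p) u)"
proof -
  have 1: "(transition d e has_derivative dtr d e (chart_map d p)) (at (transition c d (chart_map c p)))"
    using transition_deriv[of d e p] assms by (simp add: transition_chart)
  have 2: "((\<lambda>x. transition d e (transition c d x)) has_derivative
     (\<lambda>u. dtr d e (chart_map d p) (dtr c d (chart_map c p) u))) (at (chart_map c p))"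
    by (rule has_derivative_compose[OF transition_deriv 1]) (use assms in auto)
  have "(transition c e has_derivative
     (\<lambda>u. dtr d e (chart_map d p) (dtr c d (chart_map c p) u))) (at (chart_map c p))"
    by (rule has_derivative_transform_within_open[OF 2 open_overlap[of c d]])
       (use assms in \<open>auto simp: transition_chart\<close>)
  from has_derivative_unique[OF transition_deriv[of c e p] this] show ?thesis
    using assms by (auto dest: fun_cong)
qed

lemma dtr_self:
  assumes "c \<in> A" "p \<in> chart_dom c"
  shows "dtr c c (chart_map c p) u = u"
proof -
  have "(transition c c has_derivative (\<lambda>u. u)) (at (chart_map c p))"
    by (rule has_derivative_transform_within_open[OF has_derivative_ident open_image[of c]])
       (use assms in \<open>auto simp: transition_chart\<close>)
  from has_derivative_unique[OF transition_deriv[of c c p] this] show ?thesis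
    using assms by (auto dest: fun_cong)
qed

lemma dtr_inverse:
  assumes "c \<in> A" "d \<in> A" "p \<in> chart_dom c" "p \<in> chart_dom d"
  shows "dtr d c (chart_map d p) (dtr c d (chart_map c p) u) = u"
  using dtr_chain[of c d c p u] dtr_self assms by simp

lemma to_tangent_dtr: "to_tangent UNIV A c p u = dtr c (chart_at A p) (chart_map c p) u"
  by (simp add: to_tangent_def dtr_def)

lemma linear_to_tangent:
  "c \<in> A \<Longrightarrow> p \<in> chart_dom c \<Longrightarrow> linear (to_tangent UNIV A c p)"
  using linear_dtr[OF _ chart_at(1) _ chart_at(2)] by (simp add: to_tangent_dtr[abs_def])

lemma to_tangent_change:
  assumes "c \<in> A" "d \<in> A" "p \<in> chart_dom c" "p \<in> chart_dom d"
  shows "to_tangent UNIV A c p u = to_tangent UNIV A d p (dtr c d (chart_map c p) u)"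
  unfolding to_tangent_dtr using dtr_chain[OF assms(1,2) chart_at(1) assms(3,4) chart_at(2)] .

lemma to_tangent_surj:
  assumes "c \<in> A" "p \<in> chart_dom c"
  shows "\<exists>u. to_tangent UNIV A c p u = v"
  unfolding to_tangent_dtr
  using dtr_inverse[OF chart_at(1) assms(1) chart_at(2) assms(2)] by blast

lemma to_tangent_zero_iff:
  assumes "c \<in> A" "p \<in> chart_dom c"
  shows "to_tangent UNIV A c p u = 0 \<longleftrightarrow> u = 0"
proof
  assume "to_tangent UNIV A c p u = 0"
  then have "dtr (chart_at A p) c (chart_map (chart_at A p) p) (dtr c (chart_at A p) (chart_map c p) u) = 0"
    using linear_0[OF linear_dtr[OF chart_at(1) assms(1) chart_at(2) assms(2)]]
    by (simp add: to_tangent_dtr)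
  then show "u = 0" using dtr_inverse[OF assms(1) chart_at(1) assms(2) chart_at(2)] by simp
qed (simp add: linear_0[OF linear_to_tangent[OF assms]])

lemma eventually_in_dom:
  assumes "c \<in> A" "continuous (at t within I) \<gamma>" "\<gamma> t \<in> chart_dom c"
  shows "\<forall>\<^sub>F s in at t within I. \<gamma> s \<in> chart_dom c"
  using assms open_dom[OF assms(1)] topological_tendstoD unfolding continuous_within by blast

lemma curve_change_chart:
  assumes cd: "c \<in> A" "d \<in> A" and t: "\<gamma> t \<in> chart_dom c" "\<gamma> t \<in> chart_dom d"
    and \<gamma>: "continuous (at t within I) \<gamma>" "t \<in> I"
    and D: "((chart_map c \<circ> \<gamma>) has_vector_derivative D) (at t within I)"
  shows "((chart_map d \<circ> \<gamma>) has_vector_derivative dtr c d (chart_map c (\<gamma> t)) D) (at t within I)"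
proof -
  note td = transition_deriv[OF cd t]
  have "((transition c d \<circ> (chart_map c \<circ> \<gamma>)) has_derivative
      (\<lambda>h. dtr c d (chart_map c (\<gamma> t)) (h *\<^sub>R D))) (at t within I)"
    using diff_chain_within[of "chart_map c \<circ> \<gamma>" "\<lambda>h. h *\<^sub>R D" t I "transition c d" "dtr c d (chart_map c (\<gamma> t))"]
      D has_derivative_at_withinI[OF td] unfolding has_vector_derivative_def by (simp add: o_def)
  then have "((transition c d \<circ> (chart_map c \<circ> \<gamma>)) has_vector_derivative
      dtr c d (chart_map c (\<gamma> t)) D) (at t within I)"
    unfolding has_vector_derivative_def linear_scale[OF has_derivative_linear[OF td]] .
  moreover have "\<forall>\<^sub>F s in at t within I. (transition c d \<circ> (chart_map c \<circ> \<gamma>)) s = (chart_map d \<circ> \<gamma>) s"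
    using eventually_in_dom[OF cd(1) \<gamma>(1) t(1)] by eventually_elim (simp add: transition_chart cd)
  moreover have "(transition c d \<circ> (chart_map c \<circ> \<gamma>)) t = (chart_map d \<circ> \<gamma>) t"
    by (simp add: transition_chart cd t)
  ultimately show ?thesis
    unfolding has_vector_derivative_def by (rule has_derivative_transform_eventually) (rule \<gamma>(2))
qed

lemma velocity_eq:
  assumes "c \<in> A" "\<gamma> t \<in> chart_dom c" "isCont \<gamma> t"
    and "((chart_map c \<circ> \<gamma>) has_vector_derivative D) (at t)"
  shows "velocity A \<gamma> t = to_tangent UNIV A c (\<gamma> t) D"
  unfolding velocity_def to_tangent_dtr
  by (rule vector_derivative_at, rule curve_change_chart)
     (use assms chart_at in auto)

end

section \<open>Riemannian metrics in charts\<close>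

locale riemannian = smooth_mfd A
  for A :: "('a::{t2_space, second_countable_topology}, 'e::euclidean_space) chart set" +
  fixes g :: "'a \<Rightarrow> 'e \<Rightarrow> 'e \<Rightarrow> real"
  assumes metric: "riemannian_metric UNIV A g"
begin

abbreviation gc where "gc c \<equiv> metric_in_chart UNIV A c g"

lemma inner_form_g: "inner_form (g p)"
  using metric unfolding riemannian_metric_def inner_form_def by auto

lemma gc_chart: "c \<in> A \<Longrightarrow> p \<in> chart_dom c \<Longrightarrow>
    gc c (chart_map c p) u v = g p (to_tangent UNIV A c p u) (to_tangent UNIV A c p v)"
  by (simp add: metric_in_chart_def inv_chart)

lemma inner_form_pullback:
  assumes B: "inner_form B" and T: "linear T" "\<And>u. T u = 0 \<longleftrightarrow> u = 0"
  shows "inner_form (\<lambda>u v. B (T u) (T v))"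
  unfolding inner_form_def
proof (intro conjI allI impI)
  show "bilinear (\<lambda>u v. B (T u) (T v))"
    using inner_formD(1)[OF B] unfolding bilinear_def
    by (auto intro: linear_compose[OF T(1), unfolded o_def])
qed (use inner_formD[OF B] T in auto)

lemma inner_form_gc:
  assumes "c \<in> A" "x \<in> chart_image c"
  shows "inner_form (gc c x)"
proof -
  have "gc c x = (\<lambda>u v. g (chart_inv c x) (to_tangent UNIV A c (chart_inv c x) u)
      (to_tangent UNIV A c (chart_inv c x) v))"
    by (simp add: metric_in_chart_def Let_def fun_eq_iff)
  then show ?thesis
    using inner_form_pullback[OF inner_form_g linear_to_tangent to_tangent_zero_iff] inv_in_dom assms
    by auto
qed

lemmas bilinear_gc = inner_formD(1)[OF inner_form_gc]

lemma gc_Ck: "c \<in> A \<Longrightarrow> Ck_on k UNIV (chart_image c) (\<lambda>x. gc c x u v)"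
  using metric unfolding riemannian_metric_def smooth_on_def by blast

lemma gc_cont: "c \<in> A \<Longrightarrow> continuous_on (chart_image c) (\<lambda>x. gc c x u v)"
  using gc_Ck Ck_on_continuous by blast

lemma gc_change:
  assumes "c \<in> A" "d \<in> A" "p \<in> chart_dom c" "p \<in> chart_dom d"
  shows "gc c (chart_map c p) u v = gc d (chart_map d p)
     (dtr c d (chart_map c p) u) (dtr c d (chart_map c p) v)"
  using assms by (simp add: gc_chart to_tangent_change[of c d])

lemma speed_eq:
  assumes "c \<in> A" "\<gamma> t \<in> chart_dom c" "isCont \<gamma> t"
    and "((chart_map c \<circ> \<gamma>) has_vector_derivative D) (at t)"
  shows "tangent_norm g (\<gamma> t) (velocity A \<gamma> t) = sqrt (gc c (chart_map c (\<gamma> t)) D D)"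
  by (simp add: tangent_norm_def velocity_eq[OF assms] gc_chart assms)

end

section \<open>The perturbed metric\<close>

locale riemannian_form = riemannian A g
  for A :: "('a::{t2_space, second_countable_topology}, 'e::euclidean_space) chart set"
    and g :: "'a \<Rightarrow> 'e \<Rightarrow> 'e \<Rightarrow> real" +
  fixes \<mu> :: "'a \<Rightarrow> 'e \<Rightarrow> real"
  assumes one_form: "smooth_one_form UNIV A \<mu>"
begin

abbreviation N where "N p \<equiv> (tangent_norm g p (sharp UNIV g \<mu> p))\<^sup>2"

lemma linear_mu: "linear (\<mu> p)"
  using one_form unfolding smooth_one_form_def by blast

lemma sharp: "g p (sharp UNIV g \<mu> p) w = \<mu> p w"
  using theI'[OF inner_form_riesz[OF inner_form_g[of p] linear_mu[of p]]] unfolding sharp_def by simp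

lemma N_eq: "N p = \<mu> p (sharp UNIV g \<mu> p)"
  using inner_formD(4)[OF inner_form_g, of p "sharp UNIV g \<mu> p"] sharp unfolding tangent_norm_def by simp

text \<open>The form \<open>\<mu>\<close> is represented by its dual vector z, so \<open>\<mu>(v)\<^sup>2 \<le> |z|\<^sup>2 |v|\<^sup>2\<close> by the
  Cauchy-Schwarz inequality. Both the definiteness of the perturbed metric and the comparison that
  drives the completeness proof are consequences.\<close>

lemma perturbed_ge: "g p v v / (1 + N p) \<le> perturbed_metric UNIV g \<mu> p v v"
proof -
  have "(\<mu> p v)\<^sup>2 \<le> N p * g p v v"
    using inner_form_Cauchy_Schwarz[OF inner_form_g, of p "sharp UNIV g \<mu> p" v] by (simp add: sharp N_eq)
  moreover have pos: "0 < 1 + N p" by (intro add_pos_nonneg) auto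
  ultimately have "0 \<le> (N p * g p v v - (\<mu> p v)\<^sup>2) / (1 + N p)" by simp
  also have "\<dots> = ((1 + N p) * g p v v - (\<mu> p v)\<^sup>2 - g p v v) / (1 + N p)" by (simp add: algebra_simps)
  also have "\<dots> = perturbed_metric UNIV g \<mu> p v v - g p v v / (1 + N p)"
    unfolding perturbed_metric_def diff_divide_distrib using pos by (simp add: power2_eq_square)
  finally show ?thesis by simp
qed

lemma perturbed_in_chart:
  "metric_in_chart UNIV A c (perturbed_metric UNIV g \<mu>) x u v = gc c x u v -
     one_form_in_chart UNIV A c \<mu> x u * one_form_in_chart UNIV A c \<mu> x v * inverse (1 + N (chart_inv c x))"
  by (simp add: metric_in_chart_def one_form_in_chart_def perturbed_metric_def Let_def divide_inverse)

text \<open>In a chart the dual vector of \<open>\<mu>\<close> is the solution of a linear system whose coefficients are the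
  smooth components of the metric and of the form.\<close>

lemma N_Ck:
  assumes c: "c \<in> A"
  shows "Ck_on k UNIV (chart_image c) (\<lambda>x. N (chart_inv c x))"
proof -
  note U = open_image[OF c]
  let ?m = "one_form_in_chart UNIV A c \<mu>"
  let ?T = "\<lambda>x. to_tangent UNIV A c (chart_inv c x)"
  have "\<exists>z. ?T x z = sharp UNIV g \<mu> (chart_inv c x)" if "x \<in> chart_image c" for x
    using to_tangent_surj[OF c inv_in_dom[OF c that]] .
  then obtain z where z: "\<And>x. x \<in> chart_image c \<Longrightarrow> ?T x (z x) = sharp UNIV g \<mu> (chart_inv c x)"
    by metis
  have mk: "Ck_on k UNIV (chart_image c) (\<lambda>x. ?m x w)" for w
    using one_form c unfolding smooth_one_form_def smooth_on_def by blast
  have zeq: "gc c x (z x) w = ?m x w" if "x \<in> chart_image c" for x w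
    by (simp add: metric_in_chart_def one_form_in_chart_def Let_def z[OF that] sharp)
  have zk: "Ck_on k UNIV (chart_image c) z"
    by (rule solution_Ck_on[OF U inner_form_gc[OF c] gc_Ck[OF c] mk zeq])
  have eq: "(\<Sum>i\<in>Basis. (z x \<bullet> i) * ?m x i) = N (chart_inv c x)" if x: "x \<in> chart_image c" for x
  proof -
    have lin: "linear (?m x)"
      using linear_compose[OF linear_to_tangent[OF c inv_in_dom[OF c x]] linear_mu]
      by (simp add: one_form_in_chart_def[abs_def] Let_def o_def)
    show ?thesis unfolding linear_expand[OF lin, symmetric] N_eq
      by (simp add: one_form_in_chart_def Let_def z[OF x])
  qed
  have "Ck_on k UNIV (chart_image c) (\<lambda>x. \<Sum>i\<in>Basis. (z x \<bullet> i) * ?m x i)"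
    by (intro Ck_on_sum Ck_on_mult U mk Ck_on_linear[OF U bounded_linear_inner_left zk])
  from Ck_on_cong[OF U eq this] show ?thesis .
qed

lemma perturbed_riemannian: "riemannian_metric UNIV A (perturbed_metric UNIV g \<mu>)"
  unfolding riemannian_metric_def smooth_on_def
proof (intro conjI allI ballI impI)
  show "bilinear (perturbed_metric UNIV g \<mu> p)" for p
    unfolding bilinear_def perturbed_metric_def
    using inner_formD(1)[OF inner_form_g[of p]] linear_mu[of p]
    by (auto intro!: linearI simp: bilinear_ladd bilinear_radd bilinear_lmul bilinear_rmul
        linear_add linear_scale field_simps add_divide_distrib)
  show "perturbed_metric UNIV g \<mu> p u v = perturbed_metric UNIV g \<mu> p v u" for p u v
    unfolding perturbed_metric_def using inner_formD(2)[OF inner_form_g] by (simp add: mult.commute)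
  show "0 < perturbed_metric UNIV g \<mu> p v v" if "v \<noteq> 0" for p v
    using perturbed_ge[of p v] inner_formD(3)[OF inner_form_g that, of p]
    by (smt (verit) divide_pos_pos zero_le_power2)
  show "Ck_on k UNIV (chart_image c) (\<lambda>x. metric_in_chart UNIV A c (perturbed_metric UNIV g \<mu>) x u v)"
    if c: "c \<in> A" for c u v k
    unfolding perturbed_in_chart
  proof (intro Ck_on_diff Ck_on_mult Ck_on_inverse Ck_on_add Ck_on_const open_image c gc_Ck N_Ck)
    show "Ck_on k UNIV (chart_image c) (\<lambda>x. one_form_in_chart UNIV A c \<mu> x u)"
      "Ck_on k UNIV (chart_image c) (\<lambda>x. one_form_in_chart UNIV A c \<mu> x v)"
      using one_form c unfolding smooth_one_form_def smooth_on_def by blast+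
    show "1 + N (chart_inv c x) \<noteq> 0" for x by (smt (verit) zero_le_power2)
  qed
qed

end

text \<open>The zero-dimensional case: within the zero space every map is smooth, and no curve has unit
  speed, so geodesic completeness holds vacuously.\<close>

lemma Ck_on_zero_space: "U \<subseteq> {0} \<Longrightarrow> Ck_on k {0} U f"
proof (induction k arbitrary: f)
  case 0
  then show ?case using continuous_on_subset[OF continuous_on_sing] by auto
next
  case (Suc k)
  have "at x within {0} = bot" if "x \<in> U" for x
    using that Suc.prems by (auto simp: trivial_limit_within islimpt_finite)
  then have "h differentiable (at x within {0})" if "x \<in> U" for x and h :: "'a \<Rightarrow> 'b"
    using that unfolding differentiable_def has_derivative_def by (auto intro!: exI[of _ "\<lambda>_. 0"])
  then show ?case using Suc by auto
qed

lemma zero_manifold_image: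
  assumes "smooth_manifold {0} A" "c \<in> A"
  shows "chart_image c \<subseteq> {0}"
proof -
  have "openin (top_of_set {0}) (chart_image c)" using assms unfolding smooth_manifold_def by blast
  then show ?thesis by (rule openin_imp_subset)
qed

lemma zero_manifold_complete:
  fixes g :: "'a::{t2_space, second_countable_topology} \<Rightarrow> 'e::euclidean_space \<Rightarrow> 'e \<Rightarrow> real"
  assumes M: "smooth_manifold {0} A" and g: "\<And>p. bilinear (g p)"
  shows "geodesically_complete {0} A g"
proof -
  have im: "chart_map c p = 0" if "c \<in> A" "p \<in> chart_dom c" for c p
    using zero_manifold_image[OF M that(1)] that(2) by blast
  have "tangent_norm g (\<gamma> t) (velocity A \<gamma> t) = 0"
    if "open I" "t \<in> I" "geodesic_on {0} A g I \<gamma>" for I \<gamma> t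
  proof -
    have "\<exists>c\<in>A. \<gamma> t \<in> chart_dom c" using M unfolding smooth_manifold_def by blast
    then have "\<exists>c. c \<in> A \<and> \<gamma> t \<in> chart_dom c" by blast
    from someI_ex[OF this] have c: "chart_at A (\<gamma> t) \<in> A" "\<gamma> t \<in> chart_dom (chart_at A (\<gamma> t))"
      unfolding chart_at_def by blast+
    let ?c = "chart_at A (\<gamma> t)"
    have "open (chart_dom ?c)" using M c(1) unfolding smooth_manifold_def by blast
    moreover have "isCont \<gamma> t"
      using that continuous_on_eq_continuous_at unfolding geodesic_on_def by blast
    ultimately have "\<forall>\<^sub>F s in nhds t. \<gamma> s \<in> chart_dom ?c"
      using c(2) topological_tendstoD[of \<gamma> "\<gamma> t" "nhds t"] by (metis isCont_def tendsto_at_iff_tendsto_nhds)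
    then obtain T where T: "open T" "t \<in> T" "\<And>s. s \<in> T \<Longrightarrow> \<gamma> s \<in> chart_dom ?c"
      unfolding eventually_nhds by blast
    have "((chart_map ?c \<circ> \<gamma>) has_vector_derivative 0) (at t)"
      by (rule has_vector_derivative_transform_within_open[OF has_vector_derivative_const T(1,2)])
         (simp add: im[OF c(1) T(3)])
    then have "velocity A \<gamma> t = 0" unfolding velocity_def by (rule vector_derivative_at)
    then show ?thesis by (simp add: tangent_norm_def bilinear_lzero[OF g])
  qed
  then show ?thesis unfolding geodesically_complete_def by (metis all_not_in_conv zero_neq_one)
qed

lemma zero_manifold_perturbed:
  assumes M: "smooth_manifold {0} A" and g: "riemannian_metric {0} A g" and \<mu>: "smooth_one_form {0} A \<mu>"
  shows "riemannian_metric {0} A (perturbed_metric {0} g \<mu>)"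
  unfolding riemannian_metric_def smooth_on_def
proof (intro conjI allI ballI impI)
  have g': "bilinear (g p)" and \<mu>': "linear (\<mu> p)" for p
    using g \<mu> unfolding riemannian_metric_def smooth_one_form_def by auto
  show "bilinear (perturbed_metric {0} g \<mu> p)" for p
    unfolding bilinear_def perturbed_metric_def
    using g'[of p] \<mu>'[of p]
    by (auto intro!: linearI simp: bilinear_ladd bilinear_radd bilinear_lmul bilinear_rmul
        linear_add linear_scale field_simps add_divide_distrib)
  show "Ck_on k {0} (chart_image c) (\<lambda>x. metric_in_chart {0} A c (perturbed_metric {0} g \<mu>) x u v)"
    if "c \<in> A" for c u v k
    by (rule Ck_on_zero_space[OF zero_manifold_image[OF M that]])
qed auto

section \<open>Piecewise continuously differentiable curves\<close>

lemma subdivision_induct: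
  fixes K :: "real set"
  assumes K: "finite K"
    and free: "\<And>s t. a \<le> s \<Longrightarrow> s < t \<Longrightarrow> t \<le> b \<Longrightarrow> {s<..<t} \<inter> K = {} \<Longrightarrow> P s t"
    and join: "\<And>s m t. a \<le> s \<Longrightarrow> s < m \<Longrightarrow> m < t \<Longrightarrow> t \<le> b \<Longrightarrow> P s m \<Longrightarrow> P m t \<Longrightarrow> P s t"
  shows "a < b \<Longrightarrow> P a b"
proof -
  have "a \<le> s \<Longrightarrow> s < t \<Longrightarrow> t \<le> b \<Longrightarrow> card ({s<..<t} \<inter> K) = n \<Longrightarrow> P s t" for s t n
  proof (induction n arbitrary: s t rule: less_induct)
    case (less n)
    show ?case
    proof (cases "{s<..<t} \<inter> K = {}")
      case True then show ?thesis using free less.prems by auto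
    next
      case False
      then obtain m where m: "m \<in> K" "s < m" "m < t" by auto
      have "card ({s<..<m} \<inter> K) < n" "card ({m<..<t} \<inter> K) < n"
        unfolding less.prems(4)[symmetric]
        by (rule psubset_card_mono; use K m in auto)+
      then show ?thesis using less.IH[of _ s m] less.IH[of _ m t] join[of s m t] less.prems m by auto
    qed
  qed
  then show "a < b \<Longrightarrow> P a b" by blast
qed

context smooth_mfd
begin

text \<open>Piecewise continuously differentiable curves on an arbitrary interval: cutting, joining and
  reversing curves moves the interval away from the unit interval.\<close>

definition pc1 :: "real \<Rightarrow> real \<Rightarrow> (real \<Rightarrow> 'a) \<Rightarrow> bool" where
  "pc1 a b \<gamma> \<longleftrightarrow> continuous_on {a..b} \<gamma> \<and>
     (\<exists>K. finite K \<and> (\<forall>s t. a \<le> s \<and> s < t \<and> t \<le> b \<and> {s<..<t} \<inter> K = {} \<longrightarrow> C1_curve A s t \<gamma>))"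

lemma piecewise_C1_path_pc1: "piecewise_C1_path A \<gamma> \<longleftrightarrow> pc1 0 1 \<gamma>"
  by (auto simp: piecewise_C1_path_def pc1_def path_def)

lemma C1_curve_subset:
  assumes "C1_curve A a b \<gamma>" "a \<le> a'" "b' \<le> b"
  shows "C1_curve A a' b' \<gamma>"
  unfolding C1_curve_def
proof (intro conjI ballI)
  have sub: "{a'..b'} \<subseteq> {a..b}" using assms by auto
  show "continuous_on {a'..b'} \<gamma>" using assms(1) sub unfolding C1_curve_def by (blast intro: continuous_on_subset)
  fix c assume "c \<in> A"
  then obtain D where D: "\<forall>t\<in>{a..b}. \<gamma> t \<in> chart_dom c \<longrightarrow>
      ((chart_map c \<circ> \<gamma>) has_vector_derivative D t) (at t within {a..b})"
    "continuous_on {t\<in>{a..b}. \<gamma> t \<in> chart_dom c} D"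
    using assms(1) unfolding C1_curve_def by blast
  show "\<exists>D. (\<forall>t\<in>{a'..b'}. \<gamma> t \<in> chart_dom c \<longrightarrow>
      ((chart_map c \<circ> \<gamma>) has_vector_derivative D t) (at t within {a'..b'})) \<and>
      continuous_on {t\<in>{a'..b'}. \<gamma> t \<in> chart_dom c} D"
  proof (intro exI[of _ D] conjI ballI impI)
    show "((chart_map c \<circ> \<gamma>) has_vector_derivative D t) (at t within {a'..b'})"
      if "t \<in> {a'..b'}" "\<gamma> t \<in> chart_dom c" for t
      using has_vector_derivative_within_subset[OF _ sub] D(1) that sub by blast
    show "continuous_on {t\<in>{a'..b'}. \<gamma> t \<in> chart_dom c} D"
      using D(2) by (rule continuous_on_subset) (use sub in auto)
  qed
qed

lemma pc1_C1: "C1_curve A a b \<gamma> \<Longrightarrow> pc1 a b \<gamma>"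
  unfolding pc1_def
  by (intro conjI exI[of _ "{}"] allI impI) (simp_all add: C1_curve_def[THEN iffD1, THEN conjunct1] C1_curve_subset)

lemma pc1_subset:
  assumes "pc1 a b \<gamma>" "a \<le> a'" "b' \<le> b"
  shows "pc1 a' b' \<gamma>"
proof -
  obtain K where "continuous_on {a..b} \<gamma>" "finite K"
    "\<forall>s t. a \<le> s \<and> s < t \<and> t \<le> b \<and> {s<..<t} \<inter> K = {} \<longrightarrow> C1_curve A s t \<gamma>"
    using assms(1) unfolding pc1_def by blast
  then show ?thesis unfolding pc1_def using assms(2,3)
    by (intro conjI exI[of _ K]) (auto elim: continuous_on_subset)
qed

lemma pc1_join:
  assumes "pc1 a m \<gamma>" "pc1 m b \<gamma>" "a \<le> m" "m \<le> b"
  shows "pc1 a b \<gamma>"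
proof -
  obtain K where K: "continuous_on {a..m} \<gamma>" "finite K"
    "\<forall>s t. a \<le> s \<and> s < t \<and> t \<le> m \<and> {s<..<t} \<inter> K = {} \<longrightarrow> C1_curve A s t \<gamma>"
    using assms(1) unfolding pc1_def by blast
  obtain L where L: "continuous_on {m..b} \<gamma>" "finite L"
    "\<forall>s t. m \<le> s \<and> s < t \<and> t \<le> b \<and> {s<..<t} \<inter> L = {} \<longrightarrow> C1_curve A s t \<gamma>"
    using assms(2) unfolding pc1_def by blast
  have "continuous_on ({a..m} \<union> {m..b}) \<gamma>"
    using K(1) L(1) by (intro continuous_on_closed_Un) auto
  moreover have "{a..m} \<union> {m..b} = {a..b}" using assms by auto
  moreover have "C1_curve A s t \<gamma>"
    if "a \<le> s" "s < t" "t \<le> b" "{s<..<t} \<inter> (insert m (K \<union> L)) = {}" for s t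
  proof -
    have "t \<le> m \<or> m \<le> s" using that by force
    then show ?thesis using K(3) L(3) that by (metis Int_Un_distrib Int_insert_right Un_empty insert_not_empty)
  qed
  ultimately show ?thesis unfolding pc1_def using K(2) L(2)
    by (intro conjI exI[of _ "insert m (K \<union> L)"]) auto
qed

lemma C1_curve_cong:
  assumes "C1_curve A a b \<gamma>" "\<And>t. t \<in> {a..b} \<Longrightarrow> \<gamma> t = \<delta> t"
  shows "C1_curve A a b \<delta>"
  unfolding C1_curve_def
proof (intro conjI ballI)
  show "continuous_on {a..b} \<delta>" using assms unfolding C1_curve_def by (metis continuous_on_eq)
  fix c assume "c \<in> A"
  then obtain D where D: "\<forall>t\<in>{a..b}. \<gamma> t \<in> chart_dom c \<longrightarrow>
      ((chart_map c \<circ> \<gamma>) has_vector_derivative D t) (at t within {a..b})"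
    "continuous_on {t\<in>{a..b}. \<gamma> t \<in> chart_dom c} D"
    using assms(1) unfolding C1_curve_def by blast
  have eq: "{t\<in>{a..b}. \<gamma> t \<in> chart_dom c} = {t\<in>{a..b}. \<delta> t \<in> chart_dom c}" using assms(2) by auto
  have hv: "((chart_map c \<circ> \<delta>) has_vector_derivative D t) (at t within {a..b})"
    if "t \<in> {a..b}" "\<delta> t \<in> chart_dom c" for t
    by (rule has_vector_derivative_transform[OF that(1) _ D(1)[rule_format, OF that(1)]])
       (use assms(2) that in auto)
  show "\<exists>D. (\<forall>t\<in>{a..b}. \<delta> t \<in> chart_dom c \<longrightarrow>
      ((chart_map c \<circ> \<delta>) has_vector_derivative D t) (at t within {a..b})) \<and>
      continuous_on {t\<in>{a..b}. \<delta> t \<in> chart_dom c} D"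
    using D(2)[unfolded eq] hv by blast
qed

lemma pc1_cong:
  assumes "pc1 a b \<gamma>" "\<And>t. t \<in> {a..b} \<Longrightarrow> \<gamma> t = \<delta> t"
  shows "pc1 a b \<delta>"
proof -
  obtain K where K: "continuous_on {a..b} \<gamma>" "finite K"
    "\<forall>s t. a \<le> s \<and> s < t \<and> t \<le> b \<and> {s<..<t} \<inter> K = {} \<longrightarrow> C1_curve A s t \<gamma>"
    using assms(1) unfolding pc1_def by blast
  have "C1_curve A s t \<delta>" if "a \<le> s \<and> s < t \<and> t \<le> b \<and> {s<..<t} \<inter> K = {}" for s t
    by (rule C1_curve_cong[of s t \<gamma>]) (use K(3) that assms(2) in auto)
  then show ?thesis unfolding pc1_def using K(1,2) assms(2) continuous_on_eq by blast
qed

lemma pc1_derivative: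
  assumes "pc1 a b \<gamma>"
  obtains K where "finite K" "\<And>t c. t \<in> {a<..<b} - K \<Longrightarrow> isCont \<gamma> t \<and>
     (c \<in> A \<longrightarrow> \<gamma> t \<in> chart_dom c \<longrightarrow> (\<exists>D. ((chart_map c \<circ> \<gamma>) has_vector_derivative D) (at t)))"
proof -
  obtain K where K: "finite K"
    "\<forall>s t. a \<le> s \<and> s < t \<and> t \<le> b \<and> {s<..<t} \<inter> K = {} \<longrightarrow> C1_curve A s t \<gamma>"
    using assms unfolding pc1_def by blast
  have cont: "isCont \<gamma> t" if "t \<in> {a<..<b}" for t
    using assms that unfolding pc1_def by (auto intro: continuous_on_interior)
  have "\<exists>D. ((chart_map c \<circ> \<gamma>) has_vector_derivative D) (at t)"
    if t: "t \<in> {a<..<b} - K" and c: "c \<in> A" "\<gamma> t \<in> chart_dom c" for t c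
  proof -
    have "open ({a<..<b} - K)" using K(1) finite_imp_closed by (intro open_Diff) auto
    then obtain e where e: "e > 0" "cball t e \<subseteq> {a<..<b} - K" using t open_contains_cball by blast
    then have sub: "{t - e..t + e} \<subseteq> {a<..<b} - K" by (simp add: cball_eq_atLeastAtMost)
    have "t - e \<in> {a<..<b} - K" "t + e \<in> {a<..<b} - K" by (rule subsetD[OF sub]; use e(1) in simp)+
    moreover have "{t - e<..<t + e} \<inter> K = {}"
      using sub order_trans[OF greaterThanLessThan_subseteq_atLeastAtMost_iff[THEN iffD2] sub] by blast
    ultimately have C: "C1_curve A (t - e) (t + e) \<gamma>" using K(2) e(1) by auto
    have "\<exists>D. \<forall>s\<in>{t - e..t + e}. \<gamma> s \<in> chart_dom c \<longrightarrow>
        ((chart_map c \<circ> \<gamma>) has_vector_derivative D s) (at s within {t - e..t + e})"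
      using C c(1) unfolding C1_curve_def by blast
    moreover have "t \<in> {t - e..t + e}" using e(1) by simp
    ultimately obtain D where "((chart_map c \<circ> \<gamma>) has_vector_derivative D t) (at t within {t - e..t + e})"
      using c(2) by blast
    then show ?thesis using e(1) by (auto simp: at_within_interior[of t "{t - e..t + e}"])
  qed
  then show ?thesis using that[of K] K(1) cont by blast
qed

lemma C1_curve_affine:
  assumes C: "C1_curve A a' b' \<gamma>" and \<phi>: "\<And>t. \<phi> t = \<alpha> * t + \<beta>" "\<phi> ` {a..b} \<subseteq> {a'..b'}"
  shows "C1_curve A a b (\<gamma> \<circ> \<phi>)"
  unfolding C1_curve_def
proof (intro conjI ballI)
  have cont: "continuous_on T \<phi>" for T unfolding \<phi>(1)[abs_def] by (intro continuous_intros)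
  have mem: "\<phi> t \<in> {a'..b'}" if "t \<in> {a..b}" for t using that \<phi> by blast
  have C0: "continuous_on {a'..b'} \<gamma>" using C unfolding C1_curve_def by blast
  show "continuous_on {a..b} (\<gamma> \<circ> \<phi>)"
    using continuous_on_compose[OF cont continuous_on_subset[OF C0 \<phi>(2)]] .
  fix c assume "c \<in> A"
  then obtain D where D: "\<forall>t\<in>{a'..b'}. \<gamma> t \<in> chart_dom c \<longrightarrow>
      ((chart_map c \<circ> \<gamma>) has_vector_derivative D t) (at t within {a'..b'})"
    "continuous_on {t\<in>{a'..b'}. \<gamma> t \<in> chart_dom c} D"
    using C unfolding C1_curve_def by blast
  show "\<exists>D. (\<forall>t\<in>{a..b}. (\<gamma> \<circ> \<phi>) t \<in> chart_dom c \<longrightarrow>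
      ((chart_map c \<circ> (\<gamma> \<circ> \<phi>)) has_vector_derivative D t) (at t within {a..b})) \<and>
      continuous_on {t\<in>{a..b}. (\<gamma> \<circ> \<phi>) t \<in> chart_dom c} D"
  proof (intro exI[of _ "\<lambda>t. \<alpha> *\<^sub>R D (\<phi> t)"] conjI ballI impI)
    fix t assume t: "t \<in> {a..b}" "(\<gamma> \<circ> \<phi>) t \<in> chart_dom c"
    have "(\<phi> has_vector_derivative \<alpha>) (at t within {a..b})"
      unfolding \<phi>(1)[abs_def] by (auto intro!: derivative_eq_intros)
    moreover have "((chart_map c \<circ> \<gamma>) has_vector_derivative D (\<phi> t)) (at (\<phi> t) within \<phi> ` {a..b})"
      using has_vector_derivative_within_subset[OF _ \<phi>(2)] D(1) t \<phi>(2) by (metis comp_apply image_subset_iff)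
    ultimately show "((chart_map c \<circ> (\<gamma> \<circ> \<phi>)) has_vector_derivative \<alpha> *\<^sub>R D (\<phi> t)) (at t within {a..b})"
      using vector_diff_chain_within by (metis comp_assoc)
  next
    show "continuous_on {t \<in> {a..b}. (\<gamma> \<circ> \<phi>) t \<in> chart_dom c} (\<lambda>t. \<alpha> *\<^sub>R D (\<phi> t))"
      by (intro continuous_intros continuous_on_compose2[OF D(2) cont]) (use mem in auto)
  qed
qed

lemma pc1_affine:
  assumes C: "pc1 a' b' \<gamma>" and \<phi>: "\<And>t. \<phi> t = \<alpha> * t + \<beta>" "\<alpha> \<noteq> 0" "\<phi> ` {a..b} \<subseteq> {a'..b'}"
  shows "pc1 a b (\<gamma> \<circ> \<phi>)"
proof -
  obtain K where K: "continuous_on {a'..b'} \<gamma>" "finite K"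
    "\<forall>s t. a' \<le> s \<and> s < t \<and> t \<le> b' \<and> {s<..<t} \<inter> K = {} \<longrightarrow> C1_curve A s t \<gamma>"
    using C unfolding pc1_def by blast
  have cont: "continuous_on T \<phi>" for T unfolding \<phi>(1)[abs_def] by (intro continuous_intros)
  have mem: "\<phi> t \<in> {a'..b'}" if "t \<in> {a..b}" for t using that \<phi> by blast
  have inj: "inj \<phi>" using \<phi>(1,2) by (auto intro!: injI)
  have "C1_curve A s t (\<gamma> \<circ> \<phi>)" if st: "a \<le> s" "s < t" "t \<le> b" "{s<..<t} \<inter> \<phi> -` K = {}" for s t
  proof -
    let ?l = "min (\<phi> s) (\<phi> t)" and ?u = "max (\<phi> s) (\<phi> t)"
    have ne: "\<phi> s \<noteq> \<phi> t" using inj st by (auto dest: injD)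
    have in_: "\<phi> s \<in> {a'..b'}" "\<phi> t \<in> {a'..b'}" using mem[of s] mem[of t] st by simp_all
    have pre: "\<exists>v\<in>{s<..<t}. \<phi> v = y" if "y \<in> {?l<..<?u}" for y
    proof (cases "\<alpha> > 0")
      case True
      have "s < (y - \<beta>) / \<alpha>" "(y - \<beta>) / \<alpha> < t"
        using that True st mult_strict_left_mono[OF st(2) True] by (auto simp: \<phi>(1) field_simps)
      then show ?thesis using \<phi>(1,2) by (intro bexI[of _ "(y - \<beta>) / \<alpha>"]) auto
    next
      case False
      then have "\<alpha> < 0" using \<phi>(2) by auto
      then have "s < (y - \<beta>) / \<alpha>" "(y - \<beta>) / \<alpha> < t"
        using that st mult_strict_left_mono_neg[OF st(2)] by (auto simp: \<phi>(1) field_simps)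
      then show ?thesis using \<phi>(1,2) by (intro bexI[of _ "(y - \<beta>) / \<alpha>"]) auto
    qed
    have "{?l<..<?u} \<inter> K = {}" using pre st(4) by fastforce
    then have C: "C1_curve A ?l ?u \<gamma>" using K(3) in_ ne by auto
    have "\<phi> ` {s..t} \<subseteq> {?l..?u}"
    proof (rule image_subsetI)
      fix v assume v: "v \<in> {s..t}"
      show "\<phi> v \<in> {?l..?u}"
      proof (cases "\<alpha> > 0")
        case True
        then have "\<alpha> * s \<le> \<alpha> * v" "\<alpha> * v \<le> \<alpha> * t" using v by auto
        then show ?thesis by (auto simp: \<phi>(1))
      next
        case False
        then have "\<alpha> * t \<le> \<alpha> * v" "\<alpha> * v \<le> \<alpha> * s" using v by (auto intro: mult_left_mono_neg)
        then show ?thesis by (auto simp: \<phi>(1))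
      qed
    qed
    then show ?thesis by (rule C1_curve_affine[OF C \<phi>(1)])
  qed
  moreover have "finite (\<phi> -` K)" using K(2) inj by (rule finite_vimageI)
  moreover have "continuous_on {a..b} (\<gamma> \<circ> \<phi>)"
    using continuous_on_compose[OF cont continuous_on_subset[OF K(1) \<phi>(3)]] .
  ultimately show ?thesis unfolding pc1_def by blast
qed

text \<open>A continuous curve starting in a coordinate ball either stays there or reaches the
  coordinate sphere; the Hausdorff property is what makes the closed coordinate ball closed.\<close>

lemma coordinate_ball_exit:
  assumes c: "c \<in> A" "cball x r \<subseteq> chart_image c" and \<gamma>: "continuous_on {a..b::real} \<gamma>"
    and start: "\<gamma> a \<in> chart_dom c" "chart_map c (\<gamma> a) \<in> ball x r"
  obtains "\<And>t. t \<in> {a..b} \<Longrightarrow> \<gamma> t \<in> chart_dom c \<and> chart_map c (\<gamma> t) \<in> ball x r"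
  | T where "T \<in> {a..b}" "norm (chart_map c (\<gamma> T) - x) = r"
    "\<And>t. t \<in> {a..T} \<Longrightarrow> \<gamma> t \<in> chart_dom c \<and> chart_map c (\<gamma> t) \<in> cball x r"
proof -
  define W where "W = chart_dom c \<inter> chart_map c -` ball x r"
  define C where "C = chart_inv c ` cball x r"
  have oW: "open W" unfolding W_def
    by (rule continuous_open_preimage[OF cont_chart[OF c(1)] open_dom[OF c(1)]]) simp
  have "compact C" unfolding C_def
    using c by (intro compact_continuous_image continuous_on_subset[OF cont_inv]) auto
  then have cC: "closed C" by (rule compact_imp_closed)
  have C: "p \<in> chart_dom c" "chart_map c p \<in> cball x r" if "p \<in> C" for p
  proof -
    obtain y where "y \<in> cball x r" "p = chart_inv c y" using \<open>p \<in> C\<close> unfolding C_def by blast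
    then show "p \<in> chart_dom c" "chart_map c p \<in> cball x r"
      using inv_in_dom[OF c(1)] chart_inv_inv[OF c(1)] c(2) by auto
  qed
  have WC: "W \<subseteq> C"
  proof
    fix p assume "p \<in> W"
    then have "p = chart_inv c (chart_map c p)" "chart_map c p \<in> cball x r"
      using inv_chart[OF c(1)] unfolding W_def by auto
    then show "p \<in> C" unfolding C_def by blast
  qed
  show ?thesis
  proof (cases "\<forall>t\<in>{a..b}. \<gamma> t \<in> W")
    case True
    then show ?thesis using that(1) unfolding W_def by auto
  next
    case False
    define Z where "Z = {t \<in> {a..b}. \<gamma> t \<notin> W}"
    have Z: "Z \<noteq> {}" using False unfolding Z_def by auto
    have "Z = {a..b} \<inter> \<gamma> -` (- W)" unfolding Z_def by auto
    then have clZ: "closed Z"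
      using continuous_closed_preimage[OF \<gamma> closed_real_atLeastAtMost, of "- W"] oW
      by (simp add: closed_Compl)
    have bZ: "bdd_below Z" unfolding Z_def by (intro bdd_belowI[of _ a]) auto
    define T where "T = Inf Z"
    have TZ: "T \<in> Z" unfolding T_def by (rule closed_contains_Inf[OF Z bZ clZ])
    have lt: "\<gamma> t \<in> W" if "t \<in> {a..<T}" for t
      using that cInf_lower[OF _ bZ, of t] TZ unfolding T_def[symmetric] by (force simp: Z_def)
    have T: "T \<in> {a..b}" "\<gamma> T \<notin> W" using TZ unfolding Z_def by auto
    have aT: "a < T" using T start unfolding W_def by (cases "a = T") auto
    have clV: "closed ({a..b} \<inter> \<gamma> -` C)"
      using continuous_closed_preimage[OF \<gamma> closed_real_atLeastAtMost cC] .
    have "{a..<T} \<subseteq> {a..b} \<inter> \<gamma> -` C"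
    proof
      fix t assume "t \<in> {a..<T}"
      then show "t \<in> {a..b} \<inter> \<gamma> -` C" using subsetD[OF WC lt] T(1) by simp
    qed
    then have "closure {a..<T} \<subseteq> {a..b} \<inter> \<gamma> -` C" by (rule closure_minimal[OF _ clV])
    then have inC: "\<gamma> t \<in> C" if "t \<in> {a..T}" for t using that aT by auto
    show ?thesis
    proof (rule that(2)[OF T(1)])
      show "\<gamma> t \<in> chart_dom c \<and> chart_map c (\<gamma> t) \<in> cball x r" if "t \<in> {a..T}" for t
        using C inC[OF that] by auto
      have "\<gamma> T \<in> C" using inC aT by simp
      then have "chart_map c (\<gamma> T) \<in> cball x r" "chart_map c (\<gamma> T) \<notin> ball x r"
        using C[of "\<gamma> T"] T(2) unfolding W_def by auto
      then show "norm (chart_map c (\<gamma> T) - x) = r" by (simp add: dist_norm norm_minus_commute)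
    qed
  qed
qed

lemma dtr_continuous:
  assumes cd: "c \<in> A" "d \<in> A" and \<xi>: "continuous_on T \<xi>" "\<xi> ` T \<subseteq> overlap c d" and \<eta>: "continuous_on T \<eta>"
  shows "continuous_on T (\<lambda>t. dtr c d (\<xi> t) (\<eta> t))"
proof -
  have "continuous_on (overlap c d) (\<lambda>x. dtr c d x i)" for i
    using transition_Ck[OF cd, of "Suc 0"] unfolding dtr_def by auto
  from continuous_on_compose2[OF this \<xi>]
  have "continuous_on T (\<lambda>t. \<Sum>i\<in>Basis. (\<eta> t \<bullet> i) *\<^sub>R dtr c d (\<xi> t) i)"
    by (intro continuous_intros \<eta>)
  moreover have "(\<Sum>i\<in>Basis. (\<eta> t \<bullet> i) *\<^sub>R dtr c d (\<xi> t) i) = dtr c d (\<xi> t) (\<eta> t)" if t: "t \<in> T" for t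
  proof -
    obtain p where p: "p \<in> chart_dom c" "p \<in> chart_dom d" "\<xi> t = chart_map c p" using t \<xi>(2) by blast
    have "dtr c d (\<xi> t) (\<eta> t) = dtr c d (\<xi> t) (\<Sum>i\<in>Basis. (\<eta> t \<bullet> i) *\<^sub>R i)"
      by (simp add: euclidean_representation)
    also have "\<dots> = (\<Sum>i\<in>Basis. (\<eta> t \<bullet> i) *\<^sub>R dtr c d (\<xi> t) i)"
      unfolding p(3) using linear_dtr[OF cd p(1,2)] by (simp add: linear_sum linear_scale)
    finally show ?thesis by simp
  qed
  ultimately show ?thesis by (rule continuous_on_eq)
qed

lemma chart_curve_C1:
  assumes c: "c \<in> A" and \<xi>: "\<And>t. t \<in> {a..b} \<Longrightarrow> (\<xi> has_vector_derivative \<xi>' t) (at t within {a..b})"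
    and \<xi>': "continuous_on {a..b} \<xi>'" and im: "\<xi> ` {a..b} \<subseteq> chart_image c"
  shows "C1_curve A a b (chart_inv c \<circ> \<xi>)"
  unfolding C1_curve_def
proof (intro conjI ballI)
  have c\<xi>: "continuous_on {a..b} \<xi>"
    by (rule continuous_on_vector_derivative[OF \<xi>])
  show cont: "continuous_on {a..b} (chart_inv c \<circ> \<xi>)"
    by (rule continuous_on_compose[OF c\<xi> continuous_on_subset[OF cont_inv[OF c] im]])
  have cm: "chart_map c ((chart_inv c \<circ> \<xi>) t) = \<xi> t" if "t \<in> {a..b}" for t
    using chart_inv_inv[OF c subsetD[OF im imageI[OF that]]] by simp
  have dom: "(chart_inv c \<circ> \<xi>) t \<in> chart_dom c" if "t \<in> {a..b}" for t
    using inv_in_dom[OF c subsetD[OF im imageI[OF that]]] by simp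
  fix d assume d: "d \<in> A"
  let ?T = "{t \<in> {a..b}. (chart_inv c \<circ> \<xi>) t \<in> chart_dom d}"
  show "\<exists>D. (\<forall>t\<in>{a..b}. (chart_inv c \<circ> \<xi>) t \<in> chart_dom d \<longrightarrow>
      ((chart_map d \<circ> (chart_inv c \<circ> \<xi>)) has_vector_derivative D t) (at t within {a..b})) \<and>
      continuous_on ?T D"
  proof (intro exI[of _ "\<lambda>t. dtr c d (\<xi> t) (\<xi>' t)"] conjI ballI impI)
    fix t assume t: "t \<in> {a..b}" "(chart_inv c \<circ> \<xi>) t \<in> chart_dom d"
    have "((chart_map c \<circ> (chart_inv c \<circ> \<xi>)) has_vector_derivative \<xi>' t) (at t within {a..b})"
      by (rule has_vector_derivative_transform[OF t(1) _ \<xi>[OF t(1)]]) (use cm in auto)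
    from curve_change_chart[OF c d dom[OF t(1)] t(2) _ t(1) this] cont t(1)
    show "((chart_map d \<circ> (chart_inv c \<circ> \<xi>)) has_vector_derivative dtr c d (\<xi> t) (\<xi>' t)) (at t within {a..b})"
      by (simp add: cm[OF t(1), unfolded o_def] continuous_on_eq_continuous_within o_def)
  next
    have "\<xi> ` ?T \<subseteq> overlap c d"
    proof (rule image_subsetI)
      fix t assume "t \<in> ?T"
      then show "\<xi> t \<in> overlap c d" using cm[of t] dom[of t] by force
    qed
    then show "continuous_on ?T (\<lambda>t. dtr c d (\<xi> t) (\<xi>' t))"
      by (intro dtr_continuous c d continuous_on_subset[OF c\<xi>] continuous_on_subset[OF \<xi>']) auto
  qed
qed

end

section \<open>Length and the Riemannian distance\<close>

lemma (in smooth_mfd) pc1_const: "pc1 a b (\<lambda>t. p)"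
proof (rule pc1_C1, unfold C1_curve_def, intro conjI ballI)
  fix c assume "c \<in> A"
  show "\<exists>D. (\<forall>t\<in>{a..b}. p \<in> chart_dom c \<longrightarrow>
      ((chart_map c \<circ> (\<lambda>t. p)) has_vector_derivative D t) (at t within {a..b})) \<and>
      continuous_on {t\<in>{a..b}. p \<in> chart_dom c} D"
    by (intro exI[of _ "\<lambda>t. 0"]) (auto simp: o_def)
qed auto

context riemannian
begin

definition speed :: "(real \<Rightarrow> 'a) \<Rightarrow> real \<Rightarrow> real" where
  "speed \<gamma> t = tangent_norm g (\<gamma> t) (velocity A \<gamma> t)"

definition len :: "real \<Rightarrow> real \<Rightarrow> (real \<Rightarrow> 'a) \<Rightarrow> real" where
  "len a b \<gamma> = integral {a..b} (speed \<gamma>)"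

lemma speed_nonneg: "0 \<le> speed \<gamma> t"
  using inner_formD(4)[OF inner_form_g] by (simp add: speed_def tangent_norm_def)

lemma speed_chart:
  assumes "c \<in> A" "\<gamma> t \<in> chart_dom c" "isCont \<gamma> t"
    and "((chart_map c \<circ> \<gamma>) has_vector_derivative D) (at t)"
  shows "speed \<gamma> t = sqrt (gc c (chart_map c (\<gamma> t)) D D)"
  unfolding speed_def by (rule speed_eq[OF assms])

lemma speed_cong:
  assumes "open T" "t \<in> T" "\<And>s. s \<in> T \<Longrightarrow> \<gamma> s = \<delta> s"
  shows "speed \<gamma> t = speed \<delta> t"
proof -
  have "((chart_map c \<circ> \<gamma>) has_vector_derivative D) (at t) \<longleftrightarrow>
        ((chart_map c \<circ> \<delta>) has_vector_derivative D) (at t)" for D and c :: "('a, 'e) chart"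
    using has_vector_derivative_transform_within_open[OF _ assms(1,2)] assms(3) by (metis comp_apply)
  then show ?thesis unfolding speed_def velocity_def vector_derivative_def using assms by simp
qed

text \<open>The velocity is defined by a two-sided derivative, which may fail to exist at the end points of a
  smooth piece; the one-sided speed F is continuous on the whole piece, which makes speeds integrable.\<close>

lemma C1_curve_speed:
  assumes C: "C1_curve A a b \<gamma>" and ab: "a < b"
  obtains F where "continuous_on {a..b} F" "\<And>t. t \<in> {a<..<b} \<Longrightarrow> speed \<gamma> t = F t"
proof -
  define w where "w t = vector_derivative (chart_map (chart_at A (\<gamma> t)) \<circ> \<gamma>) (at t within {a..b})" for t
  define F where "F t = tangent_norm g (\<gamma> t) (w t)" for t
  have \<gamma>c: "continuous_on {a..b} \<gamma>" using C unfolding C1_curve_def by blast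
  have Feq: "F t = sqrt (gc c (chart_map c (\<gamma> t)) D D)"
    if t: "t \<in> {a..b}" and c: "c \<in> A" "\<gamma> t \<in> chart_dom c"
      and D: "((chart_map c \<circ> \<gamma>) has_vector_derivative D) (at t within {a..b})" for t c D
  proof -
    have "continuous (at t within {a..b}) \<gamma>" using \<gamma>c t by (simp add: continuous_on_eq_continuous_within)
    from curve_change_chart[OF c(1) chart_at(1) c(2) chart_at(2) this t D]
    have "w t = dtr c (chart_at A (\<gamma> t)) (chart_map c (\<gamma> t)) D"
      unfolding w_def using vector_derivative_within_cbox[of a b t] ab t by (simp add: cbox_interval)
    then show ?thesis by (simp add: F_def tangent_norm_def gc_chart[OF c] to_tangent_dtr)
  qed
  have "continuous (at t within {a..b}) F" if t: "t \<in> {a..b}" for t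
  proof -
    let ?c = "chart_at A (\<gamma> t)"
    let ?W = "{s \<in> {a..b}. \<gamma> s \<in> chart_dom ?c}"
    obtain D where D: "\<forall>t\<in>{a..b}. \<gamma> t \<in> chart_dom ?c \<longrightarrow>
      ((chart_map ?c \<circ> \<gamma>) has_vector_derivative D t) (at t within {a..b})"
      "continuous_on ?W D"
      using C chart_at(1) unfolding C1_curve_def by blast
    have W\<gamma>: "continuous_on ?W \<gamma>" using \<gamma>c by (rule continuous_on_subset) auto
    have "continuous_on ?W (\<lambda>s. gc ?c (chart_map ?c (\<gamma> s)) (D s) (D s))"
    proof (rule continuous_on_form[where F = "\<lambda>s. gc ?c (chart_map ?c (\<gamma> s))" and Q = D and R = D])
      have cW: "continuous_on ?W (\<lambda>s. chart_map ?c (\<gamma> s))"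
        by (rule continuous_on_compose2[OF cont_chart[OF chart_at(1)] W\<gamma>]) auto
      show "continuous_on ?W (\<lambda>s. gc ?c (chart_map ?c (\<gamma> s)) u v)" for u v
        by (rule continuous_on_compose2[OF gc_cont[OF chart_at(1)] cW]) auto
      show "bilinear (gc ?c (chart_map ?c (\<gamma> s)))" if "s \<in> ?W" for s
        using that by (intro bilinear_gc chart_at) auto
    qed (rule D)+
    then have "continuous_on ?W (\<lambda>s. sqrt (gc ?c (chart_map ?c (\<gamma> s)) (D s) (D s)))"
      by (intro continuous_intros)
    then have "continuous_on ?W F"
      by (rule continuous_on_eq) (rule Feq[symmetric], use D(1) chart_at in auto)
    then have 1: "continuous (at t within ?W) F"
      using t chart_at(2) by (auto simp: continuous_on_eq_continuous_within)
    obtain T where T: "open T" "T \<inter> {a..b} = \<gamma> -` chart_dom ?c \<inter> {a..b}"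
      using \<gamma>c[unfolded continuous_on_open_invariant, rule_format, OF open_dom[OF chart_at(1)]] by blast
    have "at t within {a..b} = at t within ?W"
    proof (rule at_within_nhd[of t T])
      have mem: "s \<in> T \<longleftrightarrow> \<gamma> s \<in> chart_dom ?c" if "s \<in> {a..b}" for s
        using T(2) that by (auto simp: set_eq_iff)
      show "t \<in> T" using mem[OF t] chart_at(2) by blast
      show "{a..b} \<inter> T - {t} = ?W \<inter> T - {t}" using mem by blast
    qed (rule T(1))
    then show ?thesis using 1 by simp
  qed
  then have "continuous_on {a..b} F" by (simp add: continuous_on_eq_continuous_within)
  moreover have "speed \<gamma> t = F t" if t: "t \<in> {a<..<b}" for t
  proof -
    have int: "at t within {a..b} = at t" using t by (intro at_within_interior) auto
    obtain D where D: "((chart_map (chart_at A (\<gamma> t)) \<circ> \<gamma>) has_vector_derivative D t) (at t within {a..b})"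
      using C chart_at t unfolding C1_curve_def by (meson greaterThanLessThan_iff atLeastAtMost_iff less_imp_le)
    have "isCont \<gamma> t" using \<gamma>c t by (auto intro: continuous_on_interior)
    then show ?thesis
      using speed_chart[OF chart_at(1) chart_at(2) _ D[unfolded int]] Feq[OF _ chart_at(1) chart_at(2) D] t by auto
  qed
  ultimately show ?thesis using that by blast
qed

lemma speed_integrable_C1:
  assumes "C1_curve A a b \<gamma>" "a < b"
  shows "speed \<gamma> integrable_on {a..b}"
proof -
  obtain F where F: "continuous_on {a..b} F" "\<And>t. t \<in> {a<..<b} \<Longrightarrow> speed \<gamma> t = F t"
    using C1_curve_speed[OF assms] by blast
  have "F integrable_on cbox a b" using integrable_continuous_real[OF F(1)] by (simp add: cbox_interval)
  then show ?thesis
    using integrable_spike_interior[where f = F and g = "speed \<gamma>" and a = a and b = b] F(2)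
    by (simp add: cbox_interval box_real)
qed

lemma speed_integrable:
  assumes "pc1 a b \<gamma>"
  shows "speed \<gamma> integrable_on {a..b}"
proof (cases "a < b")
  case True
  obtain K where K: "finite K"
    "\<forall>s t. a \<le> s \<and> s < t \<and> t \<le> b \<and> {s<..<t} \<inter> K = {} \<longrightarrow> C1_curve A s t \<gamma>"
    using assms unfolding pc1_def by blast
  show ?thesis
  proof (rule subdivision_induct[OF K(1) _ _ True, where P = "\<lambda>s t. speed \<gamma> integrable_on {s..t}"])
    show "speed \<gamma> integrable_on {s..t}" if "a \<le> s" "s < t" "t \<le> b" "{s<..<t} \<inter> K = {}" for s t
      using K(2) that speed_integrable_C1 by blast
    show "speed \<gamma> integrable_on {s..t}" if "s < m" "m < t" "speed \<gamma> integrable_on {s..m}"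
      "speed \<gamma> integrable_on {m..t}" for s m t
      using that Henstock_Kurzweil_Integration.integrable_combine[of s m t "speed \<gamma>"] by auto
  qed
next
  case False
  then show ?thesis by (cases "a = b") (auto intro: integrable_on_refl[of _ b, simplified])
qed

lemma len_nonneg: "pc1 a b \<gamma> \<Longrightarrow> 0 \<le> len a b \<gamma>"
  unfolding len_def by (rule integral_nonneg[OF speed_integrable]) (auto intro: speed_nonneg)

lemma len_combine:
  assumes "pc1 a b \<gamma>" "a \<le> m" "m \<le> b"
  shows "len a m \<gamma> + len m b \<gamma> = len a b \<gamma>"
  unfolding len_def using Henstock_Kurzweil_Integration.integral_combine[OF assms(2,3) speed_integrable[OF assms(1)]] .

lemma len_cong:
  assumes "\<And>t. t \<in> {a..b} \<Longrightarrow> \<gamma> t = \<delta> t"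
  shows "len a b \<gamma> = len a b \<delta>"
  unfolding len_def
proof (rule integral_spike[of "{a, b}"])
  show "speed \<delta> t = speed \<gamma> t" if "t \<in> {a..b} - {a, b}" for t
    by (rule speed_cong[of "{a<..<b}"]) (use that assms in auto)
qed auto

lemma speed_affine:
  assumes \<phi>: "\<And>t. \<phi> t = \<alpha> * t + \<beta>" and c: "isCont \<gamma> (\<phi> t)"
    "((chart_map (chart_at A (\<gamma> (\<phi> t))) \<circ> \<gamma>) has_vector_derivative D) (at (\<phi> t))"
  shows "speed (\<gamma> \<circ> \<phi>) t = \<bar>\<alpha>\<bar> * speed \<gamma> (\<phi> t)"
proof -
  let ?c = "chart_at A (\<gamma> (\<phi> t))"
  have \<phi>': "(\<phi> has_vector_derivative \<alpha>) (at t)"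
    unfolding \<phi>[abs_def] by (auto intro!: derivative_eq_intros)
  have "((chart_map ?c \<circ> (\<gamma> \<circ> \<phi>)) has_vector_derivative \<alpha> *\<^sub>R D) (at t)"
    using vector_diff_chain_at[OF \<phi>' c(2)] unfolding comp_assoc .
  moreover have "isCont (\<gamma> \<circ> \<phi>) t"
    using isCont_o2[of t \<phi> \<gamma>] has_vector_derivative_continuous[OF \<phi>'] c(1) by (simp add: o_def)
  ultimately have "speed (\<gamma> \<circ> \<phi>) t = sqrt (gc ?c (chart_map ?c (\<gamma> (\<phi> t))) (\<alpha> *\<^sub>R D) (\<alpha> *\<^sub>R D))"
    using speed_chart[of ?c "\<gamma> \<circ> \<phi>" t] chart_at by simp
  also have "\<dots> = \<bar>\<alpha>\<bar> * sqrt (gc ?c (chart_map ?c (\<gamma> (\<phi> t))) D D)"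
    using bilinear_gc[OF chart_at(1), of "chart_map ?c (\<gamma> (\<phi> t))"] chart_at
    by (simp add: bilinear_lmul bilinear_rmul real_sqrt_mult flip: mult.assoc)
  finally show ?thesis using speed_chart[OF chart_at(1) chart_at(2) c] by simp
qed

lemma len_affine:
  assumes C: "pc1 a' b' \<gamma>" and \<phi>: "\<And>t. \<phi> t = \<alpha> * t + \<beta>" "\<alpha> \<noteq> 0" "\<phi> ` {a..b} = {a'..b'}"
    and ab: "a \<le> b"
  shows "len a b (\<gamma> \<circ> \<phi>) = len a' b' \<gamma>"
proof -
  obtain K where K: "finite K" "\<And>t c. t \<in> {a'<..<b'} - K \<Longrightarrow> isCont \<gamma> t \<and>
     (c \<in> A \<longrightarrow> \<gamma> t \<in> chart_dom c \<longrightarrow> (\<exists>D. ((chart_map c \<circ> \<gamma>) has_vector_derivative D) (at t)))"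
    using pc1_derivative[OF C] by blast
  have inj: "inj \<phi>" using \<phi>(1,2) by (auto intro!: injI)
  have sp: "speed (\<gamma> \<circ> \<phi>) t = \<bar>\<alpha>\<bar> * speed \<gamma> (\<phi> t)"
    if t: "t \<in> {a..b} - \<phi> -` (K \<union> {a', b'})" for t
  proof -
    have "\<phi> t \<in> {a'..b'}" using t \<phi>(3) by blast
    then have "\<phi> t \<in> {a'<..<b'} - K" using t by auto
    from K(2)[OF this] chart_at show ?thesis using speed_affine[OF \<phi>(1)] by blast
  qed
  have "(speed \<gamma> has_integral len a' b' \<gamma>) (cbox a' b')"
    using integrable_integral[OF speed_integrable[OF C]] by (simp add: len_def cbox_interval)
  from has_integral_affinity[OF this \<phi>(2), of \<beta>]
  have "((\<lambda>t. speed \<gamma> (\<phi> t)) has_integral (1 / \<bar>\<alpha>\<bar>) * len a' b' \<gamma>)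
      ((\<lambda>x. (1 / \<alpha>) *\<^sub>R x + - ((1 / \<alpha>) *\<^sub>R \<beta>)) ` {a'..b'})"
    by (simp add: \<phi>(1) cbox_interval)
  moreover have "(\<lambda>x. (1 / \<alpha>) *\<^sub>R x + - ((1 / \<alpha>) *\<^sub>R \<beta>)) ` {a'..b'} = {a..b}"
    unfolding \<phi>(3)[symmetric] image_image using \<phi>(2) by (simp add: \<phi>(1) add_divide_distrib)
  ultimately have "((\<lambda>t. speed \<gamma> (\<phi> t)) has_integral (1 / \<bar>\<alpha>\<bar>) * len a' b' \<gamma>) {a..b}" by simp
  from has_integral_mult_right[OF this, of "\<bar>\<alpha>\<bar>"]
  have "((\<lambda>t. \<bar>\<alpha>\<bar> * speed \<gamma> (\<phi> t)) has_integral len a' b' \<gamma>) {a..b}" using \<phi>(2) by simp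
  from has_integral_spike_finite[OF finite_vimageI[OF _ inj, of "K \<union> {a', b'}"] sp this] K(1)
  have "(speed (\<gamma> \<circ> \<phi>) has_integral len a' b' \<gamma>) {a..b}" by auto
  then show ?thesis unfolding len_def[of a b] by (rule integral_unique)
qed

abbreviation d where "d \<equiv> riemannian_dist A g"

text \<open>The distance of p and q is the infimum of the l with \<open>conn p q l\<close>.\<close>

definition conn :: "'a \<Rightarrow> 'a \<Rightarrow> real \<Rightarrow> bool" where
  "conn p q l \<longleftrightarrow> (\<exists>\<gamma>. pc1 0 1 \<gamma> \<and> \<gamma> 0 = p \<and> \<gamma> 1 = q \<and> len 0 1 \<gamma> = l)"

lemma conn_nonneg: "conn p q l \<Longrightarrow> 0 \<le> l"
  using len_nonneg unfolding conn_def by blast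

lemma conn_interval:
  assumes "pc1 a b \<gamma>" "a \<le> b"
  shows "conn (\<gamma> a) (\<gamma> b) (len a b \<gamma>)"
proof (cases "a = b")
  case True
  have "speed (\<lambda>t. \<gamma> a) t = 0" for t
    using speed_chart[where \<gamma> = "\<lambda>t. \<gamma> a" and t = t and c = "chart_at A (\<gamma> a)" and D = 0]
      bilinear_lzero[OF bilinear_gc[OF chart_at(1)]] chart_at by (auto simp: o_def)
  then have "speed (\<lambda>t. \<gamma> a) = (\<lambda>t. 0)" by blast
  then have "len 0 1 (\<lambda>t. \<gamma> a) = 0" unfolding len_def by simp
  moreover have "len a b \<gamma> = 0" unfolding len_def using True by simp
  ultimately show ?thesis unfolding conn_def using True pc1_const
    by (intro exI[of _ "\<lambda>t. \<gamma> a"]) auto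
next
  case False
  define \<phi> where "\<phi> t = (b - a) * t + a" for t
  have im: "\<phi> ` {0..1} = {a..b}"
    using assms(2) False unfolding \<phi>_def
    by (auto simp: image_affinity_atLeastAtMost)
  have "pc1 0 1 (\<gamma> \<circ> \<phi>)" using pc1_affine[OF assms(1) \<phi>_def] im False by auto
  moreover have "len 0 1 (\<gamma> \<circ> \<phi>) = len a b \<gamma>" using len_affine[OF assms(1) \<phi>_def] im False by auto
  moreover have "(\<gamma> \<circ> \<phi>) 0 = \<gamma> a" "(\<gamma> \<circ> \<phi>) 1 = \<gamma> b" by (simp_all add: \<phi>_def)
  ultimately show ?thesis unfolding conn_def by blast
qed

lemma conn_refl: "conn p p 0"
  using conn_interval[OF pc1_const[of 0 0 p]] by (simp add: len_def)

lemma conn_sym: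
  assumes "conn p q l"
  shows "conn q p l"
proof -
  obtain \<gamma> where \<gamma>: "pc1 0 1 \<gamma>" "\<gamma> 0 = p" "\<gamma> 1 = q" "len 0 1 \<gamma> = l" using assms unfolding conn_def by blast
  define \<phi> where "\<phi> t = (-1) * t + (1::real)" for t
  have im: "\<phi> ` {0..1} = {0..1}" unfolding \<phi>_def by (auto simp: image_affinity_atLeastAtMost)
  have "pc1 0 1 (\<gamma> \<circ> \<phi>)" using pc1_affine[OF \<gamma>(1) \<phi>_def] im by auto
  moreover have "len 0 1 (\<gamma> \<circ> \<phi>) = l" using len_affine[OF \<gamma>(1) \<phi>_def] im \<gamma> by auto
  moreover have "(\<gamma> \<circ> \<phi>) 0 = q" "(\<gamma> \<circ> \<phi>) 1 = p" using \<gamma> by (simp_all add: \<phi>_def)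
  ultimately show ?thesis unfolding conn_def by blast
qed

lemma conn_trans:
  assumes "conn p q l" "conn q r k"
  shows "conn p r (l + k)"
proof -
  obtain \<gamma> where \<gamma>: "pc1 0 1 \<gamma>" "\<gamma> 0 = p" "\<gamma> 1 = q" "len 0 1 \<gamma> = l" using assms(1) unfolding conn_def by blast
  obtain \<delta> where \<delta>: "pc1 0 1 \<delta>" "\<delta> 0 = q" "\<delta> 1 = r" "len 0 1 \<delta> = k" using assms(2) unfolding conn_def by blast
  define \<phi> where "\<phi> t = 1 * t + (-1::real)" for t
  have im: "\<phi> ` {1..2} = {0..1}" unfolding \<phi>_def by (auto simp: image_affinity_atLeastAtMost)
  have \<delta>': "pc1 1 2 (\<delta> \<circ> \<phi>)" "len 1 2 (\<delta> \<circ> \<phi>) = k"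
    using pc1_affine[OF \<delta>(1) \<phi>_def] len_affine[OF \<delta>(1) \<phi>_def] im \<delta> by auto
  define \<eta> where "\<eta> t = (if t \<le> 1 then \<gamma> t else (\<delta> \<circ> \<phi>) t)" for t
  have e1: "\<gamma> t = \<eta> t" if "t \<in> {0..1}" for t using that by (simp add: \<eta>_def)
  have e2: "(\<delta> \<circ> \<phi>) t = \<eta> t" if "t \<in> {1..2}" for t
    using that \<gamma>(3) \<delta>(2) by (cases "t = 1") (auto simp: \<eta>_def \<phi>_def)
  have "pc1 0 1 \<eta>" "pc1 1 2 \<eta>" using pc1_cong[OF \<gamma>(1) e1] pc1_cong[OF \<delta>'(1) e2] by auto
  then have P: "pc1 0 2 \<eta>" by (rule pc1_join) auto
  have "len 0 2 \<eta> = l + k"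
    using len_combine[OF P, of 1] len_cong[of 0 1 \<gamma> \<eta>, OF e1] len_cong[of 1 2 "\<delta> \<circ> \<phi>" \<eta>, OF e2]
      \<gamma>(4) \<delta>'(2) by simp
  moreover have "\<eta> 0 = p" "\<eta> 2 = r" using e1[of 0] e2[of 2] \<gamma> \<delta> by (auto simp: \<phi>_def)
  ultimately show ?thesis using conn_interval[OF P] by simp
qed

lemma d_conn: "d p q = Inf {l. conn p q l}"
  unfolding riemannian_dist_def piecewise_C1_path_pc1 riemannian_length_def conn_def len_def speed_def
    pathstart_def pathfinish_def
  by (rule arg_cong[of _ _ Inf]) auto

lemma d_le: "conn p q l \<Longrightarrow> d p q \<le> l"
  unfolding d_conn by (rule cInf_lower) (auto intro: bdd_belowI[of _ 0] conn_nonneg)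

lemma d_le_len: "pc1 a b \<gamma> \<Longrightarrow> a \<le> b \<Longrightarrow> d (\<gamma> a) (\<gamma> b) \<le> len a b \<gamma>"
  using d_le conn_interval by blast

text \<open>A lower bound for the length of a curve that stays in a coordinate region on which the metric
  dominates a constant inner product: project onto the direction of the displacement.\<close>

lemma len_ge_chart:
  assumes C: "pc1 a b \<gamma>" "a \<le> b" and c: "c \<in> A" and B: "inner_form B"
    and dom: "\<And>t. t \<in> {a..b} \<Longrightarrow> \<gamma> t \<in> chart_dom c"
    and ge: "\<And>t u. t \<in> {a..b} \<Longrightarrow> B u u \<le> gc c (chart_map c (\<gamma> t)) u u"
    and w: "w = chart_map c (\<gamma> b) - chart_map c (\<gamma> a)"
  shows "sqrt (B w w) \<le> len a b \<gamma>"
proof (cases "w = 0")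
  case True
  then show ?thesis using len_nonneg[OF C(1)] bilinear_lzero[OF inner_formD(1)[OF B]] by simp
next
  case False
  then have Bw: "B w w > 0" by (rule inner_formD(3)[OF B])
  have blin: "bounded_linear (B w)"
    using inner_formD(1)[OF B] by (simp add: bilinear_def linear_conv_bounded_linear)
  obtain K where K: "finite K" "\<And>t c. t \<in> {a<..<b} - K \<Longrightarrow> isCont \<gamma> t \<and>
     (c \<in> A \<longrightarrow> \<gamma> t \<in> chart_dom c \<longrightarrow> (\<exists>D. ((chart_map c \<circ> \<gamma>) has_vector_derivative D) (at t)))"
    using pc1_derivative[OF C(1)] by blast
  let ?x = "chart_map c \<circ> \<gamma>"
  define D where "D t = vector_derivative ?x (at t)" for t
  have D: "(?x has_vector_derivative D t) (at t)" if "t \<in> {a<..<b} - K" for t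
    using K(2)[OF that, of c] c dom[of t] that unfolding D_def by (auto dest: vector_derivative_at)
  define h where "h t = (if t \<in> {a<..<b} - K then B w (D t) else 0)" for t
  have x_cont: "continuous_on {a..b} ?x"
    using C(1) dom unfolding pc1_def
    by (intro continuous_on_compose continuous_on_subset[OF cont_chart[OF c]]) auto
  have "(h has_integral (B w (?x b) - B w (?x a))) {a..b}"
  proof (rule fundamental_theorem_of_calculus_interior_strong[OF K(1) C(2)])
    show "((\<lambda>t. B w (?x t)) has_vector_derivative h t) (at t)" if "t \<in> {a<..<b} - K" for t
      using bounded_linear.has_vector_derivative[OF blin D[OF that]] that by (simp add: h_def)
    show "continuous_on {a..b} (\<lambda>t. B w (?x t))"
      by (rule bounded_linear.continuous_on[OF blin x_cont])
  qed
  moreover have "B w (?x b) - B w (?x a) = B w w"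
    by (simp add: w bilinear_rsub[OF inner_formD(1)[OF B]])
  ultimately have "(h has_integral B w w) {a..b}" by simp
  moreover have "((\<lambda>t. sqrt (B w w) * speed \<gamma> t) has_integral sqrt (B w w) * len a b \<gamma>) {a..b}"
    unfolding len_def by (intro has_integral_mult_right integrable_integral speed_integrable C)
  moreover have "h t \<le> sqrt (B w w) * speed \<gamma> t" if t: "t \<in> {a..b}" for t
  proof (cases "t \<in> {a<..<b} - K")
    case True
    have "B w (D t) \<le> sqrt (B w w) * sqrt (B (D t) (D t))" by (rule inner_form_sqrt_ge_linear[OF B])
    also have "\<dots> \<le> sqrt (B w w) * sqrt (gc c (chart_map c (\<gamma> t)) (D t) (D t))"
      using ge[OF t] Bw by (intro mult_left_mono) auto
    also have "sqrt (gc c (chart_map c (\<gamma> t)) (D t) (D t)) = speed \<gamma> t"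
      using speed_chart[OF c dom[OF t] _ D[OF True]] K(2)[OF True] by auto
    finally show ?thesis using True by (simp add: h_def)
  next
    case False
    then show ?thesis unfolding h_def if_not_P[OF False] using speed_nonneg Bw by simp
  qed
  ultimately have "B w w \<le> sqrt (B w w) * len a b \<gamma>" by (rule has_integral_le)
  then have "sqrt (B w w) * sqrt (B w w) \<le> sqrt (B w w) * len a b \<gamma>" using Bw by simp
  moreover have "0 < sqrt (B w w)" using Bw by simp
  ultimately show ?thesis by (meson mult_le_cancel_left_pos)
qed

lemma chart_curve_len:
  assumes c: "c \<in> A" and ab: "a \<le> b"
    and \<xi>: "\<And>t. t \<in> {a..b} \<Longrightarrow> (\<xi> has_vector_derivative \<xi>' t) (at t within {a..b})"
    and \<xi>': "continuous_on {a..b} \<xi>'" and im: "\<xi> ` {a..b} \<subseteq> chart_image c"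
  shows "pc1 a b (chart_inv c \<circ> \<xi>)"
    "((\<lambda>t. sqrt (gc c (\<xi> t) (\<xi>' t) (\<xi>' t))) has_integral len a b (chart_inv c \<circ> \<xi>)) {a..b}"
proof -
  show P: "pc1 a b (chart_inv c \<circ> \<xi>)" by (rule pc1_C1[OF chart_curve_C1[OF c \<xi> \<xi>' im]])
  have cm: "chart_map c ((chart_inv c \<circ> \<xi>) t) = \<xi> t" if "t \<in> {a..b}" for t
    using chart_inv_inv[OF c subsetD[OF im imageI[OF that]]] by simp
  have sp: "sqrt (gc c (\<xi> t) (\<xi>' t) (\<xi>' t)) = speed (chart_inv c \<circ> \<xi>) t" if t: "t \<in> {a..b} - {a, b}" for t
  proof -
    have t': "t \<in> {a<..<b}" "t \<in> {a..b}" using t by auto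
    have "(\<xi> has_vector_derivative \<xi>' t) (at t)"
      using \<xi>[OF t'(2)] t' at_within_interior[of t "{a..b}"] by simp
    then have D: "((chart_map c \<circ> (chart_inv c \<circ> \<xi>)) has_vector_derivative \<xi>' t) (at t)"
      by (rule has_vector_derivative_transform_within_open[where S = "{a<..<b}"]) (use t' cm in auto)
    have "isCont (chart_inv c \<circ> \<xi>) t"
      using P t' unfolding pc1_def by (auto intro: continuous_on_interior)
    moreover have "(chart_inv c \<circ> \<xi>) t \<in> chart_dom c"
      using inv_in_dom[OF c subsetD[OF im imageI[OF t'(2)]]] by simp
    ultimately show ?thesis using speed_chart[OF c _ _ D] cm[OF t'(2)] by simp
  qed
  show "((\<lambda>t. sqrt (gc c (\<xi> t) (\<xi>' t) (\<xi>' t))) has_integral len a b (chart_inv c \<circ> \<xi>)) {a..b}"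
    by (rule has_integral_spike_finite[of "{a, b}" _ _ "speed (chart_inv c \<circ> \<xi>)"])
       (use sp integrable_integral[OF speed_integrable[OF P]] in \<open>auto simp: len_def\<close>)
qed

lemma conn_segment:
  assumes c: "c \<in> A" and seg: "closed_segment x y \<subseteq> chart_image c"
    and M: "\<And>z. z \<in> closed_segment x y \<Longrightarrow> gc c z (y - x) (y - x) \<le> M"
  shows "\<exists>l \<le> sqrt M. conn (chart_inv c x) (chart_inv c y) l"
proof -
  define \<xi> where "\<xi> t = x + t *\<^sub>R (y - x)" for t
  have im: "\<xi> t \<in> closed_segment x y" if "t \<in> {0..1}" for t
    using that by (auto simp: \<xi>_def closed_segment_def algebra_simps intro!: exI[of _ t])
  have \<xi>': "(\<xi> has_vector_derivative (y - x)) (at t within {0..1})" for t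
    unfolding \<xi>_def by (auto intro!: derivative_eq_intros)
  have im': "\<xi> ` {0..1} \<subseteq> chart_image c" using im seg by blast
  note L = chart_curve_len[OF c zero_le_one \<xi>' continuous_on_const im']
  have "((\<lambda>t::real. sqrt M) has_integral sqrt M) {0..1}"
    using has_integral_const_real[of "sqrt M" 0 1] by simp
  from has_integral_le[OF L(2) this] M[OF im] have "len 0 1 (chart_inv c \<circ> \<xi>) \<le> sqrt M" by simp
  moreover have "(chart_inv c \<circ> \<xi>) 0 = chart_inv c x" "(chart_inv c \<circ> \<xi>) 1 = chart_inv c y"
    by (simp_all add: \<xi>_def)
  ultimately show ?thesis using L(1) unfolding conn_def by blast
qed

end

section \<open>Comparison of the distance with the coordinate metric\<close>

context riemannian
begin

lemma chart_bounds:
  assumes c: "c \<in> A" and x: "x \<in> chart_image c"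
  obtains r l L Q where "0 < r" "cball x r \<subseteq> chart_image c" "0 < l" "l \<le> L" "0 < Q"
    "\<And>z u. z \<in> cball x r \<Longrightarrow> l * (norm u)\<^sup>2 \<le> gc c z u u"
    "\<And>z u. z \<in> cball x r \<Longrightarrow> gc c z u u \<le> L * (norm u)\<^sup>2"
    "\<And>z z' u. z \<in> cball x r \<Longrightarrow> z' \<in> cball x r \<Longrightarrow>
       \<bar>gc c z u u - gc c z' u u\<bar> \<le> Q * norm (z - z') * (norm u)\<^sup>2"
proof -
  obtain r where r: "0 < r" "cball x r \<subseteq> chart_image c"
    using open_contains_cball open_image[OF c] x by blast
  obtain l L where l: "0 < l" "l \<le> L" "\<And>z u. z \<in> cball x r \<Longrightarrow> l * (norm u)\<^sup>2 \<le> gc c z u u"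
    "\<And>z u. z \<in> cball x r \<Longrightarrow> gc c z u u \<le> L * (norm u)\<^sup>2"
  proof (rule forms_uniformly_definite[of "cball x r" "gc c"])
    show "continuous_on (cball x r) (\<lambda>x. gc c x u v)" for u v
      by (rule continuous_on_subset[OF gc_cont[OF c] r(2)])
    show "inner_form (gc c z)" if "z \<in> cball x r" for z
      using inner_form_gc[OF c subsetD[OF r(2) that]] .
  qed auto
  have "\<exists>q\<ge>0. \<forall>z\<in>cball x r. \<forall>z'\<in>cball x r. \<bar>gc c z u v - gc c z' u v\<bar> \<le> q * norm (z - z')" for u v
    by (rule Ck_on_Lipschitz[OF gc_Ck[OF c, of 1 u v] compact_cball convex_cball r(2)]) blast
  then obtain q where q: "\<And>u v. 0 \<le> q u v"
    "\<And>u v z z'. z \<in> cball x r \<Longrightarrow> z' \<in> cball x r \<Longrightarrow> \<bar>gc c z u v - gc c z' u v\<bar> \<le> q u v * norm (z - z')"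
    by metis
  define Q where "Q = (\<Sum>i\<in>Basis. \<Sum>j\<in>Basis. q i j) + 1"
  have Q: "0 < Q" unfolding Q_def using q(1) by (intro add_nonneg_pos sum_nonneg) auto
  show ?thesis
  proof (rule that[OF r l(1,2) Q l(3,4)])
    fix z z' u assume z: "z \<in> cball x r" "z' \<in> cball x r"
    note bl = bilinear_gc[OF c subsetD[OF r(2) z(1)]] bilinear_gc[OF c subsetD[OF r(2) z(2)]]
    have "\<bar>gc c z u u - gc c z' u u\<bar> =
        \<bar>\<Sum>i\<in>Basis. \<Sum>j\<in>Basis. (u \<bullet> i) * (u \<bullet> j) * (gc c z i j - gc c z' i j)\<bar>"
      unfolding bilinear_expand[OF bl(1), of u u] bilinear_expand[OF bl(2), of u u] sum_subtractf[symmetric]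
        right_diff_distrib ..
    also have "\<dots> \<le> (\<Sum>i\<in>Basis. \<Sum>j\<in>Basis. \<bar>(u \<bullet> i) * (u \<bullet> j) * (gc c z i j - gc c z' i j)\<bar>)"
      by (rule order_trans[OF sum_abs]) (intro sum_mono sum_abs)
    also have "\<dots> \<le> (\<Sum>i\<in>Basis. \<Sum>j\<in>Basis. norm u * norm u * (q i j * norm (z - z')))"
      unfolding abs_mult
      by (intro sum_mono mult_mono Basis_le_norm q(2) z mult_nonneg_nonneg) auto
    also have "\<dots> = (\<Sum>i\<in>Basis. \<Sum>j\<in>Basis. q i j) * (norm (z - z') * (norm u)\<^sup>2)"
      unfolding sum_distrib_right power2_eq_square by (intro sum.cong refl) (simp only: mult_ac)
    also have "\<dots> \<le> Q * (norm (z - z') * (norm u)\<^sup>2)"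
      unfolding Q_def by (intro mult_right_mono) auto
    finally show "\<bar>gc c z u u - gc c z' u u\<bar> \<le> Q * norm (z - z') * (norm u)\<^sup>2"
      by (simp add: mult.assoc)
  qed
qed

text \<open>A curve from the centre of a coordinate ball either ends inside the ball without leaving it, or has
  a first point on the coordinate sphere; up to that point the metric dominates B.\<close>

lemma conn_ge_chart:
  assumes c: "c \<in> A" "cball m r \<subseteq> chart_image c" "0 < r" and B: "inner_form B"
    and ge: "\<And>z u. z \<in> cball m r \<Longrightarrow> B u u \<le> gc c z u u"
    and l: "conn (chart_inv c m) q l"
  shows "(q \<in> chart_dom c \<and> chart_map c q \<in> ball m r \<and> sqrt (B (chart_map c q - m) (chart_map c q - m)) \<le> l) \<or>
     (\<exists>z. norm z = r \<and> sqrt (B z z) \<le> l)"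
proof -
  obtain \<gamma> where \<gamma>: "pc1 0 1 \<gamma>" "\<gamma> 0 = chart_inv c m" "\<gamma> 1 = q" "len 0 1 \<gamma> = l"
    using l unfolding conn_def by blast
  have m: "m \<in> chart_image c" using c by (meson centre_in_cball less_imp_le subsetD)
  have g0: "\<gamma> 0 \<in> chart_dom c" "chart_map c (\<gamma> 0) = m"
    unfolding \<gamma>(2) by (rule inv_in_dom[OF c(1) m], rule chart_inv_inv[OF c(1) m])
  have cont: "continuous_on {0..1} \<gamma>" using \<gamma>(1) unfolding pc1_def by blast
  have start: "chart_map c (\<gamma> 0) \<in> ball m r" using c(3) g0 by simp
  show ?thesis
  proof (rule coordinate_ball_exit[OF c(1,2) cont g0(1) start])
    assume *: "\<And>t. t \<in> {0..1} \<Longrightarrow> \<gamma> t \<in> chart_dom c \<and> chart_map c (\<gamma> t) \<in> ball m r"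
    have "sqrt (B (chart_map c q - m) (chart_map c q - m)) \<le> len 0 1 \<gamma>"
    proof (rule len_ge_chart[OF \<gamma>(1) zero_le_one c(1) B])
      show "\<gamma> t \<in> chart_dom c" if "t \<in> {0..1}" for t using *[OF that] by blast
      show "B u u \<le> gc c (chart_map c (\<gamma> t)) u u" if "t \<in> {0..1}" for t u
        using ge *[OF that] ball_subset_cball by blast
    qed (simp add: \<gamma> g0[unfolded \<gamma>(2)])
    then show ?thesis using *[of 1] \<gamma> by simp
  next
    fix T assume T: "T \<in> {0..1}" "norm (chart_map c (\<gamma> T) - m) = r"
      "\<And>t. t \<in> {0..T} \<Longrightarrow> \<gamma> t \<in> chart_dom c \<and> chart_map c (\<gamma> t) \<in> cball m r"
    let ?z = "chart_map c (\<gamma> T) - m"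
    have P: "pc1 0 T \<gamma>" "pc1 T 1 \<gamma>" using pc1_subset[OF \<gamma>(1)] T(1) by auto
    have "sqrt (B ?z ?z) \<le> len 0 T \<gamma>"
    proof (rule len_ge_chart[OF P(1) _ c(1) B])
      show "\<gamma> t \<in> chart_dom c" if "t \<in> {0..T}" for t using T(3)[OF that] by blast
      show "B u u \<le> gc c (chart_map c (\<gamma> t)) u u" if "t \<in> {0..T}" for t u
        using ge T(3)[OF that] by blast
    qed (use T(1) in \<open>simp_all add: g0\<close>)
    also have "\<dots> \<le> l" using len_combine[OF \<gamma>(1), of T] T(1) len_nonneg[OF P(2)] \<gamma>(4) by simp
    finally show ?thesis using T(2) by blast
  qed
qed

lemma inner_form_scaled_inner: "0 < k \<Longrightarrow> inner_form (\<lambda>u v::'e. k * (u \<bullet> v))"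
  unfolding inner_form_def bilinear_def
  by (auto intro!: linearI simp: inner_add_left inner_add_right algebra_simps inner_commute)

lemma conn_small:
  assumes "open U" "p \<in> U"
  obtains e where "0 < e" "\<And>q l. conn p q l \<Longrightarrow> l < e \<Longrightarrow> q \<in> U"
proof -
  let ?c = "chart_at A p"
  note c = chart_at(1)[of p] and p = chart_at(2)[of p]
  let ?x = "chart_map ?c p"
  obtain r l L Q where r: "0 < r" "cball ?x r \<subseteq> chart_image ?c" "0 < l"
    "\<And>z u. z \<in> cball ?x r \<Longrightarrow> l * (norm u)\<^sup>2 \<le> gc ?c z u u"
    by (rule chart_bounds[OF c, of ?x]) (use p in blast)+
  have "open (chart_image ?c \<inter> chart_inv ?c -` U)"
    by (rule continuous_open_preimage[OF cont_inv[OF c] open_image[OF c] assms(1)])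
  moreover have "?x \<in> chart_image ?c \<inter> chart_inv ?c -` U" using p assms(2) inv_chart[OF c p] by auto
  ultimately obtain s where s: "0 < s" "cball ?x s \<subseteq> chart_image ?c \<inter> chart_inv ?c -` U"
    unfolding open_contains_cball by blast
  let ?r = "min r s"
  show ?thesis
  proof (rule that[of "sqrt l * ?r"])
    show "0 < sqrt l * ?r" using r s by simp
    fix q k assume k: "conn p q k" "k < sqrt l * ?r"
    have "(q \<in> chart_dom ?c \<and> chart_map ?c q \<in> ball ?x ?r \<and>
        sqrt (l * ((chart_map ?c q - ?x) \<bullet> (chart_map ?c q - ?x))) \<le> k) \<or>
        (\<exists>z::'e. norm z = ?r \<and> sqrt (l * (z \<bullet> z)) \<le> k)"
    proof (rule conn_ge_chart[where B = "\<lambda>u v. l * (u \<bullet> v)", OF c _ _ inner_form_scaled_inner[OF r(3)]])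
      show "cball ?x ?r \<subseteq> chart_image ?c" using r(2) by auto
      show "l * (u \<bullet> u) \<le> gc ?c z u u" if "z \<in> cball ?x ?r" for z u
        using r(4)[of z u] that by (simp add: power2_norm_eq_inner)
      show "conn (chart_inv ?c ?x) q k" using k(1) inv_chart[OF c p] by simp
    qed (use r s in auto)
    then show "q \<in> U"
    proof
      assume "\<exists>z::'e. norm z = ?r \<and> sqrt (l * (z \<bullet> z)) \<le> k"
      then obtain z :: 'e where z: "norm z = ?r" "sqrt (l * (z \<bullet> z)) \<le> k" by blast
      have "sqrt (l * (z \<bullet> z)) = sqrt l * norm z" by (simp add: real_sqrt_mult norm_eq_sqrt_inner)
      then show ?thesis using z k(2) by simp
    next
      assume q: "q \<in> chart_dom ?c \<and> chart_map ?c q \<in> ball ?x ?r \<and>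
        sqrt (l * ((chart_map ?c q - ?x) \<bullet> (chart_map ?c q - ?x))) \<le> k"
      then have "chart_map ?c q \<in> cball ?x s" by auto
      then have "chart_inv ?c (chart_map ?c q) \<in> U" using s(2) by blast
      then show ?thesis using inv_chart[OF c] q by simp
    qed
  qed
qed

lemma conn_near:
  assumes e: "0 < e"
  obtains U where "open U" "p \<in> U" "\<And>q. q \<in> U \<Longrightarrow> \<exists>l<e. conn p q l"
proof -
  let ?c = "chart_at A p"
  note c = chart_at(1)[of p] and p = chart_at(2)[of p]
  let ?x = "chart_map ?c p"
  obtain r l L Q where r: "0 < r" "cball ?x r \<subseteq> chart_image ?c" "0 < l" "l \<le> L"
    "\<And>z u. z \<in> cball ?x r \<Longrightarrow> gc ?c z u u \<le> L * (norm u)\<^sup>2"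
    by (rule chart_bounds[OF c, of ?x]) (use p in blast)+
  define s where "s = min r (e / (2 * sqrt L))"
  have s: "0 < s" "s \<le> r" "sqrt L * s < e"
  proof -
    have L: "0 < sqrt L" using r by simp
    show "0 < s" "s \<le> r" unfolding s_def using r e by auto
    have "sqrt L * s \<le> sqrt L * (e / (2 * sqrt L))" unfolding s_def using L by (intro mult_left_mono) auto
    also have "\<dots> = e / 2" using L by simp
    finally show "sqrt L * s < e" using e by simp
  qed
  let ?U = "chart_dom ?c \<inter> chart_map ?c -` ball ?x s"
  show ?thesis
  proof (rule that[of ?U])
    show "open ?U" by (rule continuous_open_preimage[OF cont_chart[OF c] open_dom[OF c]]) simp
    show "p \<in> ?U" using p s(1) by simp
    fix q assume q: "q \<in> ?U"
    let ?y = "chart_map ?c q"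
    have "closed_segment ?x ?y \<subseteq> cball ?x r"
      using q s(1,2) by (intro closed_segment_subset) auto
    then have seg: "closed_segment ?x ?y \<subseteq> chart_image ?c"
      "\<And>z. z \<in> closed_segment ?x ?y \<Longrightarrow> gc ?c z (?y - ?x) (?y - ?x) \<le> L * (norm (?y - ?x))\<^sup>2"
      using r by auto
    obtain k where k: "k \<le> sqrt (L * (norm (?y - ?x))\<^sup>2)" "conn (chart_inv ?c ?x) (chart_inv ?c ?y) k"
      using conn_segment[OF c seg] by blast
    have "sqrt (L * (norm (?y - ?x))\<^sup>2) = sqrt L * norm (?y - ?x)" by (simp add: real_sqrt_mult)
    also have "\<dots> \<le> sqrt L * s"
      using q r(3,4) by (intro mult_left_mono) (auto simp: dist_norm norm_minus_commute)
    finally have "k < e" using k(1) s(3) by simp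
    then show "\<exists>l<e. conn p q l" using k(2) inv_chart[OF c p] inv_chart[OF c, of q] q by auto
  qed
qed

text \<open>In coordinates the squared distance agrees with the quadratic form at one of the points up to a
  third-order error. For the lower bound the form is shrunk to one which the metric dominates on a
  ball of radius proportional to the distance of the points, large enough that leaving this ball
  costs at least as much as the straight segment.\<close>

lemma local_distance:
  assumes c: "c \<in> A" and x: "x \<in> chart_image c"
  obtains r C k where "0 < r" "0 < k" "0 \<le> C" "ball x r \<subseteq> chart_image c"
    "\<And>m y. m \<in> ball x r \<Longrightarrow> y \<in> ball x r \<Longrightarrow>
      \<bar>(d (chart_inv c m) (chart_inv c y))\<^sup>2 - gc c m (y - m) (y - m)\<bar> \<le> C * norm (y - m) ^ 3"
    "\<And>m y. m \<in> ball x r \<Longrightarrow> y \<in> ball x r \<Longrightarrow> k * norm (y - m) \<le> d (chart_inv c m) (chart_inv c y)"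
proof -
  obtain r0 l L Q where r0: "0 < r0" "cball x r0 \<subseteq> chart_image c" and l: "0 < l" "l \<le> L" and Q: "0 < Q"
    and lo: "\<And>z u. z \<in> cball x r0 \<Longrightarrow> l * (norm u)\<^sup>2 \<le> gc c z u u"
    and hi: "\<And>z u. z \<in> cball x r0 \<Longrightarrow> gc c z u u \<le> L * (norm u)\<^sup>2"
    and lip: "\<And>z z' u. z \<in> cball x r0 \<Longrightarrow> z' \<in> cball x r0 \<Longrightarrow>
       \<bar>gc c z u u - gc c z' u u\<bar> \<le> Q * norm (z - z') * (norm u)\<^sup>2"
    using chart_bounds[OF c x] by metis
  have L: "0 < L" using l by simp
  \<comment> \<open>The straight segment has length at most sqrt L times the coordinate distance, and reaching the
    sphere of radius C0 times that distance costs at least as much.\<close>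
  define C0 where "C0 = sqrt L / sqrt (l / 2)"
  have C0: "1 \<le> C0" "sqrt (l / 2) * C0 = sqrt L"
  proof -
    have "sqrt (l / 2) \<le> sqrt L" using l by simp
    then show "1 \<le> C0" unfolding C0_def using l by (simp add: le_divide_eq)
    show "sqrt (l / 2) * C0 = sqrt L" unfolding C0_def using l by simp
  qed
  define r where "r = min (r0 / (1 + 2 * C0)) (l / (4 * Q * C0))"
  have r: "0 < r" "r + 2 * C0 * r \<le> r0" "Q * (C0 * (2 * r)) \<le> l / 2"
  proof -
    have C0': "0 < C0" using C0 by simp
    show "0 < r" unfolding r_def using r0 l Q C0' by (auto intro!: divide_pos_pos add_pos_pos)
    have "r * (1 + 2 * C0) \<le> (r0 / (1 + 2 * C0)) * (1 + 2 * C0)"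
      unfolding r_def using C0' by (intro mult_right_mono) auto
    also have "\<dots> = r0" using C0' by simp
    finally show "r + 2 * C0 * r \<le> r0" by (simp add: algebra_simps)
    have "r * (4 * Q * C0) \<le> (l / (4 * Q * C0)) * (4 * Q * C0)"
      unfolding r_def using C0' Q by (intro mult_right_mono) auto
    also have "\<dots> = l" using C0' Q by simp
    finally show "Q * (C0 * (2 * r)) \<le> l / 2" by (simp add: algebra_simps)
  qed
  have rr0: "r \<le> r0" using r C0 by (smt (verit) mult_nonneg_nonneg)
  have main: "(d (chart_inv c m) (chart_inv c y))\<^sup>2 \<le> gc c m (y - m) (y - m) + Q * norm (y - m) ^ 3 \<and>
      gc c m (y - m) (y - m) - Q * C0 * norm (y - m) ^ 3 \<le> (d (chart_inv c m) (chart_inv c y))\<^sup>2 \<and>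
      sqrt (l / 2) * norm (y - m) \<le> d (chart_inv c m) (chart_inv c y)"
    if my: "m \<in> ball x r" "y \<in> ball x r" "y \<noteq> m" for m y
  proof -
    let ?w = "y - m"
    have my0: "m \<in> cball x r0" "y \<in> cball x r0" using my rr0 by auto
    have yim: "y \<in> chart_image c" using my0 r0 by blast
    have w0: "0 < norm ?w" using my by simp
    have w2: "norm ?w < 2 * r"
      using dist_triangle_less_add[of m x r y r] my by (simp add: dist_commute dist_norm[symmetric])
    have seg: "closed_segment m y \<subseteq> cball x r0" using my0 by (intro closed_segment_subset) auto
    have "gc c z ?w ?w \<le> gc c m ?w ?w + Q * norm ?w ^ 3" if z: "z \<in> closed_segment m y" for z
    proof -
      have "norm (z - m) \<le> norm ?w" using segment_bound(1)[OF z] by (simp add: norm_minus_commute)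
      then have "Q * norm (z - m) * (norm ?w)\<^sup>2 \<le> Q * norm ?w * (norm ?w)\<^sup>2"
        using Q by (intro mult_right_mono mult_left_mono) auto
      moreover have "\<bar>gc c z ?w ?w - gc c m ?w ?w\<bar> \<le> Q * norm (z - m) * (norm ?w)\<^sup>2"
        using lip[of z m ?w] z seg my0 by blast
      ultimately show ?thesis by (simp add: power3_eq_cube power2_eq_square mult.assoc)
    qed
    then obtain k where k: "k \<le> sqrt (gc c m ?w ?w + Q * norm ?w ^ 3)"
      "conn (chart_inv c m) (chart_inv c y) k"
      using conn_segment[OF c] seg r0(2) by (meson order_trans)
    have mw: "0 \<le> gc c m ?w ?w" by (rule order_trans[OF _ lo[OF my0(1)]]) (use l in simp)
    have d0: "0 \<le> d (chart_inv c m) (chart_inv c y)"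
      unfolding d_conn using k(2) conn_nonneg by (intro cInf_greatest) auto
    have "(d (chart_inv c m) (chart_inv c y))\<^sup>2 \<le> (sqrt (gc c m ?w ?w + Q * norm ?w ^ 3))\<^sup>2"
      using d_le[OF k(2)] k(1) d0 by (intro power_mono) auto
    also have "\<dots> = gc c m ?w ?w + Q * norm ?w ^ 3" using mw Q by simp
    finally have up: "(d (chart_inv c m) (chart_inv c y))\<^sup>2 \<le> gc c m ?w ?w + Q * norm ?w ^ 3" .
    define \<rho> where "\<rho> = C0 * norm ?w"
    have \<rho>: "0 < \<rho>" "norm ?w \<le> \<rho>" "\<rho> < C0 * (2 * r)"
      unfolding \<rho>_def using C0 w0 w2 by (auto intro: mult_strict_left_mono)
    have sub: "cball m \<rho> \<subseteq> cball x r0"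
    proof
      fix z assume "z \<in> cball m \<rho>"
      then show "z \<in> cball x r0" using my(1) \<rho>(3) r(2) dist_triangle[of x z m] by (auto simp: algebra_simps)
    qed
    \<comment> \<open>On the ball of radius \<open>\<rho>\<close> about m the metric differs from its value at m by at most \<open>Q \<rho>\<close>.\<close>
    define B where "B u v = gc c m u v - Q * \<rho> * (u \<bullet> v)" for u v
    have Q\<rho>: "Q * \<rho> \<le> l / 2"
      using r(3) \<rho>(3) Q mult_left_mono[of \<rho> "C0 * (2 * r)" Q] by linarith
    have B_lo: "l / 2 * (norm u)\<^sup>2 \<le> B u u" for u
    proof -
      have "Q * \<rho> * (norm u)\<^sup>2 \<le> l / 2 * (norm u)\<^sup>2" using Q\<rho> by (intro mult_right_mono) auto
      then show ?thesis using lo[OF my0(1), of u] by (simp add: B_def power2_norm_eq_inner[symmetric])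
    qed
    have blm: "inner_form (gc c m)" using my0 r0 by (intro inner_form_gc c) auto
    have B: "inner_form B" unfolding inner_form_def
    proof (intro conjI allI impI)
      show "bilinear B" unfolding bilinear_def B_def
        using inner_formD(1)[OF blm]
        by (auto intro!: linearI simp: bilinear_ladd bilinear_radd bilinear_lmul bilinear_rmul
            inner_add_left inner_add_right algebra_simps)
      show "B u v = B v u" for u v unfolding B_def inner_formD(2)[OF blm, of u v] by (simp add: inner_commute)
      show "0 < B u u" if "u \<noteq> 0" for u
        by (rule less_le_trans[OF _ B_lo]) (use that l in simp)
    qed
    have Bge: "B u u \<le> gc c z u u" if z: "z \<in> cball m \<rho>" for z u
    proof -
      have "\<bar>gc c z u u - gc c m u u\<bar> \<le> Q * norm (z - m) * (norm u)\<^sup>2"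
        using lip[of z m u] z sub my0 by blast
      also have "\<dots> \<le> Q * \<rho> * (norm u)\<^sup>2"
        using z Q by (intro mult_right_mono mult_left_mono) (auto simp: dist_norm norm_minus_commute)
      finally show ?thesis by (simp add: B_def power2_norm_eq_inner[symmetric])
    qed
    have Bw: "sqrt (B ?w ?w) \<le> k'" if k': "conn (chart_inv c m) (chart_inv c y) k'" for k'
    proof -
      have "(chart_inv c y \<in> chart_dom c \<and> chart_map c (chart_inv c y) \<in> ball m \<rho> \<and>
         sqrt (B (chart_map c (chart_inv c y) - m) (chart_map c (chart_inv c y) - m)) \<le> k') \<or>
         (\<exists>z. norm z = \<rho> \<and> sqrt (B z z) \<le> k')"
        by (rule conn_ge_chart[OF c _ \<rho>(1) B Bge k']) (use sub r0 in auto)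
      then show ?thesis
      proof
        assume "\<exists>z. norm z = \<rho> \<and> sqrt (B z z) \<le> k'"
        then obtain z where z: "norm z = \<rho>" "sqrt (B z z) \<le> k'" by blast
        have "B ?w ?w \<le> L * (norm ?w)\<^sup>2"
          using Bge[of m ?w] hi[OF my0(1), of ?w] \<rho>(1) by simp
        then have "sqrt (B ?w ?w) \<le> sqrt (L * (norm ?w)\<^sup>2)" by simp
        also have "\<dots> = sqrt L * norm ?w" by (simp add: real_sqrt_mult)
        also have "\<dots> = sqrt (l / 2) * \<rho>" unfolding C0(2)[symmetric] \<rho>_def by simp
        also have "\<dots> = sqrt (l / 2 * (norm z)\<^sup>2)" unfolding z(1)[symmetric]
          by (simp only: real_sqrt_mult real_sqrt_abs abs_norm_cancel)
        also have "\<dots> \<le> sqrt (B z z)" using B_lo by simp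
        finally show ?thesis using z(2) by (rule order_trans)
      qed (simp add: chart_inv_inv[OF c yim])
    qed
    have dB: "sqrt (B ?w ?w) \<le> d (chart_inv c m) (chart_inv c y)"
      unfolding d_conn using k(2) Bw by (intro cInf_greatest) auto
    have Bw0: "0 \<le> B ?w ?w" using inner_formD(4)[OF B] .
    have "(sqrt (B ?w ?w))\<^sup>2 \<le> (d (chart_inv c m) (chart_inv c y))\<^sup>2"
      using dB Bw0 by (intro power_mono) auto
    then have "gc c m ?w ?w - Q * C0 * norm ?w ^ 3 \<le> (d (chart_inv c m) (chart_inv c y))\<^sup>2"
      using Bw0 by (simp add: B_def \<rho>_def power3_eq_cube power2_norm_eq_inner[symmetric] power2_eq_square mult.assoc)
    moreover have "sqrt (l / 2) * norm ?w \<le> d (chart_inv c m) (chart_inv c y)"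
    proof -
      have "sqrt (l / 2) * norm ?w = sqrt (l / 2 * (norm ?w)\<^sup>2)"
        by (simp only: real_sqrt_mult real_sqrt_abs abs_norm_cancel)
      also have "\<dots> \<le> sqrt (B ?w ?w)" using B_lo[of ?w] by simp
      finally show ?thesis using dB by simp
    qed
    ultimately show ?thesis using up by blast
  qed
  have dself: "d p p = 0" for p
    using d_le[OF conn_refl[of p]] cInf_greatest[of "{l. conn p p l}" 0] conn_refl conn_nonneg
    unfolding d_conn by (metis antisym empty_iff mem_Collect_eq)
  show ?thesis
  proof (rule that[of r "sqrt (l / 2)" "Q * C0"])
    show "0 < r" "0 < sqrt (l / 2)" "0 \<le> Q * C0" using r l Q C0 by auto
    show "ball x r \<subseteq> chart_image c" using r0(2) rr0 by (meson ball_subset_cball order_trans subset_cball)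
    fix m y assume my: "m \<in> ball x r" "y \<in> ball x r"
    have m0: "gc c m 0 0 = 0"
      using my r0(2) rr0 by (intro bilinear_lzero bilinear_gc c) auto
    show "\<bar>(d (chart_inv c m) (chart_inv c y))\<^sup>2 - gc c m (y - m) (y - m)\<bar> \<le> Q * C0 * norm (y - m) ^ 3"
    proof (cases "y = m")
      case True then show ?thesis using dself m0 by simp
    next
      case False
      have "Q * norm (y - m) ^ 3 \<le> Q * C0 * norm (y - m) ^ 3"
        using Q C0 by (intro mult_right_mono) auto
      then show ?thesis using main[OF my False] by linarith
    qed
    show "sqrt (l / 2) * norm (y - m) \<le> d (chart_inv c m) (chart_inv c y)"
      using main[OF my] dself by (cases "y = m") auto
  qed
qed

end

section \<open>The metric space structure\<close>

locale connected_riemannian = riemannian A g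
  for A :: "('a::{t2_space, second_countable_topology}, 'e::euclidean_space) chart set"
    and g :: "'a \<Rightarrow> 'e \<Rightarrow> 'e \<Rightarrow> real" +
  assumes connected: "connected (UNIV :: 'a set)"
begin

lemma conn_exists: "\<exists>l. conn p q l"
proof -
  let ?R = "{q. \<exists>l. conn p q l}"
  have near: "\<exists>T. open T \<and> q \<in> T \<and> (\<forall>s\<in>T. s \<in> ?R \<longleftrightarrow> q \<in> ?R)" for q
  proof -
    obtain U where U: "open U" "q \<in> U" "\<And>s. s \<in> U \<Longrightarrow> \<exists>l<1. conn q s l"
      using conn_near[OF zero_less_one, of q] by blast
    have "s \<in> ?R \<longleftrightarrow> q \<in> ?R" if s: "s \<in> U" for s
    proof -
      obtain l where l: "conn q s l" using U(3)[OF s] by blast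
      have "conn p q (k + l)" if "conn p s k" for k by (rule conn_trans[OF that conn_sym[OF l]])
      moreover have "conn p s (k + l)" if "conn p q k" for k by (rule conn_trans[OF that l])
      ultimately show ?thesis by blast
    qed
    then show ?thesis using U(1,2) by blast
  qed
  have "open ?R"
    unfolding open_subopen[of ?R] using near by (metis subsetI)
  moreover have "open (- ?R)"
    unfolding open_subopen[of "- ?R"] using near by (metis ComplD ComplI subsetI)
  ultimately have "?R = {} \<or> ?R = UNIV"
    using connected[unfolded connected_clopen] by (auto simp: closed_open)
  moreover have "p \<in> ?R" using conn_refl by blast
  ultimately show ?thesis by blast
qed

lemma d_ge: "(\<And>l. conn p q l \<Longrightarrow> k \<le> l) \<Longrightarrow> k \<le> d p q"
  unfolding d_conn using conn_exists by (intro cInf_greatest) auto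

lemma d_lessD: "d p q < k \<Longrightarrow> \<exists>l<k. conn p q l"
  unfolding d_conn using cInf_lessD[of "{l. conn p q l}" k] conn_exists by auto

lemma d_nonneg: "0 \<le> d p q"
  by (rule d_ge) (rule conn_nonneg)

lemma d_sym: "d p q = d q p"
proof -
  have "conn p q = conn q p" by (rule ext) (blast intro: conn_sym)
  then show ?thesis unfolding d_conn by simp
qed

lemma d_triangle: "d p r \<le> d p q + d q r"
proof (rule field_le_epsilon)
  fix e :: real assume e: "0 < e"
  obtain l k where "l < d p q + e / 2" "conn p q l" "k < d q r + e / 2" "conn q r k"
    using d_lessD[of p q "d p q + e / 2"] d_lessD[of q r "d q r + e / 2"] e by auto
  then show "d p r \<le> d p q + d q r + e" using d_le[OF conn_trans[of p q l r k]] by simp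
qed

lemma d_zero: "d p q = 0 \<longleftrightarrow> p = q"
proof
  assume z: "d p q = 0"
  show "p = q"
  proof (rule ccontr)
    assume "p \<noteq> q"
    then obtain U where U: "open U" "p \<in> U" "q \<notin> U" using hausdorff[of p q] by blast
    obtain e where e: "0 < e" "\<And>q l. conn p q l \<Longrightarrow> l < e \<Longrightarrow> q \<in> U"
      using conn_small[OF U(1,2)] by blast
    then show False using d_lessD[of p q e] z U(3) by auto
  qed
next
  assume "p = q"
  then show "d p q = 0" using d_le[OF conn_refl[of p]] d_nonneg[of p p] by simp
qed

sublocale metric: Metric_space UNIV d
  by unfold_locales (auto simp: d_nonneg d_zero d_sym d_triangle)

lemma mtopology_euclidean: "metric.mtopology = euclidean"
proof (rule topology_eq[THEN iffD2], rule allI)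
  fix U
  have "openin metric.mtopology U \<longleftrightarrow> (\<forall>x\<in>U. \<exists>r>0. \<forall>y. d x y < r \<longrightarrow> y \<in> U)"
    unfolding metric.openin_mtopology by (auto simp: subset_iff)
  also have "\<dots> \<longleftrightarrow> open U"
  proof
    assume *: "\<forall>x\<in>U. \<exists>r>0. \<forall>y. d x y < r \<longrightarrow> y \<in> U"
    have "\<exists>T. open T \<and> x \<in> T \<and> T \<subseteq> U" if x: "x \<in> U" for x
    proof -
      obtain r where r: "r > 0" "\<And>y. d x y < r \<Longrightarrow> y \<in> U" using * x by blast
      show ?thesis
      proof (rule conn_near[OF r(1)])
        fix V assume V: "open V" "x \<in> V" "\<And>q. q \<in> V \<Longrightarrow> \<exists>l<r. conn x q l"
        have "q \<in> U" if "q \<in> V" for q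
          using V(3)[OF that] d_le[of x q] r(2)[of q] by (auto dest: le_less_trans)
        then show ?thesis using V(1,2) by blast
      qed
    qed
    then show "open U" by (subst open_subopen) blast
  next
    assume U: "open U"
    show "\<forall>x\<in>U. \<exists>r>0. \<forall>y. d x y < r \<longrightarrow> y \<in> U"
    proof
      fix x assume x: "x \<in> U"
      show "\<exists>r>0. \<forall>y. d x y < r \<longrightarrow> y \<in> U"
      proof (rule conn_small[OF U x])
        fix e assume "0 < e" "\<And>q l. conn x q l \<Longrightarrow> l < e \<Longrightarrow> q \<in> U"
        then show "\<exists>r>0. \<forall>y. d x y < r \<longrightarrow> y \<in> U" using d_lessD by blast
      qed
    qed
  qed
  finally show "openin metric.mtopology U = openin euclidean U" by simp
qed

lemma d_tendsto_iff: "(f \<longlongrightarrow> q) F \<longleftrightarrow> ((\<lambda>t. d (f t) q) \<longlongrightarrow> 0) F"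
proof -
  have "(f \<longlongrightarrow> q) F \<longleftrightarrow> limitin metric.mtopology f q F"
    unfolding mtopology_euclidean by simp
  also have "\<dots> \<longleftrightarrow> ((\<lambda>t. d (f t) q) \<longlongrightarrow> 0) F"
    unfolding metric.limitin_metric tendsto_iff by (simp add: d_nonneg)
  finally show ?thesis .
qed

end

section \<open>Two regularity criteria for functions of a real variable\<close>

lemma has_vector_derivative_quotient:
  assumes "(f has_vector_derivative D) (at t within S)"
  shows "((\<lambda>y. (f y - f t) /\<^sub>R (y - t)) \<longlongrightarrow> D) (at t within S)"
proof (rule LIM_zero_cancel, rule tendsto_norm_zero_cancel)
  have "((\<lambda>y. (1 / norm (y - t)) *\<^sub>R (f y - (f t + (y - t) *\<^sub>R D))) \<longlongrightarrow> 0) (at t within S)"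
    using assms unfolding has_vector_derivative_def has_derivative_within by blast
  from tendsto_norm_zero[OF this] show "((\<lambda>y. norm ((f y - f t) /\<^sub>R (y - t) - D)) \<longlongrightarrow> 0) (at t within S)"
  proof (rule Lim_transform_eventually)
    have "norm ((1 / norm (y - t)) *\<^sub>R (f y - (f t + (y - t) *\<^sub>R D))) = norm ((f y - f t) /\<^sub>R (y - t) - D)"
      if "y \<noteq> t" for y
    proof -
      have "(f y - f t) /\<^sub>R (y - t) - D = inverse (y - t) *\<^sub>R (f y - (f t + (y - t) *\<^sub>R D))"
        using that by (simp add: scaleR_diff_right scaleR_add_right)
      then show ?thesis by (simp add: divide_inverse)
    qed
    then show "\<forall>\<^sub>F y in at t within S. norm ((1 / norm (y - t)) *\<^sub>R (f y - (f t + (y - t) *\<^sub>R D))) =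
        norm ((f y - f t) /\<^sub>R (y - t) - D)"
      by (simp add: eventually_at_filter)
  qed
qed

text \<open>A bound on second differences of an order larger than one forces differentiability: the
  dyadic difference quotients form a geometrically convergent series, and they are the derivatives of
  moving averages which tend to the function itself.\<close>

lemma second_difference_imp_C1:
  fixes f :: "real \<Rightarrow> 'e::euclidean_space"
  assumes ab: "a < b" and f: "continuous_on {a..b} f"
    and bd: "\<And>t h. 0 < h \<Longrightarrow> a \<le> t - h \<Longrightarrow> t + h \<le> b \<Longrightarrow>
      norm (f (t + h) - 2 *\<^sub>R f t + f (t - h)) \<le> C * (h * sqrt h)"
  obtains D where "continuous_on {a..(a+b)/2} D"
    "\<And>t. t \<in> {a..(a+b)/2} \<Longrightarrow> (f has_vector_derivative D t) (at t within {a..(a+b)/2})"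
proof -
  let ?S = "{a..(a+b)/2}"
  define e where "e = (b - a) / 2"
  have e: "0 < e" "(a + b) / 2 + e = b" using ab by (auto simp: e_def field_simps)
  define h where "h n = e / 2 ^ n" for n :: nat
  have h: "0 < h n" "h n \<le> e" "h n = 2 * h (Suc n)" for n
    using e by (auto simp: h_def field_simps)
  have inI: "t \<in> {a..b}" "t + h n \<in> {a..b}" if "t \<in> ?S" for t n
    using that h(1)[of n] h(2)[of n] e unfolding atLeastAtMost_iff by (intro conjI; linarith)+
  define D where "D n t = (f (t + h n) - f t) /\<^sub>R h n" for n t
  have C0: "0 \<le> C"
  proof -
    have "0 \<le> C * (e * sqrt e)"
      using order_trans[OF norm_ge_zero bd[of e "(a+b)/2"]] e by (simp add: e_def field_simps)
    moreover have "0 < e * sqrt e" using e by simp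
    ultimately show ?thesis by (metis mult_less_0_iff not_le)
  qed
  define q where "q = sqrt (1 / 2 :: real)"
  have q: "0 \<le> q" "q < 1" by (simp_all add: q_def)
  have sq: "sqrt (h n) = sqrt e * q ^ n" for n
  proof -
    have "h n = e * (1 / 2) ^ n" unfolding h_def power_one_over by simp
    then show ?thesis by (simp only: q_def real_sqrt_mult real_sqrt_power)
  qed
  have step: "norm (D (Suc n) t - D n t) \<le> C * sqrt e * q ^ n" if t: "t \<in> ?S" for n t
  proof -
    let ?k = "h (Suc n)"
    have k: "0 < ?k" "h n = 2 * ?k" by (rule h)+
    have "2 * ?k * norm (D (Suc n) t - D n t) = norm ((2 * ?k) *\<^sub>R (D (Suc n) t - D n t))"
      using k by simp
    also have "(2 * ?k) *\<^sub>R (D (Suc n) t - D n t) = - (f ((t + ?k) + ?k) - 2 *\<^sub>R f (t + ?k) + f ((t + ?k) - ?k))"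
    proof -
      have 1: "(2 * ?k) *\<^sub>R D (Suc n) t = 2 *\<^sub>R (f (t + ?k) - f t)" using k by (simp add: D_def)
      have 2: "(2 * ?k) *\<^sub>R D n t = f (t + 2 * ?k) - f t" using k by (simp add: D_def)
      have 3: "t + ?k + ?k = t + 2 * ?k" by simp
      have 4: "2 *\<^sub>R f t = f t + f t" by (simp add: scaleR_2)
      show ?thesis unfolding scaleR_diff_right[of _ "D (Suc n) t"] 1 2 3 scaleR_diff_right 4 by simp
    qed
    also have "norm \<dots> \<le> C * (?k * sqrt ?k)"
      unfolding norm_minus_cancel
      by (rule bd[OF k(1)]) (use inI(1)[OF t] inI(2)[OF t, of n] k in auto)
    also have "\<dots> \<le> C * (?k * sqrt (h n))"
      using k C0 by (intro mult_left_mono) auto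
    also have "\<dots> \<le> 2 * ?k * (C * sqrt (h n))"
    proof -
      have "0 \<le> ?k * (C * sqrt (h n))" using k C0 h(1)[of n] by simp
      then show ?thesis by (simp add: mult_ac)
    qed
    finally have "2 * ?k * norm (D (Suc n) t - D n t) \<le> 2 * ?k * (C * sqrt (h n))" .
    then have "norm (D (Suc n) t - D n t) \<le> C * sqrt (h n)" using k(1) by simp
    then show ?thesis by (simp add: sq mult.assoc)
  qed
  have unif: "uniform_limit ?S (\<lambda>n t. \<Sum>i<n. D (Suc i) t - D i t) (\<lambda>t. \<Sum>i. D (Suc i) t - D i t) sequentially"
    by (rule Weierstrass_m_test[of ?S _ "\<lambda>n. C * sqrt e * q ^ n"])
       (use step q in \<open>auto intro!: summable_mult summable_geometric\<close>)
  define E where "E t = D 0 t + (\<Sum>i. D (Suc i) t - D i t)" for t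
  have tele: "D n t = D 0 t + (\<Sum>i<n. D (Suc i) t - D i t)" for n t
    by (simp add: sum_lessThan_telescope[of "\<lambda>i. D i t"])
  have DE: "uniform_limit ?S D E sequentially"
  proof -
    have "uniform_limit ?S (\<lambda>n t. D 0 t + (\<Sum>i<n. D (Suc i) t - D i t)) E sequentially"
      unfolding E_def by (intro uniform_limit_intros unif)
    then show ?thesis unfolding tele[symmetric] .
  qed
  have Dcont: "continuous_on ?S (D n)" for n
    unfolding D_def
    by (intro continuous_intros continuous_on_compose2[OF f]) (use inI less_imp_le[OF h(1)[of n]] in auto)
  have Econt: "continuous_on ?S E"
    by (rule uniform_limit_theorem[OF _ DE]) (auto simp: Dcont)
  define F where "F t = integral {a..t} f" for t
  have F: "(F has_vector_derivative f t) (at t within {a..b})" if "t \<in> {a..b}" for t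
    unfolding F_def by (rule integral_has_vector_derivative[OF f that])
  define A where "A n t = (F (t + h n) - F t) /\<^sub>R h n" for n t
  have A: "(A n has_vector_derivative D n t) (at t within ?S)" if t: "t \<in> ?S" for n t
  proof -
    have im: "(\<lambda>t. t + h n) ` ?S \<subseteq> {a..b}" by (rule image_subsetI[OF inI(2)])
    have "((F \<circ> (\<lambda>t. t + h n)) has_vector_derivative 1 *\<^sub>R f (t + h n)) (at t within ?S)"
    proof (rule vector_diff_chain_within)
      show "((\<lambda>t. t + h n) has_vector_derivative 1) (at t within ?S)" by (auto intro!: derivative_eq_intros)
      show "(F has_vector_derivative f (t + h n)) (at (t + h n) within (\<lambda>t. t + h n) ` ?S)"
        by (rule has_vector_derivative_within_subset[OF F[OF inI(2)[OF t]] im])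
    qed
    then have 1: "((\<lambda>t. F (t + h n)) has_vector_derivative f (t + h n)) (at t within ?S)" by (simp add: o_def)
    have 2: "(F has_vector_derivative f t) (at t within ?S)"
      by (rule has_vector_derivative_within_subset[OF F[OF inI(1)[OF t]]]) (use inI in auto)
    show ?thesis
      unfolding A_def D_def
      by (rule has_vector_derivative_scaleR[OF DERIV_const has_vector_derivative_diff[OF 1 2], THEN has_vector_derivative_eq_rhs]) simp
  qed
  have h0: "h \<longlonglongrightarrow> 0"
    unfolding h_def using LIMSEQ_divide_realpow_zero[of 2 e] by simp
  have AL: "(\<lambda>n. A n t) \<longlonglongrightarrow> f t" if t: "t \<in> ?S" for t
  proof -
    have "((\<lambda>y. (F y - F t) /\<^sub>R (y - t)) \<longlongrightarrow> f t) (at t within {a..b})"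
      by (rule has_vector_derivative_quotient[OF F[OF inI(1)[OF t]]])
    moreover have "filterlim (\<lambda>n. t + h n) (at t within {a..b}) sequentially"
      unfolding filterlim_at
      using tendsto_add[OF tendsto_const h0, of t] inI(2)[OF t] h(1) by (auto simp: less_imp_neq[symmetric])
    ultimately have "((\<lambda>n. (F (t + h n) - F t) /\<^sub>R ((t + h n) - t)) \<longlongrightarrow> f t) sequentially"
      by (rule filterlim_compose)
    then show ?thesis by (simp add: A_def)
  qed
  have "\<exists>k. \<forall>t\<in>?S. (\<lambda>n. A n t) \<longlonglongrightarrow> k t \<and> (k has_derivative (\<lambda>y. y *\<^sub>R E t)) (at t within ?S)"
  proof (rule has_derivative_sequence[where f' = "\<lambda>n t y. y *\<^sub>R D n t" and ?x0.0 = a])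
    show "(A n has_derivative (\<lambda>y. y *\<^sub>R D n t)) (at t within ?S)" if "t \<in> ?S" for n t
      using A[OF that] unfolding has_vector_derivative_def .
    show "\<forall>\<^sub>F n in sequentially. \<forall>t\<in>?S. \<forall>y. norm (y *\<^sub>R D n t - y *\<^sub>R E t) \<le> \<epsilon> * norm y" if "\<epsilon> > 0" for \<epsilon>
      using uniform_limitD[OF DE that]
    proof eventually_elim
      case (elim n)
      show ?case
      proof (intro ballI allI)
        fix t y :: real assume "t \<in> ?S"
        then have "norm (D n t - E t) \<le> \<epsilon>" using elim by (force simp: dist_norm)
        then have "\<bar>y\<bar> * norm (D n t - E t) \<le> \<bar>y\<bar> * \<epsilon>" by (intro mult_left_mono) auto
        then show "norm (y *\<^sub>R D n t - y *\<^sub>R E t) \<le> \<epsilon> * norm y"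
          by (simp add: scaleR_diff_right[symmetric] mult.commute)
      qed
    qed
    show "a \<in> ?S" using ab by auto
    then show "(\<lambda>n. A n a) \<longlonglongrightarrow> f a" by (rule AL)
  qed simp
  then obtain k where k: "\<And>t. t \<in> ?S \<Longrightarrow> (\<lambda>n. A n t) \<longlonglongrightarrow> k t"
    "\<And>t. t \<in> ?S \<Longrightarrow> (k has_derivative (\<lambda>y. y *\<^sub>R E t)) (at t within ?S)" by blast
  have "k t = f t" if "t \<in> ?S" for t using LIMSEQ_unique[OF k(1)[OF that] AL[OF that]] .
  then have "(f has_vector_derivative E t) (at t within ?S)" if "t \<in> ?S" for t
    using has_vector_derivative_transform[OF that, of f k "E t"] k(2)[OF that]
    unfolding has_vector_derivative_def by auto
  then show ?thesis using that[OF Econt] by blast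
qed

text \<open>Integration by parts turns the hypothesis into the vanishing of the integral of
  \<open>(P - H) \<phi>'\<close>, where H is a primitive of Q. Choosing for \<open>\<phi>'\<close> the deviation of
  P - H from its mean value shows that P - H is constant.\<close>

lemma du_Bois_Reymond:
  fixes P Q :: "real \<Rightarrow> real"
  assumes ab: "a < b" and P: "continuous_on {a..b} P" and Q: "continuous_on {a..b} Q"
    and test: "\<And>\<phi> \<phi>'. (\<And>t. t \<in> {a..b} \<Longrightarrow> (\<phi> has_real_derivative \<phi>' t) (at t within {a..b})) \<Longrightarrow>
       continuous_on {a..b} \<phi>' \<Longrightarrow> \<phi> a = 0 \<Longrightarrow> \<phi> b = 0 \<Longrightarrow>
       integral {a..b} (\<lambda>t. Q t * \<phi> t + P t * \<phi>' t) = 0"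
    and t: "t \<in> {a..b}"
  shows "(P has_real_derivative Q t) (at t within {a..b})"
proof -
  have int: "f integrable_on {a..b}" if "continuous_on {a..b} f" for f :: "real \<Rightarrow> real"
    using that by (rule integrable_continuous_real)
  define H where "H t = integral {a..t} Q" for t
  have H: "(H has_real_derivative Q t) (at t within {a..b})" if "t \<in> {a..b}" for t
    using integral_has_vector_derivative[OF Q that]
    by (simp add: H_def[abs_def] has_real_derivative_iff_has_vector_derivative)
  have Hc: "continuous_on {a..b} H" using H by (rule DERIV_continuous_on)
  define R where "R t = P t - H t" for t
  have Rc: "continuous_on {a..b} R" unfolding R_def by (intro continuous_intros P Hc)
  define m where "m = integral {a..b} R / (b - a)"
  define \<phi> where "\<phi> t = integral {a..t} (\<lambda>t. R t - m)" for t
  have Rm: "continuous_on {a..b} (\<lambda>t. R t - m)" by (intro continuous_intros Rc)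
  have \<phi>: "(\<phi> has_real_derivative R t - m) (at t within {a..b})" if "t \<in> {a..b}" for t
    using integral_has_vector_derivative[OF Rm that]
    by (simp add: \<phi>_def[abs_def] has_real_derivative_iff_has_vector_derivative)
  have \<phi>c: "continuous_on {a..b} \<phi>" using \<phi> by (rule DERIV_continuous_on)
  have intm: "integral {a..b} (\<lambda>t. R t - m) = 0"
    using ab integral_diff[OF int[OF Rc] integrable_const_ivl[of m a b]] by (simp add: m_def)
  then have \<phi>ab: "\<phi> a = 0" "\<phi> b = 0" by (auto simp: \<phi>_def)
  have 1: "integral {a..b} (\<lambda>t. Q t * \<phi> t + P t * (R t - m)) = 0"
    by (rule test[OF \<phi> Rm \<phi>ab])
  have "((\<lambda>t. Q t * \<phi> t + H t * (R t - m)) has_integral (H b * \<phi> b - H a * \<phi> a)) {a..b}"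
  proof (rule fundamental_theorem_of_calculus)
    show "((\<lambda>t. H t * \<phi> t) has_vector_derivative Q t * \<phi> t + H t * (R t - m)) (at t within {a..b})"
      if "t \<in> {a..b}" for t
      unfolding has_real_derivative_iff_has_vector_derivative[symmetric]
      by (rule DERIV_mult'[OF H[OF that] \<phi>[OF that], THEN DERIV_cong]) simp
  qed (use ab in auto)
  then have 2: "integral {a..b} (\<lambda>t. Q t * \<phi> t + H t * (R t - m)) = 0"
    using \<phi>ab by (auto simp: integral_unique)
  have i1: "((\<lambda>t. Q t * \<phi> t + P t * (R t - m)) has_integral 0) {a..b}"
    by (subst 1[symmetric]) (intro integrable_integral int continuous_intros P Q \<phi>c Rc)
  have i2: "((\<lambda>t. Q t * \<phi> t + H t * (R t - m)) has_integral 0) {a..b}"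
    by (subst 2[symmetric]) (intro integrable_integral int continuous_intros Hc Q \<phi>c Rc)
  have "((\<lambda>t. R t - m) has_integral 0) {a..b}"
    by (subst intm[symmetric]) (intro integrable_integral int Rm)
  then have i3: "((\<lambda>t. m * (R t - m)) has_integral m * 0) {a..b}" by (rule has_integral_mult_right)
  have "((\<lambda>t. (R t - m)\<^sup>2) has_integral 0 - 0 - m * 0) {a..b}"
    by (rule has_integral_eq[OF _ has_integral_diff[OF has_integral_diff[OF i1 i2] i3]])
       (simp add: R_def power2_eq_square algebra_simps)
  then have z: "integral {a..b} (\<lambda>t. (R t - m)\<^sup>2) = 0" by (simp add: integral_unique)
  have "continuous_on {a..b} (\<lambda>t. (R t - m)\<^sup>2)" by (intro continuous_intros Rc)
  from integral_eq_0_iff[OF this ab] z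
  have "(R t - m)\<^sup>2 = 0" if t: "t \<in> {a..b}" for t using t by auto
  then have R: "R t = m" if "t \<in> {a..b}" for t using that by simp
  have "((\<lambda>t. m + H t) has_real_derivative Q t) (at t within {a..b})"
    using H[OF t] by (auto intro!: derivative_eq_intros)
  then show ?thesis
    by (rule has_field_derivative_transform_within[where d = 1]) (use R t in \<open>auto simp: R_def algebra_simps\<close>)
qed

section \<open>Distance-preserving curves are geodesics\<close>

context riemannian
begin

abbreviation dgc where "dgc c \<equiv> metric_deriv UNIV (gc c)"

lemma dgc_deriv:
  assumes "c \<in> A" "x \<in> chart_image c"
  shows "((\<lambda>y. gc c y u v) has_derivative (\<lambda>k. dgc c x k u v)) (at x)"
  using Ck_on_SucD[OF gc_Ck[OF assms(1)] assms(2)] by (simp add: metric_deriv_def)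

lemma linear_dgc: "c \<in> A \<Longrightarrow> x \<in> chart_image c \<Longrightarrow> linear (\<lambda>k. dgc c x k u v)"
  using dgc_deriv has_derivative_linear by blast

lemma dgc_expand:
  assumes "c \<in> A" "x \<in> chart_image c"
  shows "dgc c x k u v = (\<Sum>i\<in>Basis. \<Sum>j\<in>Basis. (u \<bullet> i) * (v \<bullet> j) * dgc c x k i j)"
proof -
  have "((\<lambda>y. gc c y u v) has_derivative
      (\<lambda>k. \<Sum>i\<in>Basis. \<Sum>j\<in>Basis. (u \<bullet> i) * (v \<bullet> j) * dgc c x k i j)) (at x)"
  proof (rule has_derivative_transform_within_open[OF _ open_image[OF assms(1)] assms(2)])
    show "((\<lambda>y. \<Sum>i\<in>Basis. \<Sum>j\<in>Basis. (u \<bullet> i) * (v \<bullet> j) * gc c y i j) has_derivative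
      (\<lambda>k. \<Sum>i\<in>Basis. \<Sum>j\<in>Basis. (u \<bullet> i) * (v \<bullet> j) * dgc c x k i j)) (at x)"
      by (intro has_derivative_sum has_derivative_mult_right dgc_deriv assms)
  qed (rule bilinear_expand[OF bilinear_gc[OF assms(1)], symmetric])
  from fun_cong[OF has_derivative_unique[OF dgc_deriv[OF assms] this]] show ?thesis .
qed

lemma bilinear_dgc:
  assumes "c \<in> A" "x \<in> chart_image c"
  shows "bilinear (dgc c x k)"
proof -
  have "dgc c x k u v = (\<Sum>i\<in>Basis. \<Sum>j\<in>Basis. (u \<bullet> i) * (v \<bullet> j) * dgc c x k i j)" for u v
    by (rule dgc_expand[OF assms])
  then have eq: "dgc c x k = (\<lambda>u v. \<Sum>i\<in>Basis. \<Sum>j\<in>Basis. (u \<bullet> i) * (v \<bullet> j) * dgc c x k i j)"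
    by (intro ext)
  have "bilinear (\<lambda>u v. \<Sum>i\<in>Basis. \<Sum>j\<in>Basis. (u \<bullet> i) * (v \<bullet> j) * dgc c x k i j)"
    unfolding bilinear_def
    by (auto intro!: linearI simp: inner_add_left sum.distrib sum_distrib_left algebra_simps)
  then show ?thesis by (rule ssubst[OF eq])
qed

lemma gc_continuous:
  assumes "c \<in> A" "continuous_on T x" "x ` T \<subseteq> chart_image c" "continuous_on T u" "continuous_on T v"
  shows "continuous_on T (\<lambda>t. gc c (x t) (u t) (v t))"
proof (rule continuous_on_form[where F = "\<lambda>t. gc c (x t)"])
  show "bilinear (gc c (x t))" if "t \<in> T" for t using assms(1,3) that by (intro bilinear_gc) auto
  show "continuous_on T (\<lambda>t. gc c (x t) u v)" for u v
    by (rule continuous_on_compose2[OF gc_cont[OF assms(1)] assms(2,3)])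
qed (rule assms)+

lemma dgc_continuous:
  assumes c: "c \<in> A" and x: "continuous_on T x" "x ` T \<subseteq> chart_image c"
    and k: "continuous_on T k" and uv: "continuous_on T u" "continuous_on T v"
  shows "continuous_on T (\<lambda>t. dgc c (x t) (k t) (u t) (v t))"
proof (rule continuous_on_form[where F = "\<lambda>t. dgc c (x t) (k t)"])
  have im: "x t \<in> chart_image c" if "t \<in> T" for t using x(2) that by blast
  show "bilinear (dgc c (x t) (k t))" if "t \<in> T" for t by (rule bilinear_dgc[OF c im[OF that]])
  show "continuous_on T (\<lambda>t. dgc c (x t) (k t) u v)" for u v
  proof -
    have "continuous_on (chart_image c) (\<lambda>y. dgc c y i u v)" for i
      using gc_Ck[OF c, of "Suc 0" u v] by (simp add: metric_deriv_def)
    from continuous_on_compose2[OF this x]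
    have "continuous_on T (\<lambda>t. \<Sum>i\<in>Basis. (k t \<bullet> i) * dgc c (x t) i u v)"
      by (intro continuous_intros k)
    then show ?thesis
      by (rule continuous_on_eq) (rule linear_expand[OF linear_dgc[OF c im], symmetric])
  qed
qed (rule uv)+

lemma christoffel_unique:
  assumes c: "c \<in> A" and x: "x \<in> chart_image c"
  shows "christoffel UNIV (gc c) x u v = z \<longleftrightarrow>
    (\<forall>w. gc c x z w = (dgc c x u v w + dgc c x v u w - dgc c x w u v) / 2)"
proof -
  have "linear (\<lambda>w. (dgc c x u v w + dgc c x v u w - dgc c x w u v) / 2)"
    by (intro linearI) (simp_all add: bilinear_radd[OF bilinear_dgc[OF c x]] bilinear_rmul[OF bilinear_dgc[OF c x]]
        linear_add[OF linear_dgc[OF c x]] linear_scale[OF linear_dgc[OF c x]] field_simps)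
  note riesz = inner_form_riesz[OF inner_form_gc[OF c x] this]
  define P where "P z \<longleftrightarrow> (\<forall>w. gc c x z w = (dgc c x u v w + dgc c x v u w - dgc c x w u v) / 2)" for z
  have ex1: "\<exists>!z. P z" unfolding P_def by (rule riesz)
  have "christoffel UNIV (gc c) x u v = (THE z. P z)"
    by (simp only: christoffel_def UNIV_I ball_UNIV simp_thms P_def)
  then have "christoffel UNIV (gc c) x u v = z \<longleftrightarrow> P z"
    using theI'[OF ex1] the1_equality[OF ex1, of z] by auto
  then show ?thesis unfolding P_def .
qed

text \<open>The geodesic equation in the form in which it arises from the first variation of energy.\<close>

lemma christoffel_diag:
  assumes c: "c \<in> A" and x: "x \<in> chart_image c"
  shows "christoffel UNIV (gc c) x u u = z \<longleftrightarrow>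
    (\<forall>w. gc c x z w = dgc c x u u w - dgc c x w u u / 2)"
  unfolding christoffel_unique[OF c x] by (simp add: field_simps)

text \<open>Among curves with the same end points a distance-realizing unit-speed curve minimizes not only
  the length but also the energy, because \<open>2 sqrt e \<le> 1 + e\<close> with equality for e = 1. The energy of
  a linear variation is differentiable in the parameter, so its derivative vanishes.\<close>

lemma first_variation:
  assumes c: "c \<in> A" and ab: "a < b"
    and x: "\<And>t. t \<in> {a..b} \<Longrightarrow> (x has_vector_derivative D t) (at t within {a..b})"
    and D: "continuous_on {a..b} D" and im: "x ` {a..b} \<subseteq> chart_image c"
    and unit: "\<And>t. t \<in> {a..b} \<Longrightarrow> gc c (x t) (D t) (D t) = 1"
    and min: "d (chart_inv c (x a)) (chart_inv c (x b)) = b - a"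
    and \<psi>: "\<And>t. t \<in> {a..b} \<Longrightarrow> (\<psi> has_vector_derivative \<psi>' t) (at t within {a..b})"
    and \<psi>': "continuous_on {a..b} \<psi>'" and ends: "\<psi> a = 0" "\<psi> b = 0"
  shows "integral {a..b} (\<lambda>t. dgc c (x t) (\<psi> t) (D t) (D t) + 2 * gc c (x t) (D t) (\<psi>' t)) = 0"
proof -
  have xc: "continuous_on {a..b} x" by (rule continuous_on_vector_derivative[OF x])
  have \<psi>c: "continuous_on {a..b} \<psi>" by (rule continuous_on_vector_derivative[OF \<psi>])
  have cx: "compact (x ` {a..b})" by (rule compact_continuous_image[OF xc compact_Icc])
  obtain \<epsilon> where \<epsilon>: "0 < \<epsilon>" "(\<Union>y\<in>x ` {a..b}. ball y \<epsilon>) \<subseteq> chart_image c"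
    using compact_subset_open_imp_ball_epsilon_subset[OF cx open_image[OF c] im] by blast
  obtain M where M: "0 < M" "\<And>t. t \<in> {a..b} \<Longrightarrow> norm (\<psi> t) \<le> M"
    using compact_imp_bounded[OF compact_continuous_image[OF \<psi>c compact_Icc]]
    unfolding bounded_pos by auto
  define s0 where "s0 = \<epsilon> / (2 * M)"
  have s0: "0 < s0" using \<epsilon> M by (simp add: s0_def)
  let ?U = "{- s0..s0}"
  have im': "x t + s *\<^sub>R \<psi> t \<in> chart_image c" if "s \<in> ?U" "t \<in> {a..b}" for s t
  proof -
    have "norm (s *\<^sub>R \<psi> t) \<le> s0 * M" using that M by (auto intro!: mult_mono)
    also have "\<dots> < \<epsilon>" using \<epsilon> M by (simp add: s0_def)
    finally have "x t + s *\<^sub>R \<psi> t \<in> ball (x t) \<epsilon>" by (simp add: dist_norm)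
    then show ?thesis using \<epsilon>(2) that by blast
  qed
  define f where "f s t = gc c (x t + s *\<^sub>R \<psi> t) (D t + s *\<^sub>R \<psi>' t) (D t + s *\<^sub>R \<psi>' t)" for s t
  define f' where "f' s t = dgc c (x t + s *\<^sub>R \<psi> t) (\<psi> t) (D t + s *\<^sub>R \<psi>' t) (D t + s *\<^sub>R \<psi>' t) +
      2 * gc c (x t + s *\<^sub>R \<psi> t) (D t + s *\<^sub>R \<psi>' t) (\<psi>' t)" for s t
  have fd: "((\<lambda>s. f s t) has_field_derivative f' s t) (at s within ?U)" if st: "s \<in> ?U" "t \<in> {a..b}" for s t
  proof -
    let ?T = "(\<lambda>s. x t + s *\<^sub>R \<psi> t) -` chart_image c"
    have T: "open ?T" by (intro open_vimage open_image c continuous_intros)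
    have sT: "s \<in> ?T" using im'[OF st] by simp
    have "((\<lambda>s. f s t) has_derivative (\<lambda>k. dgc c (x t + s *\<^sub>R \<psi> t) (k *\<^sub>R \<psi> t) (D t + s *\<^sub>R \<psi>' t) (D t + s *\<^sub>R \<psi>' t) +
      gc c (x t + s *\<^sub>R \<psi> t) (k *\<^sub>R \<psi>' t) (D t + s *\<^sub>R \<psi>' t) +
      gc c (x t + s *\<^sub>R \<psi> t) (D t + s *\<^sub>R \<psi>' t) (k *\<^sub>R \<psi>' t))) (at s)"
      unfolding f_def
    proof (rule has_derivative_form[where F = "\<lambda>s. gc c (x t + s *\<^sub>R \<psi> t)" and t = s
          and DF = "\<lambda>k. dgc c (x t + s *\<^sub>R \<psi> t) (k *\<^sub>R \<psi> t)" and Q' = "\<lambda>k. k *\<^sub>R \<psi>' t"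
          and R' = "\<lambda>k. k *\<^sub>R \<psi>' t", OF T sT])
      show "bilinear (gc c (x t + s *\<^sub>R \<psi> t))" if "s \<in> ?T" for s using that by (intro bilinear_gc c) simp
      show "((\<lambda>s. gc c (x t + s *\<^sub>R \<psi> t) u v) has_derivative (\<lambda>k. dgc c (x t + s *\<^sub>R \<psi> t) (k *\<^sub>R \<psi> t) u v)) (at s)" for u v
        by (rule has_derivative_compose[where f = "\<lambda>s. x t + s *\<^sub>R \<psi> t", OF _ dgc_deriv[OF c im'[OF st]]])
           (auto intro!: derivative_eq_intros)
    qed (auto intro!: derivative_eq_intros)
    moreover have "dgc c (x t + s *\<^sub>R \<psi> t) (k *\<^sub>R \<psi> t) (D t + s *\<^sub>R \<psi>' t) (D t + s *\<^sub>R \<psi>' t) +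
      gc c (x t + s *\<^sub>R \<psi> t) (k *\<^sub>R \<psi>' t) (D t + s *\<^sub>R \<psi>' t) +
      gc c (x t + s *\<^sub>R \<psi> t) (D t + s *\<^sub>R \<psi>' t) (k *\<^sub>R \<psi>' t) = f' s t * k" for k
      unfolding f'_def linear_scale[OF linear_dgc[OF c im'[OF st]]]
        bilinear_lmul[OF bilinear_gc[OF c im'[OF st]]] bilinear_rmul[OF bilinear_gc[OF c im'[OF st]]]
        inner_formD(2)[OF inner_form_gc[OF c im'[OF st]], of "\<psi>' t"]
      by (simp add: algebra_simps)
    ultimately have "((\<lambda>s. f s t) has_derivative (\<lambda>k. f' s t * k)) (at s)" by simp
    then show ?thesis unfolding has_field_derivative_def by (rule has_derivative_at_withinI)
  qed
  have c2: "continuous_on (?U \<times> {a..b}) (\<lambda>p. x (snd p) + fst p *\<^sub>R \<psi> (snd p))"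
      "continuous_on (?U \<times> {a..b}) (\<lambda>p. D (snd p) + fst p *\<^sub>R \<psi>' (snd p))"
      "continuous_on (?U \<times> {a..b}) (\<lambda>p. \<psi>' (snd p))" "continuous_on (?U \<times> {a..b}) (\<lambda>p. \<psi> (snd p))"
    by (intro continuous_intros continuous_on_compose2[OF xc] continuous_on_compose2[OF \<psi>c]
        continuous_on_compose2[OF D] continuous_on_compose2[OF \<psi>']; auto)+
  have im2: "(\<lambda>p. x (snd p) + fst p *\<^sub>R \<psi> (snd p)) ` (?U \<times> {a..b}) \<subseteq> chart_image c"
    using im' by auto
  have f'c: "continuous_on (?U \<times> {a..b}) (\<lambda>(s, t). f' s t)"
    unfolding f'_def case_prod_beta
    by (intro continuous_on_add continuous_on_mult_left dgc_continuous gc_continuous c c2 im2)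
  have fc: "continuous_on {a..b} (f s)" if s: "s \<in> ?U" for s
    unfolding f_def
    by (intro gc_continuous c continuous_intros xc \<psi>c D \<psi>') (use im' s in auto)
  have fi: "f s integrable_on {a..b}" if "s \<in> ?U" for s
    by (rule integrable_continuous_real[OF fc[OF that]])
  have "((\<lambda>s. integral (cbox a b) (f s)) has_field_derivative integral (cbox a b) (f' 0)) (at 0 within ?U)"
    by (rule leibniz_rule_field_derivative) (use fd fi f'c s0 in \<open>auto simp: cbox_interval\<close>)
  moreover have "at 0 within ?U = at 0" using s0 by (intro at_within_interior) auto
  ultimately have der: "((\<lambda>s. integral {a..b} (f s)) has_real_derivative integral {a..b} (f' 0)) (at 0)"
    by (simp add: cbox_interval)
  have E0: "integral {a..b} (f 0) = b - a"
  proof -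
    have "integral {a..b} (f 0) = integral {a..b} (\<lambda>t. 1)"
      by (rule integral_cong) (simp add: f_def unit)
    then show ?thesis using ab by simp
  qed
  have "b - a \<le> integral {a..b} (f s)" if s: "s \<in> ?U" for s
  proof -
    have \<xi>: "((\<lambda>t. x t + s *\<^sub>R \<psi> t) has_vector_derivative (D t + s *\<^sub>R \<psi>' t)) (at t within {a..b})"
      if "t \<in> {a..b}" for t
      by (rule has_vector_derivative_eq_rhs) (auto intro!: derivative_eq_intros x \<psi> that)
    have \<xi>': "continuous_on {a..b} (\<lambda>t. D t + s *\<^sub>R \<psi>' t)" by (intro continuous_intros D \<psi>')
    have imx: "(\<lambda>t. x t + s *\<^sub>R \<psi> t) ` {a..b} \<subseteq> chart_image c" using im' s by blast
    note L = chart_curve_len[OF c less_imp_le[OF ab] \<xi> \<xi>' imx]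
    let ?\<xi> = "chart_inv c \<circ> (\<lambda>t. x t + s *\<^sub>R \<psi> t)"
    have "b - a \<le> len a b ?\<xi>"
      using d_le_len[OF L(1) less_imp_le[OF ab]] ends min by simp
    moreover have "len a b ?\<xi> \<le> (b - a + integral {a..b} (f s)) / 2"
    proof (rule has_integral_le[OF L(2)])
      have "((\<lambda>t. (1::real)) has_integral (b - a)) {a..b}"
        using has_integral_const_real[of "1::real" a b] ab by simp
      from has_integral_divide[OF has_integral_add[OF this integrable_integral[OF fi[OF s]]], of 2]
      show "((\<lambda>t. (1 + f s t) / 2) has_integral (b - a + integral {a..b} (f s)) / 2) {a..b}" .
      fix t assume t: "t \<in> {a..b}"
      have f0: "0 \<le> f s t" unfolding f_def
        by (rule inner_formD(4)[OF inner_form_gc[OF c im'[OF s t]]])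
      have "0 \<le> (sqrt (f s t) - 1)\<^sup>2" by simp
      then have "2 * sqrt (f s t) \<le> 1 + f s t"
        using f0 by (simp add: power2_diff)
      then show "sqrt (gc c (x t + s *\<^sub>R \<psi> t) (D t + s *\<^sub>R \<psi>' t) (D t + s *\<^sub>R \<psi>' t)) \<le> (1 + f s t) / 2"
        by (simp add: f_def)
    qed
    ultimately show ?thesis by simp
  qed
  then have "integral {a..b} (f 0) \<le> integral {a..b} (f s)" if "\<bar>0 - s\<bar> < s0" for s
    unfolding E0 using that by (simp add: abs_less_iff)
  then have "integral {a..b} (f' 0) = 0"
    by (intro DERIV_local_min[OF der s0]) blast
  moreover have "f' 0 = (\<lambda>t. dgc c (x t) (\<psi> t) (D t) (D t) + 2 * gc c (x t) (D t) (\<psi>' t))"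
    by (simp add: f'_def fun_eq_iff)
  ultimately show ?thesis by simp
qed

end

context connected_riemannian
begin

lemma isometric_curve_continuous:
  assumes "\<And>s t. s \<in> {a<..<b} \<Longrightarrow> t \<in> {a<..<b} \<Longrightarrow> d (\<gamma> s) (\<gamma> t) = \<bar>s - t\<bar>"
  shows "continuous_on {a<..<b} \<gamma>"
proof (rule continuous_at_imp_continuous_on, rule ballI)
  fix t assume t: "t \<in> {a<..<b}"
  have ev: "\<forall>\<^sub>F s in at t. s \<in> {a<..<b}" using t by (intro eventually_at_in_open') auto
  have "((\<lambda>s. \<bar>s - t\<bar>) \<longlongrightarrow> 0) (at t)"
    by (rule tendsto_eq_rhs[OF tendsto_rabs[OF tendsto_diff[OF tendsto_ident_at tendsto_const]]]) simp
  then have "((\<lambda>s. d (\<gamma> s) (\<gamma> t)) \<longlongrightarrow> 0) (at t)"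
    by (rule Lim_transform_eventually) (use ev in eventually_elim, use assms t in auto)
  then show "isCont \<gamma> t" unfolding isCont_def d_tendsto_iff .
qed

text \<open>Let m be the point at time t, and P and R the coordinate displacements from time t to t + h and
  from t - h to t. Up to errors of order \<open>h\<^sup>3\<close>, the form at m has the value \<open>h\<^sup>2\<close> on P and on R
  and \<open>4 h\<^sup>2\<close> on P + R, so by the parallelogram identity its value on the second difference P - R
  is of order \<open>h\<^sup>3\<close>.\<close>

lemma isometric_curve_C1:
  assumes iso: "\<And>s t. s \<in> {a<..<b} \<Longrightarrow> t \<in> {a<..<b} \<Longrightarrow> d (\<gamma> s) (\<gamma> t) = \<bar>s - t\<bar>"
    and t0: "t0 \<in> {a<..<b}" and c: "c \<in> A" "\<gamma> t0 \<in> chart_dom c"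
  obtains \<alpha> \<beta> D where "\<alpha> < t0" "t0 < \<beta>" "{\<alpha>..\<beta>} \<subseteq> {a<..<b}" "\<And>t. t \<in> {\<alpha>..\<beta>} \<Longrightarrow> \<gamma> t \<in> chart_dom c"
    "continuous_on {\<alpha>..\<beta>} D"
    "\<And>t. t \<in> {\<alpha>..\<beta>} \<Longrightarrow> ((chart_map c \<circ> \<gamma>) has_vector_derivative D t) (at t within {\<alpha>..\<beta>})"
    "\<And>t. t \<in> {\<alpha>..\<beta>} \<Longrightarrow> gc c (chart_map c (\<gamma> t)) (D t) (D t) = 1"
proof -
  let ?x = "chart_map c \<circ> \<gamma>"
  have x0: "?x t0 \<in> chart_image c" using c by simp
  obtain r C k where r: "0 < r" "0 < k" "0 \<le> C"
    and dist: "\<And>m y. m \<in> ball (?x t0) r \<Longrightarrow> y \<in> ball (?x t0) r \<Longrightarrow>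
      \<bar>(d (chart_inv c m) (chart_inv c y))\<^sup>2 - gc c m (y - m) (y - m)\<bar> \<le> C * norm (y - m) ^ 3"
    "\<And>m y. m \<in> ball (?x t0) r \<Longrightarrow> y \<in> ball (?x t0) r \<Longrightarrow> k * norm (y - m) \<le> d (chart_inv c m) (chart_inv c y)"
    using local_distance[OF c(1) x0] by metis
  obtain r2 l Q where r2: "0 < r2" "cball (?x t0) r2 \<subseteq> chart_image c" and l: "0 < l" and Q: "0 < Q"
    and lo: "\<And>z u. z \<in> cball (?x t0) r2 \<Longrightarrow> l * (norm u)\<^sup>2 \<le> gc c z u u"
    and lip: "\<And>z z' u. z \<in> cball (?x t0) r2 \<Longrightarrow> z' \<in> cball (?x t0) r2 \<Longrightarrow>
       \<bar>gc c z u u - gc c z' u u\<bar> \<le> Q * norm (z - z') * (norm u)\<^sup>2"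
    using chart_bounds[OF c(1) x0] by metis
  have \<gamma>c: "continuous_on {a<..<b} \<gamma>" by (rule isometric_curve_continuous[OF iso])
  have cont0: "isCont \<gamma> t0" using \<gamma>c t0 by (simp add: continuous_on_eq_continuous_at)
  let ?W = "chart_dom c \<inter> chart_map c -` ball (?x t0) (min r r2)"
  have "open ?W" by (rule continuous_open_preimage[OF cont_chart[OF c(1)] open_dom[OF c(1)]]) simp
  moreover have "\<gamma> t0 \<in> ?W" using c r r2 by simp
  ultimately have "\<forall>\<^sub>F t in nhds t0. \<gamma> t \<in> ?W"
    using cont0 unfolding isCont_def tendsto_at_iff_tendsto_nhds by (rule topological_tendstoD[rotated])
  moreover have "\<forall>\<^sub>F t in nhds t0. t \<in> {a<..<b}" using t0 by (intro eventually_nhds_in_open) auto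
  ultimately have "\<forall>\<^sub>F t in nhds t0. t \<in> {a<..<b} \<and> \<gamma> t \<in> ?W" by (rule eventually_conj[rotated])
  then obtain \<delta> where \<delta>: "0 < \<delta>" "\<And>t. dist t t0 < \<delta> \<Longrightarrow> t \<in> {a<..<b} \<and> \<gamma> t \<in> ?W"
    unfolding eventually_nhds_metric by blast
  define J where "J = ball t0 \<delta>"
  have J: "t \<in> {a<..<b}" "\<gamma> t \<in> chart_dom c" "?x t \<in> ball (?x t0) r" "?x t \<in> cball (?x t0) r2"
    "?x t \<in> chart_image c" if "t \<in> J" for t
    using \<delta>(2)[of t] that by (auto simp: J_def dist_commute)
  define K where "K = 1 / k"
  have K: "0 < K" using r by (simp add: K_def)
  have F1: "norm (?x t - ?x s) \<le> K * \<bar>t - s\<bar>" if "s \<in> J" "t \<in> J" for s t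
    using dist(2)[OF J(3)[OF that(1)] J(3)[OF that(2)]] iso[of s t] J that inv_chart[OF c(1)] r
    by (simp add: K_def field_simps abs_minus_commute)
  define M where "M = C * K ^ 3"
  have M: "0 \<le> M" using r K by (simp add: M_def)
  have F2: "\<bar>(t - s)\<^sup>2 - gc c (?x s) (?x t - ?x s) (?x t - ?x s)\<bar> \<le> M * \<bar>t - s\<bar> ^ 3"
    if "s \<in> J" "t \<in> J" for s t
  proof -
    have "C * norm (?x t - ?x s) ^ 3 \<le> C * (K * \<bar>t - s\<bar>) ^ 3"
      using F1[OF that] r by (intro mult_left_mono power_mono) auto
    also have "\<dots> = M * \<bar>t - s\<bar> ^ 3" by (simp only: M_def power_mult_distrib mult.assoc)
    moreover have "(d (chart_inv c (?x s)) (chart_inv c (?x t)))\<^sup>2 = (t - s)\<^sup>2"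
      using iso[of s t] J that inv_chart[OF c(1)] by (simp add: power2_commute)
    ultimately show ?thesis using dist(1)[OF J(3)[OF that(1)] J(3)[OF that(2)]] by simp
  qed
  define N where "N = (12 * M + 4 * Q * K ^ 3) / l"
  have N: "0 \<le> N" using M Q K l by (simp add: N_def)
  have second: "norm (?x (t + h) - 2 *\<^sub>R ?x t + ?x (t - h)) \<le> sqrt N * (h * sqrt h)"
    if h: "0 < h" "t - h \<in> J" "t + h \<in> J" for t h
  proof -
    have tJ: "t \<in> J" using h unfolding J_def by (auto simp: dist_real_def)
    note G = inner_form_gc[OF c(1) J(5)[OF tJ]]
    define P where "P = ?x (t + h) - ?x t"
    define R where "R = ?x t - ?x (t - h)"
    have "gc c (?x t) P P \<le> h\<^sup>2 + M * h ^ 3" using F2[OF tJ h(3)] h(1) by (simp add: P_def)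
    moreover have "gc c (?x t) R R \<le> h\<^sup>2 + M * h ^ 3"
    proof -
      have "?x (t - h) - ?x t = - R" by (simp add: R_def)
      moreover have "gc c (?x t) (- R) (- R) = gc c (?x t) R R"
        unfolding bilinear_lneg[OF inner_formD(1)[OF G]] bilinear_rneg[OF inner_formD(1)[OF G]] by simp
      ultimately show ?thesis using F2[OF tJ h(2)] h(1) by simp
    qed
    moreover have "gc c (?x t) (P + R) (P + R) \<ge> 4 * h\<^sup>2 - 8 * (M * h ^ 3) - 4 * (Q * K ^ 3 * h ^ 3)"
    proof -
      have PR: "P + R = ?x (t + h) - ?x (t - h)" by (simp add: P_def R_def)
      have nPR: "norm (P + R) \<le> K * (2 * h)" using F1[OF h(2,3)] h(1) by (simp add: PR)
      have "4 * h\<^sup>2 - 8 * (M * h ^ 3) \<le> gc c (?x (t - h)) (P + R) (P + R)"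
        using F2[OF h(2,3)] h(1) by (simp add: PR power_mult_distrib)
      moreover have "\<bar>gc c (?x t) (P + R) (P + R) - gc c (?x (t - h)) (P + R) (P + R)\<bar> \<le> 4 * (Q * K ^ 3 * h ^ 3)"
      proof -
        have "\<bar>gc c (?x t) (P + R) (P + R) - gc c (?x (t - h)) (P + R) (P + R)\<bar> \<le>
            Q * norm (?x t - ?x (t - h)) * (norm (P + R))\<^sup>2"
          by (rule lip[OF J(4)[OF tJ] J(4)[OF h(2)]])
        also have "\<dots> \<le> Q * (K * h) * (K * (2 * h))\<^sup>2"
          using F1[OF h(2) tJ] h(1) nPR Q K by (intro mult_mono power_mono) auto
        also have "\<dots> = 4 * (Q * K ^ 3 * h ^ 3)" by (simp add: power2_eq_square power3_eq_cube)
        finally show ?thesis .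
      qed
      ultimately show ?thesis by linarith
    qed
    ultimately have "gc c (?x t) (P - R) (P - R) \<le> (12 * M + 4 * Q * K ^ 3) * h ^ 3"
      unfolding inner_form_parallelogram[OF G] by (simp add: algebra_simps)
    then have "l * (norm (P - R))\<^sup>2 \<le> (12 * M + 4 * Q * K ^ 3) * h ^ 3"
      using lo[OF J(4)[OF tJ], of "P - R"] by linarith
    then have "(norm (P - R))\<^sup>2 \<le> N * h ^ 3"
      using l by (simp add: N_def field_simps)
    also have "\<dots> = (sqrt N * (h * sqrt h))\<^sup>2"
      using N h(1) by (simp add: power_mult_distrib power3_eq_cube power2_eq_square[of h])
    finally have "norm (P - R) \<le> sqrt N * (h * sqrt h)"
      by (rule power2_le_imp_le) (use N h(1) in simp)
    moreover have "?x (t + h) - 2 *\<^sub>R ?x t + ?x (t - h) = P - R" by (simp add: P_def R_def scaleR_2)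
    ultimately show ?thesis by simp
  qed
  let ?a = "t0 - \<delta> / 4" and ?b = "t0 + 3 * \<delta> / 4"
  have IJ: "{?a..?b} \<subseteq> J" using \<delta>(1) by (auto simp: J_def dist_real_def)
  have xc: "continuous_on {?a..?b} ?x"
  proof (rule continuous_on_compose)
    show "continuous_on {?a..?b} \<gamma>" by (rule continuous_on_subset[OF \<gamma>c]) (use IJ J in blast)
    show "continuous_on (\<gamma> ` {?a..?b}) (chart_map c)"
      by (rule continuous_on_subset[OF cont_chart[OF c(1)]]) (use IJ J in blast)
  qed
  have mid: "(?a + ?b) / 2 = t0 + \<delta> / 4" by (simp add: field_simps)
  let ?I = "{t0 - \<delta> / 4..t0 + \<delta> / 4}"
  have ab: "?a < ?b" using \<delta>(1) by simp
  obtain D where D: "continuous_on ?I D"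
    "\<And>t. t \<in> ?I \<Longrightarrow> (?x has_vector_derivative D t) (at t within ?I)"
  proof (rule second_difference_imp_C1[OF ab xc, unfolded mid])
    show "norm (?x (t + h) - 2 *\<^sub>R ?x t + ?x (t - h)) \<le> sqrt N * (h * sqrt h)"
      if "0 < h" "?a \<le> t - h" "t + h \<le> ?b" for t h
      using that IJ by (intro second) auto
  qed blast
  have IJ': "t \<in> J" if "t \<in> ?I" for t using that IJ \<delta>(1) by auto
  have unit: "gc c (?x t) (D t) (D t) = 1" if t: "t \<in> ?I" for t
  proof -
    let ?F = "at t within ?I"
    let ?q = "\<lambda>s. (?x s - ?x t) /\<^sub>R (s - t)"
    note bl = bilinear_gc[OF c(1) J(5)[OF IJ'[OF t]]]
    have "\<exists>s\<in>?I. s \<noteq> t" using \<delta>(1) by (intro bexI[of _ "if t = t0 then t0 + \<delta> / 4 else t0"]) auto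
    then have "t islimpt ?I" using t by (intro connected_imp_perfect) auto
    then have nb: "?F \<noteq> bot" by (simp add: trivial_limit_within)
    have "(?q \<longlongrightarrow> D t) ?F" by (rule has_vector_derivative_quotient[OF D(2)[OF t]])
    then have 1: "((\<lambda>s. gc c (?x t) (?q s) (?q s)) \<longlongrightarrow> gc c (?x t) (D t) (D t)) ?F"
      using bounded_bilinear.tendsto[of "gc c (?x t)"] bl bilinear_conv_bounded_bilinear by blast
    have "((\<lambda>s. gc c (?x t) (?q s) (?q s) - 1) \<longlongrightarrow> 0) ?F"
    proof (rule Lim_null_comparison)
      have "norm (gc c (?x t) (?q s) (?q s) - 1) \<le> M * \<bar>s - t\<bar>" if s: "s \<in> ?I" "s \<noteq> t" for s
      proof -
        have e: "gc c (?x t) (?q s) (?q s) = gc c (?x t) (?x s - ?x t) (?x s - ?x t) / (s - t)\<^sup>2"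
          unfolding bilinear_lmul[OF bl] bilinear_rmul[OF bl] by (simp add: divide_inverse power2_eq_square)
        have "gc c (?x t) (?q s) (?q s) - 1 = - (((s - t)\<^sup>2 - gc c (?x t) (?x s - ?x t) (?x s - ?x t)) / (s - t)\<^sup>2)"
          unfolding e using s(2) by (simp add: diff_divide_distrib)
        then have "norm (gc c (?x t) (?q s) (?q s) - 1) =
            \<bar>(s - t)\<^sup>2 - gc c (?x t) (?x s - ?x t) (?x s - ?x t)\<bar> / (s - t)\<^sup>2" by simp
        also have "\<dots> \<le> M * \<bar>s - t\<bar> ^ 3 / (s - t)\<^sup>2"
          by (intro divide_right_mono F2 IJ' s t) simp
        also have "\<dots> = M * \<bar>s - t\<bar>"
        proof -
          have "\<bar>s - t\<bar> ^ 3 = \<bar>s - t\<bar> * (s - t)\<^sup>2" by (simp add: power3_eq_cube power2_eq_square)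
          then show ?thesis using s(2) by simp
        qed
        finally show ?thesis .
      qed
      then show "\<forall>\<^sub>F s in ?F. norm (gc c (?x t) (?q s) (?q s) - 1) \<le> M * \<bar>s - t\<bar>"
        by (auto simp: eventually_at_filter)
      have "((\<lambda>s. M * \<bar>s - t\<bar>) \<longlongrightarrow> M * \<bar>t - t\<bar>) ?F" by (intro tendsto_intros)
      then show "((\<lambda>s. M * \<bar>s - t\<bar>) \<longlongrightarrow> 0) ?F" by simp
    qed
    from tendsto_unique[OF nb 1 LIM_zero_cancel[OF this]] show ?thesis .
  qed
  show ?thesis
    by (rule that[of "t0 - \<delta> / 4" "t0 + \<delta> / 4" D]) (use \<delta>(1) D unit IJ' J in auto)
qed

text \<open>The vanishing of the first variation says that the momentum G(x)(x', w) has a derivative for every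
  direction w; as x' solves a linear system with differentiable coefficients, it is itself
  differentiable, and the Euler-Lagrange equation is the geodesic equation.\<close>

lemma isometric_curve_geodesic_at:
  assumes iso: "\<And>s t. s \<in> {a<..<b} \<Longrightarrow> t \<in> {a<..<b} \<Longrightarrow> d (\<gamma> s) (\<gamma> t) = \<bar>s - t\<bar>"
    and t0: "t0 \<in> {a<..<b}" and c: "c \<in> A" "\<gamma> t0 \<in> chart_dom c"
  obtains \<alpha> \<beta> D where "\<alpha> < t0" "t0 < \<beta>"
    "\<And>t. t \<in> {\<alpha><..<\<beta>} \<Longrightarrow> ((chart_map c \<circ> \<gamma>) has_vector_derivative D t) (at t)"
    "(D has_vector_derivative - christoffel UNIV (gc c) (chart_map c (\<gamma> t0)) (D t0) (D t0)) (at t0)"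
    "gc c (chart_map c (\<gamma> t0)) (D t0) (D t0) = 1"
proof -
  let ?x = "chart_map c \<circ> \<gamma>"
  obtain \<alpha> \<beta> D where ab: "\<alpha> < t0" "t0 < \<beta>" "{\<alpha>..\<beta>} \<subseteq> {a<..<b}"
    and dom: "\<And>t. t \<in> {\<alpha>..\<beta>} \<Longrightarrow> \<gamma> t \<in> chart_dom c"
    and D: "continuous_on {\<alpha>..\<beta>} D"
    "\<And>t. t \<in> {\<alpha>..\<beta>} \<Longrightarrow> (?x has_vector_derivative D t) (at t within {\<alpha>..\<beta>})"
    and unit: "\<And>t. t \<in> {\<alpha>..\<beta>} \<Longrightarrow> gc c (chart_map c (\<gamma> t)) (D t) (D t) = 1"
    using isometric_curve_C1[OF iso t0 c] by metis
  have lt: "\<alpha> < \<beta>" using ab by simp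
  have im: "?x ` {\<alpha>..\<beta>} \<subseteq> chart_image c" using dom by auto
  have imt: "?x t \<in> chart_image c" if "t \<in> {\<alpha>..\<beta>}" for t using im that by blast
  have xc: "continuous_on {\<alpha>..\<beta>} ?x" by (rule continuous_on_vector_derivative[OF D(2)])
  have min: "d (chart_inv c (?x \<alpha>)) (chart_inv c (?x \<beta>)) = \<beta> - \<alpha>"
  proof -
    have "\<alpha> \<in> {\<alpha>..\<beta>}" "\<beta> \<in> {\<alpha>..\<beta>}" using lt by auto
    moreover from this have "d (\<gamma> \<alpha>) (\<gamma> \<beta>) = \<bar>\<alpha> - \<beta>\<bar>" using ab(3) by (intro iso) auto
    ultimately show ?thesis using inv_chart[OF c(1)] dom lt by simp
  qed
  have EL: "((\<lambda>t. gc c (?x t) (D t) w) has_real_derivative dgc c (?x t) w (D t) (D t) / 2) (at t within {\<alpha>..\<beta>})"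
    if t: "t \<in> {\<alpha>..\<beta>}" for t w
  proof (rule du_Bois_Reymond[OF lt _ _ _ t])
    show Pc: "continuous_on {\<alpha>..\<beta>} (\<lambda>t. gc c (?x t) (D t) w)"
      by (intro gc_continuous c xc im D(1) continuous_intros)
    show "continuous_on {\<alpha>..\<beta>} (\<lambda>t. dgc c (?x t) w (D t) (D t) / 2)"
      by (intro continuous_intros dgc_continuous c xc im D(1)) simp
    fix \<phi> \<phi>' :: "real \<Rightarrow> real"
    assume \<phi>: "\<And>t. t \<in> {\<alpha>..\<beta>} \<Longrightarrow> (\<phi> has_real_derivative \<phi>' t) (at t within {\<alpha>..\<beta>})"
      and \<phi>': "continuous_on {\<alpha>..\<beta>} \<phi>'" and e: "\<phi> \<alpha> = 0" "\<phi> \<beta> = 0"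
    have "integral {\<alpha>..\<beta>} (\<lambda>t. dgc c (?x t) (\<phi> t *\<^sub>R w) (D t) (D t) + 2 * gc c (?x t) (D t) (\<phi>' t *\<^sub>R w)) = 0"
    proof (rule first_variation[OF c(1) lt D(2) D(1) im _ min])
      show "gc c (?x t) (D t) (D t) = 1" if "t \<in> {\<alpha>..\<beta>}" for t using unit[OF that] by simp
      show "((\<lambda>t. \<phi> t *\<^sub>R w) has_vector_derivative \<phi>' t *\<^sub>R w) (at t within {\<alpha>..\<beta>})"
        if "t \<in> {\<alpha>..\<beta>}" for t
        by (rule has_vector_derivative_eq_rhs[OF has_vector_derivative_scaleR[OF \<phi>[OF that] has_vector_derivative_const]]) simp
      show "continuous_on {\<alpha>..\<beta>} (\<lambda>t. \<phi>' t *\<^sub>R w)" by (intro continuous_intros \<phi>')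
    qed (use e in auto)
    also have "integral {\<alpha>..\<beta>} (\<lambda>t. dgc c (?x t) (\<phi> t *\<^sub>R w) (D t) (D t) + 2 * gc c (?x t) (D t) (\<phi>' t *\<^sub>R w)) =
        integral {\<alpha>..\<beta>} (\<lambda>t. 2 * (dgc c (?x t) w (D t) (D t) / 2 * \<phi> t + gc c (?x t) (D t) w * \<phi>' t))"
    proof (rule integral_cong)
      fix t assume t: "t \<in> {\<alpha>..\<beta>}"
      show "dgc c (?x t) (\<phi> t *\<^sub>R w) (D t) (D t) + 2 * gc c (?x t) (D t) (\<phi>' t *\<^sub>R w) =
        2 * (dgc c (?x t) w (D t) (D t) / 2 * \<phi> t + gc c (?x t) (D t) w * \<phi>' t)"
        unfolding linear_scale[OF linear_dgc[OF c(1) imt[OF t]]] bilinear_rmul[OF bilinear_gc[OF c(1) imt[OF t]]]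
        by (simp add: algebra_simps)
    qed
    finally show "integral {\<alpha>..\<beta>} (\<lambda>t. dgc c (?x t) w (D t) (D t) / 2 * \<phi> t + gc c (?x t) (D t) w * \<phi>' t) = 0"
      unfolding integral_mult_right by simp
  qed
  let ?T = "{\<alpha><..<\<beta>}"
  have T: "open ?T" "t0 \<in> ?T" using ab by auto
  have T': "t \<in> {\<alpha>..\<beta>}" "at t within {\<alpha>..\<beta>} = at t" if "t \<in> ?T" for t
    using that at_within_interior[of t "{\<alpha>..\<beta>}"] by auto
  have x': "(?x has_vector_derivative D t) (at t)" if "t \<in> ?T" for t
    using D(2)[OF T'(1)[OF that]] unfolding T'(2)[OF that] .
  have EL': "((\<lambda>t. gc c (?x t) (D t) w) has_derivative (\<lambda>k. k *\<^sub>R (dgc c (?x t0) w (D t0) (D t0) / 2))) (at t0)" for w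
    using EL[OF T'(1)[OF T(2)], of w] unfolding T'(2)[OF T(2)]
    by (simp add: has_real_derivative_iff_has_vector_derivative has_vector_derivative_def)
  have gx: "((\<lambda>t. gc c (?x t) u v) has_derivative (\<lambda>k. dgc c (?x t0) (k *\<^sub>R D t0) u v)) (at t0)" for u v
    using has_derivative_compose[OF x'[OF T(2), unfolded has_vector_derivative_def]
        dgc_deriv[OF c(1) imt[OF T'(1)[OF T(2)]], of u v]] .
  have bl: "bilinear (gc c (?x t))" if "t \<in> ?T" for t by (rule bilinear_gc[OF c(1) imt[OF T'(1)[OF that]]])
  have "\<exists>D'. (D has_derivative D') (at t0)"
  proof (rule solution_differentiable[where G = "\<lambda>t. gc c (?x t)" and T = ?T, OF T bl _ gx EL'])
    show "inner_form (gc c (?x t0))" by (rule inner_form_gc[OF c(1) imt[OF T'(1)[OF T(2)]]])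
    show "isCont D t0" using D(1) ab by (auto intro: continuous_on_interior)
  qed auto
  then obtain D' where D': "(D has_derivative D') (at t0)" by blast
  have "D' k = k *\<^sub>R D' 1" for k
    using linear_scale[OF has_derivative_linear[OF D'], of k 1] by simp
  then have D'v: "(D has_vector_derivative D' 1) (at t0)"
    unfolding has_vector_derivative_def by (intro has_derivative_eq_rhs[OF D'] ext)
  have "gc c (?x t0) (- D' 1) w = dgc c (?x t0) (D t0) (D t0) w - dgc c (?x t0) w (D t0) (D t0) / 2" for w
  proof -
    have "((\<lambda>t. gc c (?x t) (D t) w) has_derivative
       (\<lambda>k. dgc c (?x t0) (k *\<^sub>R D t0) (D t0) w + gc c (?x t0) (D' k) w + gc c (?x t0) (D t0) 0)) (at t0)"
      by (rule has_derivative_form[where F = "\<lambda>t. gc c (?x t)", OF T bl gx D' has_derivative_const])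
    from fun_cong[OF has_derivative_unique[OF EL' this], of 1] show ?thesis
      using bilinear_rzero[OF bl[OF T(2)]] bilinear_lneg[OF bl[OF T(2)]] by (simp add: field_simps)
  qed
  then have "christoffel UNIV (gc c) (?x t0) (D t0) (D t0) = - D' 1"
    using christoffel_diag[OF c(1) imt[OF T'(1)[OF T(2)]]] by blast
  then show ?thesis using that[of \<alpha> \<beta> D] ab x' D'v unit[OF T'(1)[OF T(2)]] by simp
qed

lemma isometric_curve_geodesic:
  assumes iso: "\<And>s t. s \<in> {a<..<b} \<Longrightarrow> t \<in> {a<..<b} \<Longrightarrow> d (\<gamma> s) (\<gamma> t) = \<bar>s - t\<bar>"
  shows "geodesic_on UNIV A g {a<..<b} \<gamma>" "\<And>t. t \<in> {a<..<b} \<Longrightarrow> speed \<gamma> t = 1"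
proof -
  have \<gamma>c: "continuous_on {a<..<b} \<gamma>" by (rule isometric_curve_continuous[OF iso])
  show "geodesic_on UNIV A g {a<..<b} \<gamma>"
    unfolding geodesic_on_def
  proof (intro conjI ballI \<gamma>c)
    fix c assume c: "c \<in> A"
    let ?D = "\<lambda>t. vector_derivative (chart_map c \<circ> \<gamma>) (at t)"
    have "((chart_map c \<circ> \<gamma>) has_vector_derivative ?D t) (at t) \<and>
        (?D has_vector_derivative - christoffel UNIV (gc c) (chart_map c (\<gamma> t)) (?D t) (?D t)) (at t)"
      if t: "t \<in> {a<..<b}" "\<gamma> t \<in> chart_dom c" for t
    proof (rule isometric_curve_geodesic_at[OF iso t(1) c t(2)])
      fix \<alpha> \<beta> D assume *: "\<alpha> < t" "t < \<beta>"
        "\<And>s. s \<in> {\<alpha><..<\<beta>} \<Longrightarrow> ((chart_map c \<circ> \<gamma>) has_vector_derivative D s) (at s)"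
        "(D has_vector_derivative - christoffel UNIV (gc c) (chart_map c (\<gamma> t)) (D t) (D t)) (at t)"
      have eq: "D s = ?D s" if "s \<in> {\<alpha><..<\<beta>}" for s using vector_derivative_at[OF *(3)[OF that]] by simp
      have tin: "t \<in> {\<alpha><..<\<beta>}" using * by simp
      show ?thesis
        using has_vector_derivative_transform_within_open[OF *(4) open_greaterThanLessThan tin eq] *(3)[OF tin]
        unfolding eq[OF tin] by blast
    qed
    then show "\<exists>D. \<forall>t\<in>{a<..<b}. \<gamma> t \<in> chart_dom c \<longrightarrow>
      ((chart_map c \<circ> \<gamma>) has_vector_derivative D t) (at t) \<and>
      (D has_vector_derivative - christoffel UNIV (gc c) (chart_map c (\<gamma> t)) (D t) (D t)) (at t)"
      by (intro exI[of _ ?D]) blast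
  qed
  show "speed \<gamma> t = 1" if t: "t \<in> {a<..<b}" for t
  proof (rule isometric_curve_geodesic_at[OF iso t chart_at(1) chart_at(2)])
    fix \<alpha> \<beta> D assume *: "\<alpha> < t" "t < \<beta>"
      "\<And>s. s \<in> {\<alpha><..<\<beta>} \<Longrightarrow> ((chart_map (chart_at A (\<gamma> t)) \<circ> \<gamma>) has_vector_derivative D s) (at s)"
      "gc (chart_at A (\<gamma> t)) (chart_map (chart_at A (\<gamma> t)) (\<gamma> t)) (D t) (D t) = 1"
    have "isCont \<gamma> t" using \<gamma>c t by (simp add: continuous_on_eq_continuous_at)
    from speed_chart[OF chart_at(1) chart_at(2) this *(3)] * show ?thesis by simp
  qed
qed

end

section \<open>Bounded sets in a geodesically complete manifold\<close>

context connected_riemannian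
begin

lemma d_continuous2:
  assumes "continuous_on T u" "continuous_on T v"
  shows "continuous_on T (\<lambda>t. d (u t) (v t))"
  unfolding continuous_on_def
proof
  fix t assume t: "t \<in> T"
  have 1: "((\<lambda>s. d (u s) (u t)) \<longlongrightarrow> 0) (at t within T)" "((\<lambda>s. d (v s) (v t)) \<longlongrightarrow> 0) (at t within T)"
    using assms t unfolding continuous_on_def d_tendsto_iff by blast+
  have lim: "((\<lambda>s. d (u s) (u t) + d (v s) (v t)) \<longlongrightarrow> 0) (at t within T)"
    using tendsto_add[OF 1] by simp
  have "norm (d (u s) (v s) - d (u t) (v t)) \<le> d (u s) (u t) + d (v s) (v t)" for s
    using d_triangle[of "u s" "v s" "u t"] d_triangle[of "u t" "v s" "v t"]
      d_triangle[of "u t" "v t" "u s"] d_triangle[of "u s" "v t" "v s"] d_sym[of "u s" "u t"] d_sym[of "v s" "v t"]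
    by (simp add: abs_le_iff)
  then have "((\<lambda>s. d (u s) (v s) - d (u t) (v t)) \<longlongrightarrow> 0) (at t within T)"
    by (intro Lim_null_comparison[OF always_eventually lim]) blast
  then show "((\<lambda>s. d (u s) (v s)) \<longlongrightarrow> d (u t) (v t)) (at t within T)" by (rule LIM_zero_cancel)
qed

abbreviation cb where "cb p r \<equiv> {q. d q p \<le> r}"

lemma closed_cb: "closed (cb p r)"
  by (intro closed_Collect_le d_continuous2 continuous_intros)

lemma cb_locally_compact: "\<exists>r>0. compact (cb q r)"
proof -
  let ?c = "chart_at A q"
  note c = chart_at(1)[of q] and q = chart_at(2)[of q]
  obtain r where r: "0 < r" "cball (chart_map ?c q) r \<subseteq> chart_image ?c"
    using open_contains_cball open_image[OF c] q by blast
  define C where "C = chart_inv ?c ` cball (chart_map ?c q) r"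
  have C: "compact C" unfolding C_def
    by (intro compact_continuous_image continuous_on_subset[OF cont_inv[OF c] r(2)] compact_cball)
  let ?U = "chart_dom ?c \<inter> chart_map ?c -` ball (chart_map ?c q) r"
  have "open ?U" by (rule continuous_open_preimage[OF cont_chart[OF c] open_dom[OF c]]) simp
  moreover have "q \<in> ?U" using q r by simp
  ultimately obtain e where e: "0 < e" "\<And>y l. conn q y l \<Longrightarrow> l < e \<Longrightarrow> y \<in> ?U"
    by (rule conn_small) blast
  have "?U \<subseteq> C"
  proof
    fix y assume y: "y \<in> ?U"
    then have "chart_inv ?c (chart_map ?c y) = y" "chart_map ?c y \<in> cball (chart_map ?c q) r"
      using inv_chart[OF c] by auto
    then show "y \<in> C" unfolding C_def by force
  qed
  moreover have "cb q (e / 2) \<subseteq> ?U"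
  proof
    fix y assume "y \<in> cb q (e / 2)"
    then have "d q y < e" using e(1) d_sym[of q y] by simp
    then show "y \<in> ?U" using d_lessD e(2) by blast
  qed
  ultimately have "compact (C \<inter> cb q (e / 2))" "C \<inter> cb q (e / 2) = cb q (e / 2)"
    using C closed_cb by (blast intro: compact_Int_closed)+
  then show ?thesis using e(1) by (intro exI[of _ "e / 2"]) simp
qed

text \<open>Parametrization by arc length, with arbitrary choices on intervals where the length does not
  increase.\<close>

lemma conn_parametrized:
  assumes "conn p q l"
  obtains \<sigma> where "\<sigma> 0 = p" "\<sigma> l = q" "\<And>s t. s \<in> {0..l} \<Longrightarrow> t \<in> {0..l} \<Longrightarrow> d (\<sigma> s) (\<sigma> t) \<le> \<bar>s - t\<bar>"
proof -
  obtain \<gamma> where \<gamma>: "pc1 0 1 \<gamma>" "\<gamma> 0 = p" "\<gamma> 1 = q" "len 0 1 \<gamma> = l" using assms unfolding conn_def by blast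
  have cont: "continuous_on {0..1} (\<lambda>u. len 0 u \<gamma>)"
    unfolding len_def by (rule indefinite_integral_continuous_1[OF speed_integrable[OF \<gamma>(1)]])
  have ends: "len 0 0 \<gamma> = 0" "len 0 1 \<gamma> = l" using \<gamma> by (auto simp: len_def)
  have "\<exists>u\<ge>0. u \<le> 1 \<and> len 0 u \<gamma> = t" if "t \<in> {0..l}" for t
    using IVT'[of "\<lambda>u. len 0 u \<gamma>" 0 t 1] cont ends that by auto
  then obtain u where u: "\<And>t. t \<in> {0..l} \<Longrightarrow> 0 \<le> u t \<and> u t \<le> 1 \<and> len 0 (u t) \<gamma> = t" by metis
  have sub: "d (\<gamma> v) (\<gamma> w) \<le> len 0 w \<gamma> - len 0 v \<gamma>" if "0 \<le> v" "v \<le> w" "w \<le> 1" for v w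
    using d_le_len[OF pc1_subset[OF \<gamma>(1)], of v w] len_combine[OF pc1_subset[OF \<gamma>(1), of 0 w], of v] that by simp
  have main: "d (\<gamma> (u s)) (\<gamma> (u t)) \<le> \<bar>s - t\<bar>" if "s \<in> {0..l}" "t \<in> {0..l}" for s t
  proof (cases "u s \<le> u t")
    case True
    then show ?thesis using sub[of "u s" "u t"] u[OF that(1)] u[OF that(2)] by simp
  next
    case False
    then show ?thesis using sub[of "u t" "u s"] u[OF that(1)] u[OF that(2)] d_sym[of "\<gamma> (u s)"] by simp
  qed
  have l0: "0 \<le> l" using conn_nonneg[OF assms] .
  show ?thesis
  proof (rule that[of "\<lambda>t. \<gamma> (u t)"])
    have "d (\<gamma> 0) (\<gamma> (u 0)) \<le> 0" "d (\<gamma> (u l)) (\<gamma> 1) \<le> 0"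
      using sub[of 0 "u 0"] sub[of "u l" 1] u[of 0] u[of l] l0 ends by auto
    then have "d (\<gamma> 0) (\<gamma> (u 0)) = 0" "d (\<gamma> (u l)) (\<gamma> 1) = 0" using d_nonneg by (metis antisym)+
    then show "\<gamma> (u 0) = p" "\<gamma> (u l) = q" using \<gamma> d_zero by metis+
  qed (use main in blast)
qed

lemma intermediate_point:
  assumes "d y p < r + \<eta>" "0 \<le> r" "0 < \<eta>"
  shows "\<exists>z. d z p \<le> r \<and> d z y < \<eta>"
proof -
  obtain l where l: "l < r + \<eta>" "conn p y l" using d_lessD[of p y "r + \<eta>"] assms d_sym[of p y] by auto
  show ?thesis
  proof (cases "l \<le> r")
    case True
    then show ?thesis
      using d_le[OF l(2)] d_sym[of p y] d_zero[of y y] assms(3) by (intro exI[of _ y]) auto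
  next
    case False
    obtain \<sigma> where \<sigma>: "\<sigma> 0 = p" "\<sigma> l = y" "\<And>s t. s \<in> {0..l} \<Longrightarrow> t \<in> {0..l} \<Longrightarrow> d (\<sigma> s) (\<sigma> t) \<le> \<bar>s - t\<bar>"
      using conn_parametrized[OF l(2)] by metis
    show ?thesis
      using \<sigma>(3)[of r 0] \<sigma>(3)[of r l] False assms l(1) \<sigma>(1,2) by (intro exI[of _ "\<sigma> r"]) auto
  qed
qed

lemma compact_cb_extend:
  assumes R: "0 \<le> R" and K: "compact (cb p R)"
  shows "\<exists>e>0. compact (cb p (R + e))"
proof -
  obtain r where r: "\<And>q. 0 < r q \<and> compact (cb q (r q))" using cb_locally_compact by metis
  have op: "open {y. d y q < r q / 2}" for q
    by (intro open_Collect_less d_continuous2 continuous_intros)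
  have "q \<in> {y. d y q < r q / 2}" for q using r[of q] d_zero[of q q] by simp
  then have cov: "cb p R \<subseteq> (\<Union>q\<in>cb p R. {y. d y q < r q / 2})" by blast
  obtain Q where Q: "Q \<subseteq> cb p R" "finite Q" "cb p R \<subseteq> (\<Union>q\<in>Q. {y. d y q < r q / 2})"
    by (rule compactE_image[OF K op cov])
  define e where "e = Min (insert 1 ((\<lambda>q. r q / 4) ` Q))"
  have e: "0 < e" "\<And>q. q \<in> Q \<Longrightarrow> e \<le> r q / 4"
  proof -
    show "0 < e" unfolding e_def using Q(2) r by auto
    show "e \<le> r q / 4" if "q \<in> Q" for q unfolding e_def by (rule Min_le) (use Q(2) that in auto)
  qed
  have "cb p (R + e) \<subseteq> (\<Union>q\<in>Q. cb q (r q))"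
  proof
    fix y assume "y \<in> cb p (R + e)"
    then obtain z where z: "d z p \<le> R" "d z y < 2 * e"
      using intermediate_point[of y p R "2 * e"] R e(1) by auto
    then obtain q where q: "q \<in> Q" "d z q < r q / 2" using Q(3) by blast
    have "d y q \<le> r q" using d_triangle[of y q z] d_sym[of y z] z(2) q(2) e(2)[OF q(1)] by simp
    then show "y \<in> (\<Union>q\<in>Q. cb q (r q))" using q(1) by blast
  qed
  then have eq: "(\<Union>q\<in>Q. cb q (r q)) \<inter> cb p (R + e) = cb p (R + e)" by (rule Int_absorb1)
  have cpt: "compact (\<Union>q\<in>Q. cb q (r q))" by (rule compact_UN[OF Q(2)]) (use r in blast)
  have "compact (cb p (R + e))" using compact_Int_closed[OF cpt closed_cb[of p "R + e"]] unfolding eq .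
  then show ?thesis using e(1) by blast
qed

text \<open>Near-minimal curves towards the members of a Cauchy sequence cluster, in
  the topology of pointwise convergence, at a curve which runs at unit speed towards the
  limit point in the metric completion. It is a geodesic, so it extends, and its
  extension reaches the limit point inside the manifold.\<close>

lemma Cauchy_at_critical_radius:
  assumes complete: "geodesically_complete UNIV A g" and R: "0 < R"
    and K: "\<And>r. r < R \<Longrightarrow> compact (cb p r)"
    and y: "metric.MCauchy y" "\<And>n. y n \<in> cb p R"
  shows "\<exists>q. y \<longlonglongrightarrow> q"
proof -
  have yC: "\<exists>N. \<forall>m\<ge>N. \<forall>n\<ge>N. d (y m) (y n) < e" if "e > 0" for e
    using y(1)[unfolded metric.MCauchy_def] that by simp
  have lip: "\<bar>d q x - d q' x\<bar> \<le> d q q'" for q q' x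
    using d_triangle[of q x q'] d_triangle[of q' x q] d_sym[of q q'] by (simp add: abs_le_iff)
  have lip2: "\<bar>d q x - d q x'\<bar> \<le> d x x'" for q x x' using lip[of x q x'] d_sym by simp
  have "convergent (\<lambda>n. d q (y n))" for q
    unfolding Cauchy_convergent_iff[symmetric]
  proof (rule metric_CauchyI)
    fix e :: real assume "e > 0"
    then obtain N where "\<forall>m\<ge>N. \<forall>n\<ge>N. d (y m) (y n) < e" using yC by blast
    then have "dist (d q (y m)) (d q (y n)) < e" if "m \<ge> N" "n \<ge> N" for m n
      using le_less_trans[OF lip2[of q "y m" "y n"]] that by (simp add: dist_real_def)
    then show "\<exists>N. \<forall>m\<ge>N. \<forall>n\<ge>N. dist (d q (y m)) (d q (y n)) < e" by blast
  qed
  then obtain f where f: "\<And>q. (\<lambda>n. d q (y n)) \<longlonglongrightarrow> f q" unfolding convergent_def by metis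
  have f_lip: "\<bar>f q - f q'\<bar> \<le> d q q'" for q q'
    by (rule LIMSEQ_le_const2[OF tendsto_rabs[OF tendsto_diff[OF f[of q] f[of q']]]]) (use lip in blast)
  have f_unif: "\<exists>N. \<forall>n\<ge>N. \<forall>q. f q \<le> d q (y n) + e" if e: "e > 0" for e
  proof -
    obtain N where N: "\<forall>m\<ge>N. \<forall>n\<ge>N. d (y m) (y n) < e" using yC[OF e] by blast
    have "f q \<le> d q (y n) + e" if "n \<ge> N" for n q
    proof (rule LIMSEQ_le_const2[OF f], rule exI[of _ N], intro allI impI)
      fix m assume "m \<ge> N"
      then have "d (y m) (y n) < e" using N that by blast
      then show "d q (y m) \<le> d q (y n) + e" using lip2[of q "y m" "y n"] by simp
    qed
    then show ?thesis by blast
  qed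
  have f_cont: "continuous_on T (\<lambda>t. f (u t))" if "continuous_on T u" for T and u :: "'z::topological_space \<Rightarrow> 'a"
    unfolding continuous_on_def
  proof
    fix t assume "t \<in> T"
    then have "((\<lambda>s. d (u s) (u t)) \<longlongrightarrow> 0) (at t within T)"
      using that unfolding continuous_on_def d_tendsto_iff by blast
    then have "((\<lambda>s. f (u s) - f (u t)) \<longlongrightarrow> 0) (at t within T)"
      by (rule Lim_null_comparison[rotated]) (simp add: f_lip)
    then show "((\<lambda>s. f (u s)) \<longlongrightarrow> f (u t)) (at t within T)" by (rule LIM_zero_cancel)
  qed
  have f0: "\<exists>q. y \<longlonglongrightarrow> q" if "f q = 0" for q
    using f[of q] that d_sym d_tendsto_iff[of y q sequentially] by auto
  have fp: "f p \<le> R"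
    by (rule LIMSEQ_le_const2[OF f]) (use y(2) d_sym[of p] in auto)
  show ?thesis
  proof (cases "f p < R")
    case True
    let ?r = "(f p + R) / 2"
    have "\<forall>\<^sub>F n in sequentially. d p (y n) < ?r" using order_tendstoD(2)[OF f[of p], of ?r] True by simp
    then obtain N where N: "\<And>n. n \<ge> N \<Longrightarrow> y n \<in> cb p ?r"
      unfolding eventually_sequentially using d_sym[of p] by (metis less_imp_le mem_Collect_eq)
    have "compactin metric.mtopology (cb p ?r)"
      unfolding mtopology_euclidean using K[of ?r] True by (simp add: compactin_euclidean_iff)
    then have "\<exists>l s. l \<in> cb p ?r \<and> strict_mono s \<and> limitin metric.mtopology ((\<lambda>n. y (n + N)) \<circ> s) l sequentially"
      unfolding metric.compactin_sequentially using N by (metis (mono_tags, lifting) image_subset_iff le_add2)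
    then obtain l s where s: "strict_mono s" "((\<lambda>n. y (n + N)) \<circ> s) \<longlonglongrightarrow> l"
      unfolding mtopology_euclidean by auto
    have "f l = 0"
    proof (rule LIMSEQ_unique)
      have "strict_mono (\<lambda>n. s n + N)" using s(1) by (auto simp: strict_mono_def)
      from LIMSEQ_subseq_LIMSEQ[OF f[of l] this] show "(\<lambda>n. d l (y (s n + N))) \<longlonglongrightarrow> f l" by (simp add: o_def)
      show "(\<lambda>n. d l (y (s n + N))) \<longlonglongrightarrow> 0"
        using s(2) unfolding d_tendsto_iff by (simp add: o_def d_sym)
    qed
    then show ?thesis by (rule f0)
  next
    case False
    then have fp: "f p = R" using fp by simp
    have "\<exists>l. l < d p (y n) + 1 / Suc n \<and> conn p (y n) l" for n
      using d_lessD[of p "y n" "d p (y n) + 1 / Suc n"] by auto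
    then obtain l where l: "\<And>n. l n < d p (y n) + 1 / Suc n" "\<And>n. conn p (y n) (l n)" by metis
    have "\<exists>\<sigma>. \<sigma> 0 = p \<and> \<sigma> (l n) = y n \<and> (\<forall>s\<in>{0..l n}. \<forall>t\<in>{0..l n}. d (\<sigma> s) (\<sigma> t) \<le> \<bar>s - t\<bar>)" for n
      by (rule conn_parametrized[OF l(2)]) blast
    then obtain \<sigma> where \<sigma>: "\<And>n. \<sigma> n 0 = p" "\<And>n. \<sigma> n (l n) = y n"
      "\<And>n s t. s \<in> {0..l n} \<Longrightarrow> t \<in> {0..l n} \<Longrightarrow> d (\<sigma> n s) (\<sigma> n t) \<le> \<bar>s - t\<bar>" by metis
    have l0: "0 \<le> l n" for n using conn_nonneg[OF l(2)] .
    have lR: "l \<longlonglongrightarrow> R"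
    proof (rule tendsto_sandwich[OF _ _ f[of p, unfolded fp]])
      show "\<forall>\<^sub>F n in sequentially. d p (y n) \<le> l n" using d_le[OF l(2)] by simp
      show "\<forall>\<^sub>F n in sequentially. l n \<le> d p (y n) + 1 / Suc n" using l(1) by (simp add: less_imp_le)
      have "(\<lambda>n. d p (y n) + 1 / Suc n) \<longlonglongrightarrow> R + 0"
        by (intro tendsto_add f[of p, unfolded fp] LIMSEQ_Suc[OF lim_1_over_n])
      then show "(\<lambda>n. d p (y n) + 1 / Suc n) \<longlonglongrightarrow> R" by simp
    qed
    define h where "h t = (if t \<in> {0..<R} then t else 0)" for t :: real
    have h: "0 \<le> h t" "h t < R" "t \<in> {0..<R} \<Longrightarrow> h t = t" for t using R by (auto simp: h_def)
    \<comment> \<open>The curves are made total by cutting off the time, so that their values lie in a product of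
      compact balls.\<close>
    define Y where "Y n t = \<sigma> n (min (h t) (l n))" for n t
    have Yd: "d (Y n s) (Y n t) \<le> \<bar>h s - h t\<bar>" for n s t
      using \<sigma>(3)[of "min (h s) (l n)" n "min (h t) (l n)"] h l0[of n] unfolding Y_def by (simp split: split_min)
    have YK: "Y n \<in> PiE UNIV (\<lambda>t. cb p (h t))" for n
    proof -
      have "d (Y n t) p \<le> h t" for t
        using \<sigma>(3)[of "min (h t) (l n)" n 0] h(1)[of t] l0[of n] unfolding Y_def \<sigma>(1) by simp
      then show ?thesis by (auto simp: PiE_iff)
    qed
    have "compactin (product_topology (\<lambda>t. euclidean) UNIV) (PiE UNIV (\<lambda>t. cb p (h t)))"
      unfolding compactin_PiE using K h by auto
    then have "compact (PiE UNIV (\<lambda>t. cb p (h t)))"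
      by (simp add: euclidean_product_topology compactin_euclidean_iff)
    then obtain \<phi> where \<phi>: "\<phi> \<in> PiE UNIV (\<lambda>t. cb p (h t))" "inf (nhds \<phi>) (filtermap Y sequentially) \<noteq> bot"
      unfolding compact_filter using YK
      by (metis (mono_tags, lifting) always_eventually eventually_filtermap filtermap_bot_iff sequentially_bot)
    have cluster: "\<phi> \<in> C" if "closed C" "\<forall>\<^sub>F n in sequentially. Y n \<in> C" for C
    proof (rule ccontr)
      assume "\<phi> \<notin> C"
      then have "\<forall>\<^sub>F x in nhds \<phi>. x \<in> - C" using that(1) by (intro eventually_nhds_in_open) auto
      moreover have "\<forall>\<^sub>F x in filtermap Y sequentially. x \<in> C" using that(2) by (simp add: eventually_filtermap)
      ultimately have "\<forall>\<^sub>F x in inf (nhds \<phi>) (filtermap Y sequentially). False"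
        unfolding eventually_inf by blast
      then show False using \<phi>(2) by (simp add: trivial_limit_def)
    qed
    have coord: "continuous_on UNIV (\<lambda>\<phi>. (\<phi> :: real \<Rightarrow> 'a) t)" for t by (rule continuous_on_product_coordinates)
    have \<phi>d: "d (\<phi> s) (\<phi> t) \<le> \<bar>s - t\<bar>" if "s \<in> {0..<R}" "t \<in> {0..<R}" for s t
    proof -
      have "closed {\<phi>. d (\<phi> s) (\<phi> t) \<le> \<bar>h s - h t\<bar>}"
        by (intro closed_Collect_le d_continuous2 coord continuous_intros)
      from cluster[OF this] show ?thesis using Yd h(3) that by simp
    qed
    have \<phi>f: "f (\<phi> t) \<le> R - t" if t: "t \<in> {0..<R}" for t
    proof (rule field_le_epsilon)
      fix e :: real assume e: "0 < e"
      have "closed {\<phi>. f (\<phi> t) \<le> R - t + e}"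
        by (intro closed_Collect_le f_cont coord continuous_intros)
      moreover have "\<forall>\<^sub>F n in sequentially. Y n \<in> {\<phi>. f (\<phi> t) \<le> R - t + e}"
      proof -
        obtain N where N: "\<And>n q. n \<ge> N \<Longrightarrow> f q \<le> d q (y n) + e / 2" using f_unif[of "e / 2"] e by auto
        have "\<forall>\<^sub>F n in sequentially. l n < R + e / 2" "\<forall>\<^sub>F n in sequentially. t < l n"
          using order_tendstoD[OF lR] e t by auto
        then show ?thesis using eventually_ge_at_top[of N]
        proof eventually_elim
          case (elim n)
          have "d (Y n t) (y n) \<le> l n - t"
            using \<sigma>(3)[of t n "l n"] \<sigma>(2)[of n] elim(2) t h(3)[OF t] unfolding Y_def by simp
          then show ?case using N[OF elim(3), of "Y n t"] elim(1) by simp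
        qed
      qed
      ultimately have "\<phi> \<in> {\<phi>. f (\<phi> t) \<le> R - t + e}" by (rule cluster)
      then show "f (\<phi> t) \<le> R - t + e" by simp
    qed
    have f\<phi>: "f (\<phi> t) = R - t" if t: "t \<in> {0..<R}" for t
    proof -
      have "d (\<phi> t) p \<le> t" using \<phi>(1) h(3)[OF t] unfolding PiE_iff
        by (metis (mono_tags, lifting) UNIV_I mem_Collect_eq)
      then show ?thesis using f_lip[of p "\<phi> t"] fp \<phi>f[OF t] d_sym[of p "\<phi> t"] by simp
    qed
    have iso: "d (\<phi> s) (\<phi> t) = \<bar>s - t\<bar>" if "s \<in> {0<..<R}" "t \<in> {0<..<R}" for s t
      using \<phi>d[of s t] f_lip[of "\<phi> s" "\<phi> t"] f\<phi>[of s] f\<phi>[of t] that by simp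
    note geo = isometric_curve_geodesic[OF iso]
    have "open {0<..<R} \<and> is_interval {0<..<R} \<and> {0<..<R} \<noteq> {} \<and> geodesic_on UNIV A g {0<..<R} \<phi> \<and>
       (\<forall>t\<in>{0<..<R}. tangent_norm g (\<phi> t) (velocity A \<phi> t) = 1)"
      using geo R by (auto simp: speed_def is_interval_oo)
    then obtain \<delta> where \<delta>: "geodesic_on UNIV A g UNIV \<delta>" "\<forall>t\<in>{0<..<R}. \<delta> t = \<phi> t"
      using complete unfolding geodesically_complete_def by blast
    have "continuous_on UNIV (\<lambda>t. f (\<delta> t))"
      using \<delta>(1) unfolding geodesic_on_def by (blast intro: f_cont)
    then have "((\<lambda>t. f (\<delta> t)) \<longlongrightarrow> f (\<delta> R)) (at_left R)"
      by (auto simp: continuous_on_eq_continuous_within continuous_within intro: tendsto_within_subset)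
    moreover have "((\<lambda>t. f (\<delta> t)) \<longlongrightarrow> 0) (at_left R)"
    proof (rule Lim_transform_eventually)
      show "((\<lambda>t. R - t) \<longlongrightarrow> 0) (at_left R)" by (auto intro!: tendsto_eq_intros)
      show "\<forall>\<^sub>F t in at_left R. R - t = f (\<delta> t)"
        unfolding eventually_at_left[OF R] by (intro exI[of _ 0]) (use R \<delta>(2) f\<phi> in auto)
    qed
    ultimately have "f (\<delta> R) = 0" by (rule tendsto_unique[OF trivial_limit_at_left_real])
    then show ?thesis by (rule f0)
  qed
qed

text \<open>Cohn-Vossen's argument: let R be the supremum of the radii of compact balls about p. The ball of
  radius R is totally bounded because smaller balls come close to each of its points, and complete by
  the preceding lemma, hence compact; by local compactness slightly larger balls are compact too.\<close>

theorem Hopf_Rinow_bounded_compact: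
  assumes complete: "geodesically_complete UNIV A g"
  shows "compact (cb p r)"
proof (rule ccontr)
  assume not: "\<not> compact (cb p r)"
  define S where "S = {s. 0 \<le> s \<and> compact (cb p s)}"
  have mono: "compact (cb p s)" if "compact (cb p s')" "s \<le> s'" for s s'
  proof -
    have "cb p s' \<inter> cb p s = cb p s" using that(2) by auto
    then show ?thesis using compact_Int_closed[OF that(1) closed_cb[of p s]] by simp
  qed
  have bdd: "bdd_above S"
  proof (rule bdd_aboveI)
    show "s \<le> r" if "s \<in> S" for s
      using that not mono[of s r] unfolding S_def by (cases "r \<le> s") auto
  qed
  obtain r0 where r0: "0 < r0" "compact (cb p r0)" using cb_locally_compact by blast
  then have r0S: "r0 \<in> S" by (simp add: S_def)
  define R where "R = Sup S"
  have R: "0 < R" using cSup_upper[OF r0S bdd] r0(1) by (simp add: R_def)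
  have K: "compact (cb p s)" if sR: "s < R" for s
  proof -
    have "S \<noteq> {}" using r0S by blast
    then obtain s' where "s' \<in> S" "s < s'" using sR less_cSup_iff[OF _ bdd, of s] unfolding R_def by blast
    then show ?thesis using mono by (auto simp: S_def)
  qed
  have tb: "metric.mtotally_bounded (cb p R)"
    unfolding metric.mtotally_bounded_def
  proof (intro allI impI)
    fix e :: real assume e: "e > 0"
    define s where "s = max 0 (R - e / 4)"
    have s: "0 \<le> s" "s < R" "R < s + e / 2" using R e by (auto simp: s_def)
    have "compactin metric.mtopology (cb p s)"
      unfolding mtopology_euclidean using K[OF s(2)] by (simp add: compactin_euclidean_iff)
    then have "metric.mtotally_bounded (cb p s)" by (rule metric.compactin_imp_mtotally_bounded)
    then obtain F where F: "finite F" "F \<subseteq> cb p s" "cb p s \<subseteq> (\<Union>x\<in>F. metric.mball x (e / 2))"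
      using e unfolding metric.mtotally_bounded_def by (meson half_gt_zero)
    have "cb p R \<subseteq> (\<Union>x\<in>F. metric.mball x e)"
    proof
      fix y assume "y \<in> cb p R"
      then obtain z where z: "d z p \<le> s" "d z y < e / 2"
        using intermediate_point[of y p s "e / 2"] s e by auto
      then obtain x where "x \<in> F" "d x z < e / 2" using F(3) by auto
      then show "y \<in> (\<Union>x\<in>F. metric.mball x e)" using d_triangle[of x y z] z(2) by force
    qed
    moreover have "F \<subseteq> cb p R" using F(2) s(2) by auto
    ultimately show "\<exists>K. finite K \<and> K \<subseteq> cb p R \<and> cb p R \<subseteq> (\<Union>x\<in>K. metric.mball x e)"
      using F(1) by blast
  qed
  have "compactin metric.mtopology (cb p R)"
    unfolding metric.compactin_sequentially
  proof (intro conjI allI impI)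
    fix y :: "nat \<Rightarrow> 'a" assume y: "range y \<subseteq> cb p R"
    obtain s where s: "strict_mono s" "metric.MCauchy (y \<circ> s)"
      using tb y unfolding metric.mtotally_bounded_sequentially by blast
    obtain q where q: "(y \<circ> s) \<longlonglongrightarrow> q"
      using Cauchy_at_critical_radius[OF complete R K s(2)] y by auto
    have "q \<in> cb p R" by (rule closed_sequentially[OF closed_cb _ q]) (use y in auto)
    then show "\<exists>l r. l \<in> cb p R \<and> strict_mono r \<and> limitin metric.mtopology (y \<circ> r) l sequentially"
      unfolding mtopology_euclidean using q s(1) by auto
  qed simp
  then have "compact (cb p R)" unfolding mtopology_euclidean by (simp add: compactin_euclidean_iff)
  then obtain e where e: "0 < e" "compact (cb p (R + e))" using compact_cb_extend[of R p] R by auto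
  then have "R + e \<in> S" using R by (simp add: S_def)
  then show False using cSup_upper[OF _ bdd] e(1) unfolding R_def by fastforce
qed

end

section \<open>Local solutions of differential equations\<close>

text \<open>Picard iteration for the vector field composed with the projection onto the ball, which is globally
  Lipschitz; the interval is so short that the solution stays in the ball.\<close>

lemma ode_exists_right:
  fixes F :: "'b::euclidean_space \<Rightarrow> 'b"
  assumes r: "0 < r" and lip: "\<And>u v. u \<in> cball z0 r \<Longrightarrow> v \<in> cball z0 r \<Longrightarrow> norm (F u - F v) \<le> L * norm (u - v)"
  obtains e Z where "0 < e" "Z b = z0" "continuous_on {b..b + e} Z"
    "\<And>t. t \<in> {b..b + e} \<Longrightarrow> Z t \<in> cball z0 r"
    "\<And>t. t \<in> {b<..<b + e} \<Longrightarrow> (Z has_vector_derivative F (Z t)) (at t)"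
proof -
  let ?B = "cball z0 r"
  have L': "norm (F u - F v) \<le> \<bar>L\<bar> * norm (u - v)" if "u \<in> ?B" "v \<in> ?B" for u v
    by (rule order_trans[OF lip[OF that]]) (simp add: mult_right_mono)
  have z0: "z0 \<in> ?B" using r by simp
  define G where "G u = F (closest_point ?B u)" for u
  have cp: "closest_point ?B u \<in> ?B" for u using z0 by (intro closest_point_in_set) auto
  have Glip: "norm (G u - G v) \<le> \<bar>L\<bar> * norm (u - v)" for u v
  proof -
    have "norm (closest_point ?B u - closest_point ?B v) \<le> norm (u - v)"
      using closest_point_lipschitz[of ?B u v] z0 by (auto simp: dist_norm)
    then have "\<bar>L\<bar> * norm (closest_point ?B u - closest_point ?B v) \<le> \<bar>L\<bar> * norm (u - v)"
      by (intro mult_left_mono) auto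
    then show ?thesis unfolding G_def using L'[OF cp cp, of u v] by linarith
  qed
  have Gc: "continuous_on T G" for T
    by (rule lipschitz_on_continuous_on[of "\<bar>L\<bar>"]) (auto simp: lipschitz_on_def dist_norm Glip)
  define M where "M = norm (F z0) + \<bar>L\<bar> * r"
  have M: "0 \<le> M" using r by (simp add: M_def)
  have GM: "norm (G u) \<le> M" for u
  proof -
    have "norm (G u) \<le> norm (F z0) + norm (G u - F z0)" by (metis norm_triangle_sub)
    moreover have "norm (G u - F z0) \<le> \<bar>L\<bar> * r"
      unfolding G_def
      by (rule order_trans[OF L'[OF cp z0]], rule mult_left_mono)
         (use cp[of u] in \<open>auto simp: dist_norm norm_minus_commute\<close>)
    ultimately show ?thesis by (simp add: M_def)
  qed
  define e where "e = min (r / (M + 1)) (1 / (2 * \<bar>L\<bar> + 2))"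
  have e: "0 < e" "e * M \<le> r" "e * \<bar>L\<bar> \<le> 1 / 2"
  proof -
    show e0: "0 < e" unfolding e_def using r M by (auto intro!: divide_pos_pos)
    have "e * (M + 1) \<le> r / (M + 1) * (M + 1)" unfolding e_def using M by (intro mult_right_mono) auto
    also have "r / (M + 1) * (M + 1) = r" using M by simp
    finally show "e * M \<le> r" using e0 by (simp add: algebra_simps)
    have "e * (2 * \<bar>L\<bar> + 2) \<le> 1 / (2 * \<bar>L\<bar> + 2) * (2 * \<bar>L\<bar> + 2)"
      unfolding e_def by (intro mult_right_mono) auto
    also have "1 / (2 * \<bar>L\<bar> + 2) * (2 * \<bar>L\<bar> + 2) = 1" by (simp add: field_simps)
    finally show "e * \<bar>L\<bar> \<le> 1 / 2" using e0 by (simp add: algebra_simps)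
  qed
  define cl where "cl t = max b (min t (b + e))" for t
  have cl: "cl t \<in> {b..b + e}" for t using e(1) by (auto simp: cl_def)
  define T where "T f t = z0 + integral {b..cl t} (\<lambda>s. G (apply_bcontfun f s))" for f :: "real \<Rightarrow>\<^sub>C 'b" and t
  have Gf: "continuous_on S (\<lambda>s. G (apply_bcontfun f s))" for S and f :: "real \<Rightarrow>\<^sub>C 'b"
    by (rule continuous_on_compose2[OF Gc[of UNIV]]) (auto intro: continuous_intros)
  have int: "(\<lambda>s. G (apply_bcontfun f s)) integrable_on {a..c}" for a c and f :: "real \<Rightarrow>\<^sub>C 'b"
    by (rule integrable_continuous_real[OF Gf])
  have len: "norm (integral {b..cl t} h) \<le> e * k" if "continuous_on {b..cl t} h" "\<And>s. norm (h s) \<le> k"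
    for t k and h :: "real \<Rightarrow> 'b"
  proof -
    have "norm (integral {b..cl t} h) \<le> k * (cl t - b)"
      using cl[of t] that by (intro integral_bound) auto
    also have "\<dots> \<le> k * e" using cl[of t] order_trans[OF norm_ge_zero that(2)] by (intro mult_left_mono) auto
    finally show ?thesis by (simp add: mult.commute)
  qed
  have TB: "T f t \<in> ?B" for f t
    using order_trans[OF len[OF Gf GM] e(2)] by (simp add: T_def dist_norm)
  have Tc: "continuous_on UNIV (T f)" for f
  proof -
    have "continuous_on {b..b + e} (\<lambda>t. integral {b..t} (\<lambda>s. G (apply_bcontfun f s)))"
      by (rule indefinite_integral_continuous_1[OF int])
    moreover have "continuous_on UNIV cl" unfolding cl_def[abs_def] by (intro continuous_intros)
    moreover have "range cl \<subseteq> {b..b + e}" using cl by blast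
    ultimately show ?thesis
      unfolding T_def by (intro continuous_intros) (rule continuous_on_compose2)
  qed
  have Tb: "T f \<in> bcontfun" for f
  proof (rule bcontfun_normI[OF Tc])
    show "norm (T f t) \<le> norm z0 + r" for t
      using TB[of f t] norm_triangle_ineq2[of "T f t" z0] by (simp add: dist_norm norm_minus_commute)
  qed
  define TT where "TT f = Bcontfun (T f)" for f
  have TT: "apply_bcontfun (TT f) t = T f t" for f t
    unfolding TT_def using Bcontfun_inverse[OF Tb] by simp
  have "dist (TT f) (TT h) \<le> 1 / 2 * dist f h" for f h
  proof (rule dist_bound)
    fix t
    have "T f t - T h t = integral {b..cl t} (\<lambda>s. G (apply_bcontfun f s) - G (apply_bcontfun h s))"
      unfolding T_def by (simp add: integral_diff[OF int int])
    also have "norm \<dots> \<le> e * (\<bar>L\<bar> * dist f h)"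
    proof (rule len)
      show "continuous_on {b..cl t} (\<lambda>s. G (apply_bcontfun f s) - G (apply_bcontfun h s))"
        by (intro continuous_intros Gf)
      show "norm (G (apply_bcontfun f s) - G (apply_bcontfun h s)) \<le> \<bar>L\<bar> * dist f h" for s
        by (rule order_trans[OF Glip mult_left_mono]) (auto simp: dist_norm[symmetric] dist_bounded)
    qed
    also have "\<dots> = e * \<bar>L\<bar> * dist f h" by simp
    also have "\<dots> \<le> 1 / 2 * dist f h" using e(3) by (rule mult_right_mono) simp
    finally show "dist (apply_bcontfun (TT f) t) (apply_bcontfun (TT h) t) \<le> 1 / 2 * dist f h"
      unfolding TT by (simp add: dist_norm)
  qed
  then have "\<exists>!f. TT f = f"
    by (intro banach_fix_type[where c = "1/2"]) auto
  then obtain f where "TT f = f" by blast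
  then have fixf: "apply_bcontfun f t = T f t" for t using TT[of f t] by simp
  define Z where "Z = apply_bcontfun f"
  have ZB: "Z t \<in> ?B" for t unfolding Z_def fixf by (rule TB)
  have GZ: "G (Z t) = F (Z t)" for t unfolding G_def by (simp add: closest_point_self[OF ZB])
  have Zc: "continuous_on S Z" for S unfolding Z_def by (rule continuous_on_apply_bcontfun)
  have Zeq: "Z t = z0 + integral {b..t} (\<lambda>s. G (Z s))" if "t \<in> {b..b + e}" for t
  proof -
    have "cl t = t" using that by (auto simp: cl_def)
    then show ?thesis using fixf[of t] unfolding Z_def T_def by simp
  qed
  show ?thesis
  proof (rule that[of e Z])
    show "Z b = z0" using Zeq[of b] e(1) by simp
    show "(Z has_vector_derivative F (Z t)) (at t)" if t: "t \<in> {b<..<b + e}" for t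
    proof -
      have t': "t \<in> {b..b + e}" using t by auto
      have "continuous_on {b..b + e} (\<lambda>s. G (Z s))" using Gf unfolding Z_def .
      from integral_has_vector_derivative[OF this t']
      have "((\<lambda>u. integral {b..u} (\<lambda>s. G (Z s))) has_vector_derivative F (Z t)) (at t)"
        using at_within_interior[of t "{b..b + e}"] t by (simp add: GZ)
      from has_vector_derivative_add[OF has_vector_derivative_const this, of z0]
      have "((\<lambda>u. z0 + integral {b..u} (\<lambda>s. G (Z s))) has_vector_derivative F (Z t)) (at t)" by simp
      then show ?thesis
        by (rule has_vector_derivative_transform_within_open[where S = "{b<..<b + e}"])
           (use t Zeq in auto)
    qed
  qed (use e ZB Zc in auto)
qed

text \<open>A continuous function whose derivative is known off one point is a primitive there as well, as
  a single point does not affect the integral. This joins two solutions of a differential equation.\<close>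

lemma has_vector_derivative_across:
  fixes Z :: "real \<Rightarrow> 'b::euclidean_space"
  assumes b: "\<alpha> < b" "b < \<omega>" and Z: "continuous_on {\<alpha>..\<omega>} Z" and f: "continuous_on {\<alpha>..\<omega>} f"
    and der: "\<And>t. t \<in> {\<alpha><..<\<omega>} - {b} \<Longrightarrow> (Z has_vector_derivative f t) (at t)"
  shows "(Z has_vector_derivative f b) (at b)"
proof -
  have eq: "Z t = Z \<alpha> + integral {\<alpha>..t} f" if t: "t \<in> {\<alpha>..\<omega>}" for t
  proof -
    have "(f has_integral (Z t - Z \<alpha>)) {\<alpha>..t}"
      by (rule fundamental_theorem_of_calculus_interior_strong[of "{b}"])
         (use t der in \<open>auto intro: continuous_on_subset[OF Z]\<close>)
    then show ?thesis by (simp add: integral_unique)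
  qed
  have bin: "b \<in> {\<alpha>..\<omega>}" using b by auto
  have "((\<lambda>t. integral {\<alpha>..t} f) has_vector_derivative f b) (at b)"
    using integral_has_vector_derivative[OF f bin] at_within_interior[of b "{\<alpha>..\<omega>}"] b by simp
  from has_vector_derivative_add[OF has_vector_derivative_const this, of "Z \<alpha>"]
  have "((\<lambda>t. Z \<alpha> + integral {\<alpha>..t} f) has_vector_derivative f b) (at b)" by simp
  then show ?thesis
  proof (rule has_vector_derivative_transform_within_open[where S = "{\<alpha><..<\<omega>}"])
    show "Z \<alpha> + integral {\<alpha>..t} f = Z t" if "t \<in> {\<alpha><..<\<omega>}" for t
      by (rule eq[symmetric]) (use that in simp)
  qed (use b in auto)
qed

lemma bounded_derivative_left_limit:
  fixes D :: "real \<Rightarrow> 'b::euclidean_space"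
  assumes ab: "a < b" and D: "\<And>t. t \<in> {a<..<b} \<Longrightarrow> (D has_vector_derivative D' t) (at t)"
    and M: "\<And>t. t \<in> {a<..<b} \<Longrightarrow> norm (D' t) \<le> M"
  obtains v where "(D \<longlongrightarrow> v) (at_left b)"
proof -
  have lip: "norm (D s - D t) \<le> M * norm (s - t)" if "s \<in> {a<..<b}" "t \<in> {a<..<b}" for s t
  proof (rule differentiable_bound[of "{a<..<b}" D "\<lambda>t h. h *\<^sub>R D' t" M s t])
    show "(D has_derivative (\<lambda>h. h *\<^sub>R D' t)) (at t within {a<..<b})" if "t \<in> {a<..<b}" for t
      using D[OF that] unfolding has_vector_derivative_def by (rule has_derivative_at_withinI)
    show "onorm (\<lambda>h. h *\<^sub>R D' t) \<le> M" if "t \<in> {a<..<b}" for t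
      by (rule onorm_le) (use mult_right_mono[OF M[OF that] abs_ge_zero] in \<open>simp add: mult.commute\<close>)
  qed (use that in auto)
  have "\<bar>M\<bar>-lipschitz_on {a<..<b} D"
  proof (rule lipschitz_onI)
    fix s t assume "s \<in> {a<..<b}" "t \<in> {a<..<b}"
    from lip[OF this] show "dist (D s) (D t) \<le> \<bar>M\<bar> * dist s t"
      using mult_right_mono[OF abs_ge_self[of M] norm_ge_zero[of "s - t"]] by (simp add: dist_norm)
  qed simp
  then have uc: "uniformly_continuous_on {a<..<b} D" by (rule lipschitz_on_uniformly_continuous)
  obtain h where h: "uniformly_continuous_on (closure {a<..<b}) h" "\<And>x. x \<in> {a<..<b} \<Longrightarrow> D x = h x"
    by (rule uniformly_continuous_on_extension_on_closure[OF uc]) (rule that)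
  have "continuous_on {a..b} h" using uniformly_continuous_imp_continuous[OF h(1)] ab by simp
  then have "(h \<longlongrightarrow> h b) (at b within {a..b})" using ab by (simp add: continuous_on_def)
  then have "(h \<longlongrightarrow> h b) (at_left b)"
    using ab by (simp add: at_within_Icc_at_left)
  then have "(D \<longlongrightarrow> h b) (at_left b)"
    by (rule Lim_transform_eventually)
       (use h(2) ab in \<open>auto simp: eventually_at_left[OF ab] intro!: exI[of _ a]\<close>)
  then show ?thesis by (rule that)
qed

lemma Ck_on_fst:
  fixes f :: "'e::euclidean_space \<Rightarrow> 'f::real_normed_vector"
  assumes U: "open U"
  shows "Ck_on k UNIV U f \<Longrightarrow> Ck_on k UNIV (U \<times> (UNIV :: 'b::euclidean_space set)) (\<lambda>z. f (fst z))"
proof (induction k arbitrary: f)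
  case 0
  then show ?case by (auto intro!: continuous_on_compose2[of U f] continuous_intros)
next
  case (Suc k)
  show ?case
  proof (rule Ck_on_SucI[OF open_Times[OF U open_UNIV]])
    show "((\<lambda>z. f (fst z)) has_derivative (\<lambda>w. frechet_derivative f (at (fst z)) (fst w))) (at z)"
      if "z \<in> U \<times> UNIV" for z :: "'e \<times> 'b"
      by (rule has_derivative_compose[OF has_derivative_fst[OF has_derivative_ident] Ck_on_SucD[OF Suc.prems]])
         (use that in auto)
    show "Ck_on k UNIV (U \<times> UNIV) (\<lambda>z::'e \<times> 'b. frechet_derivative f (at (fst z)) (fst w))" for w :: "'e \<times> 'b"
      using Suc.IH[of "\<lambda>x. frechet_derivative f (at x) (fst w)"] Suc.prems by simp
  qed
qed

lemma Ck_on_linear_map: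
  assumes "open U" "bounded_linear T"
  shows "Ck_on k UNIV U T"
proof (cases k)
  case 0
  then show ?thesis using assms(2) by (simp add: linear_continuous_on)
next
  case (Suc j)
  show ?thesis unfolding Suc
    by (rule Ck_on_SucI[OF assms(1) bounded_linear_imp_has_derivative[OF assms(2)]]) (rule Ck_on_const[OF assms(1)])
qed

section \<open>The geodesic equation in different charts\<close>

context riemannian
begin

text \<open>The geodesic spray in a chart, a vector field on pairs of position and velocity.\<close>

definition spray :: "('a, 'e) chart \<Rightarrow> 'e \<times> 'e \<Rightarrow> 'e \<times> 'e" where
  "spray c z = (snd z, - christoffel UNIV (gc c) (fst z) (snd z) (snd z))"

lemma christoffel_expand:
  assumes c: "c \<in> A" "x \<in> chart_image c"
  shows "christoffel UNIV (gc c) x v v =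
    (\<Sum>i\<in>Basis. \<Sum>j\<in>Basis. ((v \<bullet> i) * (v \<bullet> j)) *\<^sub>R christoffel UNIV (gc c) x i j)"
proof -
  note bl = bilinear_gc[OF c]
  have ch: "gc c x (christoffel UNIV (gc c) x u u') w = (dgc c x u u' w + dgc c x u' u w - dgc c x w u u') / 2" for u u' w
    using christoffel_unique[OF c, of u u' "christoffel UNIV (gc c) x u u'"] by blast
  have lin: "gc c x (\<Sum>i\<in>I. f i) w = (\<Sum>i\<in>I. gc c x (f i) w)" for I f w
    by (rule linear_sum[OF bilinear_linear1[OF bl]])
  have "gc c x (\<Sum>i\<in>Basis. \<Sum>j\<in>Basis. ((v \<bullet> i) * (v \<bullet> j)) *\<^sub>R christoffel UNIV (gc c) x i j) w =
     dgc c x v v w - dgc c x w v v / 2" for w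
  proof -
    have B: "bilinear (\<lambda>u u'. dgc c x u u' w)"
      unfolding bilinear_def
      using linear_dgc[OF c] bilinear_linear1[OF bilinear_dgc[OF c]] by blast
    have e1: "dgc c x v v w = (\<Sum>i\<in>Basis. \<Sum>j\<in>Basis. (v \<bullet> i) * (v \<bullet> j) * dgc c x i j w)"
      by (rule bilinear_expand[OF B])
    have e2: "dgc c x v v w = (\<Sum>i\<in>Basis. \<Sum>j\<in>Basis. (v \<bullet> i) * (v \<bullet> j) * dgc c x j i w)"
      unfolding e1 by (subst sum.swap) (simp add: mult.commute mult.left_commute)
    have e3: "dgc c x w v v = (\<Sum>i\<in>Basis. \<Sum>j\<in>Basis. (v \<bullet> i) * (v \<bullet> j) * dgc c x w i j)"
      by (rule dgc_expand[OF c])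
    have "gc c x (\<Sum>i\<in>Basis. \<Sum>j\<in>Basis. ((v \<bullet> i) * (v \<bullet> j)) *\<^sub>R christoffel UNIV (gc c) x i j) w =
       (\<Sum>i\<in>Basis. \<Sum>j\<in>Basis. ((v \<bullet> i) * (v \<bullet> j) * dgc c x i j w + (v \<bullet> i) * (v \<bullet> j) * dgc c x j i w
          - (v \<bullet> i) * (v \<bullet> j) * dgc c x w i j) / 2)"
      unfolding lin bilinear_lmul[OF bl] ch by (simp add: distrib_left right_diff_distrib)
    also have "\<dots> = (dgc c x v v w + dgc c x v v w - dgc c x w v v) / 2"
      unfolding sum_divide_distrib[symmetric] sum.distrib sum_subtractf e1[symmetric] e2[symmetric] e3[symmetric] ..
    finally show ?thesis by (simp add: field_simps)
  qed
  then show ?thesis using christoffel_diag[OF c] by blast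
qed

lemma spray_Ck:
  assumes c: "c \<in> A"
  shows "Ck_on k UNIV (chart_image c \<times> UNIV) (\<lambda>z. snd (spray c z) \<bullet> n)"
proof -
  let ?U = "chart_image c \<times> (UNIV :: 'e set)"
  note U = open_image[OF c]
  have U2: "open ?U" by (intro open_Times U) simp
  have dk: "Ck_on k UNIV (chart_image c) (\<lambda>x. dgc c x u v w)" for u v w
    using gc_Ck[OF c, of "Suc k" v w] by (simp add: metric_deriv_def)
  have \<Gamma>: "Ck_on k UNIV (chart_image c) (\<lambda>x. christoffel UNIV (gc c) x i j)" for i j
  proof (rule solution_Ck_on[OF U inner_form_gc[OF c] gc_Ck[OF c]])
    show "Ck_on k UNIV (chart_image c) (\<lambda>x. (dgc c x i j w + dgc c x j i w - dgc c x w i j) * (1 / 2))" for w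
      by (intro Ck_on_mult Ck_on_diff Ck_on_add Ck_on_const U dk)
    show "gc c x (christoffel UNIV (gc c) x i j) w = (dgc c x i j w + dgc c x j i w - dgc c x w i j) * (1 / 2)"
      if "x \<in> chart_image c" for x w
      using christoffel_unique[OF c that, of i j "christoffel UNIV (gc c) x i j"] by simp
  qed
  have "Ck_on k UNIV ?U (\<lambda>z. - (\<Sum>i\<in>Basis. \<Sum>j\<in>Basis.
      ((snd z \<bullet> i) * (snd z \<bullet> j)) * (christoffel UNIV (gc c) (fst z) i j \<bullet> n)))"
    by (intro Ck_on_minus Ck_on_sum Ck_on_mult U2 Ck_on_fst[OF U, where f = "\<lambda>x. christoffel UNIV (gc c) x i j \<bullet> n" for i j]
        Ck_on_linear[OF U bounded_linear_inner_left \<Gamma>]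
        Ck_on_linear_map[where T = "\<lambda>z. snd z \<bullet> i" for i]
        bounded_linear_compose[OF bounded_linear_inner_left bounded_linear_snd])
  then show ?thesis
    by (rule Ck_on_cong[OF U2, rotated])
       (auto simp: spray_def christoffel_expand[OF c] inner_sum_left)
qed

lemma spray_Lipschitz:
  assumes c: "c \<in> A" and sub: "cball z r \<subseteq> chart_image c \<times> UNIV"
  obtains L where "\<And>u v. u \<in> cball z r \<Longrightarrow> v \<in> cball z r \<Longrightarrow> norm (spray c u - spray c v) \<le> L * norm (u - v)"
proof -
  have "\<exists>l. \<forall>u\<in>cball z r. \<forall>v\<in>cball z r. \<bar>snd (spray c u) \<bullet> n - snd (spray c v) \<bullet> n\<bar> \<le> l * norm (u - v)" for n
    by (rule Ck_on_Lipschitz[OF spray_Ck[OF c] compact_cball convex_cball sub]) blast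
  then obtain l where l: "\<And>n u v. u \<in> cball z r \<Longrightarrow> v \<in> cball z r \<Longrightarrow>
      \<bar>snd (spray c u) \<bullet> n - snd (spray c v) \<bullet> n\<bar> \<le> l n * norm (u - v)" by metis
  have "norm (spray c u - spray c v) \<le> (1 + (\<Sum>n\<in>Basis. l n)) * norm (u - v)"
    if uv: "u \<in> cball z r" "v \<in> cball z r" for u v
  proof -
    have "norm (spray c u - spray c v) \<le> norm (fst (spray c u - spray c v)) + norm (snd (spray c u - spray c v))"
      using norm_Pair_le[of "fst (spray c u - spray c v)" "snd (spray c u - spray c v)"]
      unfolding prod.collapse .
    also have "fst (spray c u - spray c v) = snd (u - v)" by (simp add: spray_def)
    also have "norm (snd (u - v)) \<le> norm (u - v)" by (metis norm_snd_le prod.collapse)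
    also have "norm (snd (spray c u - spray c v)) \<le> (\<Sum>n\<in>Basis. \<bar>snd (spray c u - spray c v) \<bullet> n\<bar>)"
      by (rule norm_le_l1)
    also have "\<dots> \<le> (\<Sum>n\<in>Basis. l n * norm (u - v))"
      by (intro sum_mono) (use l[OF uv] in \<open>simp add: inner_diff_left\<close>)
    finally show ?thesis by (simp add: sum_distrib_right distrib_right)
  qed
  then show ?thesis by (rule that)
qed

text \<open>A pointwise form of the geodesic equation, which makes gluing and restriction immediate.\<close>

definition geod_in_chart :: "('a, 'e) chart \<Rightarrow> (real \<Rightarrow> 'a) \<Rightarrow> real \<Rightarrow> bool" where
  "geod_in_chart c \<gamma> t \<longleftrightarrow> (\<exists>T D. open T \<and> t \<in> T \<and>
     (\<forall>s\<in>T. ((chart_map c \<circ> \<gamma>) has_vector_derivative D s) (at s)) \<and>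
     (D has_vector_derivative - christoffel UNIV (gc c) (chart_map c (\<gamma> t)) (D t) (D t)) (at t))"

definition geod_at :: "(real \<Rightarrow> 'a) \<Rightarrow> real \<Rightarrow> bool" where
  "geod_at \<gamma> t \<longleftrightarrow> isCont \<gamma> t \<and> (\<forall>c\<in>A. \<gamma> t \<in> chart_dom c \<longrightarrow> geod_in_chart c \<gamma> t)"

lemma open_chart_preimage:
  assumes "c \<in> A" "open I" "continuous_on I \<gamma>"
  shows "open (I \<inter> \<gamma> -` chart_dom c)"
  by (rule continuous_open_preimage[OF assms(3,2) open_dom[OF assms(1)]])

lemma geodesic_on_iff:
  assumes I: "open I"
  shows "geodesic_on UNIV A g I \<gamma> \<longleftrightarrow> (\<forall>t\<in>I. geod_at \<gamma> t)"
proof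
  assume G: "geodesic_on UNIV A g I \<gamma>"
  then have cont: "continuous_on I \<gamma>" by (simp add: geodesic_on_def)
  show "\<forall>t\<in>I. geod_at \<gamma> t"
  proof (intro ballI, unfold geod_at_def, intro conjI ballI impI)
    fix t assume t: "t \<in> I"
    show "isCont \<gamma> t" using cont I t by (simp add: continuous_on_eq_continuous_at)
    fix c assume c: "c \<in> A" "\<gamma> t \<in> chart_dom c"
    obtain D where D: "\<forall>t\<in>I. \<gamma> t \<in> chart_dom c \<longrightarrow>
        ((chart_map c \<circ> \<gamma>) has_vector_derivative D t) (at t) \<and>
        (D has_vector_derivative - christoffel UNIV (gc c) (chart_map c (\<gamma> t)) (D t) (D t)) (at t)"
      using G c(1) unfolding geodesic_on_def by blast
    show "geod_in_chart c \<gamma> t"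
      unfolding geod_in_chart_def
      by (rule exI[of _ "I \<inter> \<gamma> -` chart_dom c"], rule exI[of _ D])
         (use D t c open_chart_preimage[OF c(1) I cont] in auto)
  qed
next
  assume G: "\<forall>t\<in>I. geod_at \<gamma> t"
  show "geodesic_on UNIV A g I \<gamma>"
    unfolding geodesic_on_def
  proof (intro conjI ballI)
    show "continuous_on I \<gamma>" using G by (auto simp: geod_at_def intro: continuous_at_imp_continuous_on)
    fix c assume c: "c \<in> A"
    let ?D = "\<lambda>t. vector_derivative (chart_map c \<circ> \<gamma>) (at t)"
    have "((chart_map c \<circ> \<gamma>) has_vector_derivative ?D t) (at t) \<and>
        (?D has_vector_derivative - christoffel UNIV (gc c) (chart_map c (\<gamma> t)) (?D t) (?D t)) (at t)"
      if t: "t \<in> I" "\<gamma> t \<in> chart_dom c" for t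
    proof -
      obtain T D where T: "open T" "t \<in> T" and D: "\<forall>s\<in>T. ((chart_map c \<circ> \<gamma>) has_vector_derivative D s) (at s)"
        "(D has_vector_derivative - christoffel UNIV (gc c) (chart_map c (\<gamma> t)) (D t) (D t)) (at t)"
        using G t c unfolding geod_at_def geod_in_chart_def by blast
      have eq: "D s = ?D s" if "s \<in> T" for s using vector_derivative_at D(1) that by metis
      show ?thesis
        using has_vector_derivative_transform_within_open[OF D(2) T eq] D(1) T(2)
        unfolding eq[OF T(2)] by (metis eq)
    qed
    then show "\<exists>D. \<forall>t\<in>I. \<gamma> t \<in> chart_dom c \<longrightarrow>
        ((chart_map c \<circ> \<gamma>) has_vector_derivative D t) (at t) \<and>
        (D has_vector_derivative - christoffel UNIV (gc c) (chart_map c (\<gamma> t)) (D t) (D t)) (at t)"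
      by (intro exI[of _ ?D]) blast
  qed
qed

lemma geod_at_cong:
  assumes T: "open T" "t \<in> T" "\<And>s. s \<in> T \<Longrightarrow> \<gamma> s = \<delta> s" and G: "geod_at \<gamma> t"
  shows "geod_at \<delta> t"
  unfolding geod_at_def
proof (intro conjI ballI impI)
  show "isCont \<delta> t"
    using G isCont_cong[of \<gamma> \<delta> t] eventually_mono[OF eventually_nhds_in_open[OF T(1,2)] T(3)]
    by (auto simp: geod_at_def)
  fix c assume c: "c \<in> A" "\<delta> t \<in> chart_dom c"
  then obtain U D where U: "open U" "t \<in> U" and D: "\<forall>s\<in>U. ((chart_map c \<circ> \<gamma>) has_vector_derivative D s) (at s)"
        "(D has_vector_derivative - christoffel UNIV (gc c) (chart_map c (\<gamma> t)) (D t) (D t)) (at t)"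
    using G T unfolding geod_at_def geod_in_chart_def by (metis (no_types, lifting))
  have "((chart_map c \<circ> \<delta>) has_vector_derivative D s) (at s)" if "s \<in> T \<inter> U" for s
    by (rule has_vector_derivative_transform_within_open[OF bspec[OF D(1)] T(1)]) (use that T(3) in auto)
  then show "geod_in_chart c \<delta> t"
    unfolding geod_in_chart_def using D(2) T U
    by (intro exI[of _ "T \<inter> U"] exI[of _ D]) (auto simp: open_Int)
qed

text \<open>Invariance of the geodesic equation under a change of charts. The second derivative S of the
  transition map enters the transformed derivatives of the metric, and by its symmetry exactly the
  term that belongs to the acceleration of the transformed curve remains.\<close>

lemma christoffel_transition:
  assumes c: "c \<in> A" "c' \<in> A" and p: "p \<in> chart_dom c" "p \<in> chart_dom c'"
  defines "x \<equiv> chart_map c p" and "y \<equiv> chart_map c' p"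
  shows "christoffel UNIV (gc c') y (dtr c c' x u) (dtr c c' x u) =
    dtr c c' x (christoffel UNIV (gc c) x u u) - frechet_derivative (\<lambda>z. dtr c c' z u) (at x) u"
proof -
  let ?P = "dtr c c'"
  define S where "S k u = frechet_derivative (\<lambda>z. ?P z u) (at x) k" for k u
  note Ov = open_overlap[OF c]
  have xO: "x \<in> overlap c c'" using p by (auto simp: x_def)
  have xi: "x \<in> chart_image c" and yi: "y \<in> chart_image c'" using p by (auto simp: x_def y_def)
  have S: "((\<lambda>z. ?P z u) has_derivative (\<lambda>k. S k u)) (at x)" for u
    using Ck_on_SucD[OF _ xO, of 0 "\<lambda>z. ?P z u"] transition_Ck[OF c, of "Suc (Suc 0)"]
    by (auto simp: dtr_def S_def)
  have Ssym: "S k u = S u k" for k u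
    using second_derivative_symmetric[OF Ov xO transition_Ck[OF c]] by (simp add: S_def dtr_def)
  have \<tau>x: "transition c c' x = y" by (simp add: x_def y_def transition_chart[OF c(1) p(1)])
  have \<tau>: "(transition c c' has_derivative ?P x) (at x)" unfolding x_def by (rule transition_deriv[OF c p])
  have dg: "dgc c x k u v = dgc c' y (?P x k) (?P x u) (?P x v) + gc c' y (S k u) (?P x v) + gc c' y (?P x u) (S k v)"
    for k u v
  proof -
    have 1: "((\<lambda>z. gc c' (transition c c' z) (?P z u) (?P z v)) has_derivative
      (\<lambda>k. dgc c' y (?P x k) (?P x u) (?P x v) + gc c' (transition c c' x) (S k u) (?P x v) +
         gc c' (transition c c' x) (?P x u) (S k v))) (at x)"
    proof (rule has_derivative_form[where F = "\<lambda>z. gc c' (transition c c' z)" and DF = "\<lambda>k. dgc c' y (?P x k)",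
          OF Ov xO _ _ S S])
      show "bilinear (gc c' (transition c c' z))" if "z \<in> overlap c c'" for z
        using that by (intro bilinear_gc c) (auto simp: transition_chart[OF c(1)])
      show "((\<lambda>z. gc c' (transition c c' z) u v) has_derivative (\<lambda>k. dgc c' y (?P x k) u v)) (at x)" for u v
        by (rule has_derivative_compose[OF \<tau>, of "\<lambda>z. gc c' z u v"]) (simp only: \<tau>x dgc_deriv[OF c(2) yi])
    qed
    have "((\<lambda>z. gc c z u v) has_derivative
      (\<lambda>k. dgc c' y (?P x k) (?P x u) (?P x v) + gc c' (transition c c' x) (S k u) (?P x v) +
         gc c' (transition c c' x) (?P x u) (S k v))) (at x)"
    proof (rule has_derivative_transform_within_open[OF 1 Ov xO])
      fix z assume "z \<in> overlap c c'"
      then obtain q where q: "q \<in> chart_dom c" "q \<in> chart_dom c'" "z = chart_map c q" by blast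
      show "gc c' (transition c c' z) (?P z u) (?P z v) = gc c z u v"
        unfolding q(3) transition_chart[OF c(1) q(1)] by (rule gc_change[OF c q(1,2), symmetric])
    qed
    from fun_cong[OF has_derivative_unique[OF dgc_deriv[OF c(1) xi] this], of k] show ?thesis by (simp add: \<tau>x)
  qed
  let ?a = "christoffel UNIV (gc c) x u u"
  have "gc c' y (?P x ?a - S u u) W = dgc c' y (?P x u) (?P x u) W - dgc c' y W (?P x u) (?P x u) / 2" for W
  proof -
    obtain w where w: "W = ?P x w" using dtr_inverse[OF c(2,1) p(2,1), of W] unfolding x_def by metis
    have "gc c x ?a w = dgc c x u u w - dgc c x w u u / 2"
      using christoffel_diag[OF c(1) xi, of u ?a] by blast
    moreover have "gc c x ?a w = gc c' y (?P x ?a) W"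
      unfolding w x_def y_def by (rule gc_change[OF c p])
    ultimately have "gc c' y (?P x ?a) W = dgc c' y (?P x u) (?P x u) W + gc c' y (S u u) W + gc c' y (?P x u) (S u w)
       - (dgc c' y W (?P x u) (?P x u) + gc c' y (S w u) (?P x u) + gc c' y (?P x u) (S w u)) / 2"
      unfolding dg w[symmetric] by simp
    also have "gc c' y (S w u) (?P x u) = gc c' y (?P x u) (S u w)"
      unfolding Ssym[of w u] by (rule inner_formD(2)[OF inner_form_gc[OF c(2) yi]])
    also have "gc c' y (?P x u) (S w u) = gc c' y (?P x u) (S u w)" unfolding Ssym[of w u] ..
    finally show ?thesis
      unfolding bilinear_lsub[OF bilinear_gc[OF c(2) yi]] by (simp add: field_simps)
  qed
  then show ?thesis using christoffel_diag[OF c(2) yi] by (simp add: S_def)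
qed

lemma geod_at_one_chart:
  assumes c: "c \<in> A" "\<gamma> t \<in> chart_dom c" and cont: "open I" "t \<in> I" "continuous_on I \<gamma>"
    and G: "geod_in_chart c \<gamma> t"
  shows "geod_at \<gamma> t"
  unfolding geod_at_def
proof (intro conjI ballI impI)
  show isC: "isCont \<gamma> t" using cont by (simp add: continuous_on_eq_continuous_at)
  fix c' assume c': "c' \<in> A" "\<gamma> t \<in> chart_dom c'"
  obtain T D where T: "open T" "t \<in> T" and D: "\<forall>s\<in>T. ((chart_map c \<circ> \<gamma>) has_vector_derivative D s) (at s)"
    "(D has_vector_derivative - christoffel UNIV (gc c) (chart_map c (\<gamma> t)) (D t) (D t)) (at t)"
    using G unfolding geod_in_chart_def by blast
  let ?x = "chart_map c \<circ> \<gamma>" and ?P = "dtr c c'" and ?y = "chart_map c (\<gamma> t)"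
  define T' where "T' = (T \<inter> (I \<inter> \<gamma> -` chart_dom c)) \<inter> (I \<inter> \<gamma> -` chart_dom c')"
  have T': "open T'" "t \<in> T'"
    unfolding T'_def using open_chart_preimage[OF c(1) cont(1,3)] open_chart_preimage[OF c'(1) cont(1,3)] T c c' cont
    by auto
  define E where "E s = ?P (?x s) (D s)" for s
  have "((chart_map c' \<circ> \<gamma>) has_vector_derivative E s) (at s)" if s: "s \<in> T'" for s
  proof -
    have "isCont \<gamma> s" using cont s by (simp add: continuous_on_eq_continuous_at T'_def)
    then show ?thesis unfolding E_def o_apply[of "chart_map c" \<gamma>]
      by (intro curve_change_chart c c') (use s D(1) in \<open>auto simp: T'_def\<close>)
  qed
  moreover have "(E has_vector_derivative - christoffel UNIV (gc c') (chart_map c' (\<gamma> t)) (E t) (E t)) (at t)"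
  proof -
    define a where "a = - christoffel UNIV (gc c) ?y (D t) (D t)"
    define S where "S k u = frechet_derivative (\<lambda>z. ?P z u) (at ?y) k" for k u
    have xO: "?y \<in> overlap c c'" using c c' by auto
    have S: "((\<lambda>z. ?P z u) has_derivative (\<lambda>k. S k u)) (at ?y)" for u
      using Ck_on_SucD[OF _ xO, of 0 "\<lambda>z. ?P z u"] transition_Ck[OF c(1) c'(1), of "Suc (Suc 0)"]
      by (auto simp: dtr_def S_def)
    have exp: "?P z u = (\<Sum>i\<in>Basis. (u \<bullet> i) *\<^sub>R ?P z i)" if z: "z \<in> overlap c c'" for z u
    proof -
      obtain q where q: "q \<in> chart_dom c" "q \<in> chart_dom c'" "z = chart_map c q" using z by blast
      have "?P z (\<Sum>i\<in>Basis. (u \<bullet> i) *\<^sub>R i) = (\<Sum>i\<in>Basis. (u \<bullet> i) *\<^sub>R ?P z i)"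
        unfolding q(3) using linear_dtr[OF c(1) c'(1) q(1,2)] by (simp add: linear_sum linear_scale)
      then show ?thesis by (simp add: euclidean_representation)
    qed
    have Sexp: "S k u = (\<Sum>i\<in>Basis. (u \<bullet> i) *\<^sub>R S k i)" for k u
    proof -
      have "((\<lambda>z. ?P z u) has_derivative (\<lambda>k. \<Sum>i\<in>Basis. (u \<bullet> i) *\<^sub>R S k i)) (at ?y)"
      proof (rule has_derivative_transform_within_open[OF _ open_overlap[OF c(1) c'(1)] xO])
        show "((\<lambda>z. \<Sum>i\<in>Basis. (u \<bullet> i) *\<^sub>R ?P z i) has_derivative (\<lambda>k. \<Sum>i\<in>Basis. (u \<bullet> i) *\<^sub>R S k i)) (at ?y)"
          by (intro has_derivative_sum has_derivative_scaleR_right S)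
      qed (rule exp[symmetric])
      from fun_cong[OF has_derivative_unique[OF S this]] show ?thesis .
    qed
    have xd: "(?x has_derivative (\<lambda>h. h *\<^sub>R D t)) (at t)"
      using D(1) T(2) unfolding has_vector_derivative_def by blast
    have Dd: "(D has_derivative (\<lambda>h. h *\<^sub>R a)) (at t)" using D(2) unfolding has_vector_derivative_def a_def .
    have "((\<lambda>s. \<Sum>i\<in>Basis. (D s \<bullet> i) *\<^sub>R ?P (?x s) i) has_derivative
       (\<lambda>h. \<Sum>i\<in>Basis. (D t \<bullet> i) *\<^sub>R S (h *\<^sub>R D t) i + (h *\<^sub>R a \<bullet> i) *\<^sub>R ?P (?x t) i)) (at t)"
    proof (intro has_derivative_sum has_derivative_scaleR has_derivative_inner_left Dd)
      show "((\<lambda>s. ?P (?x s) i) has_derivative (\<lambda>h. S (h *\<^sub>R D t) i)) (at t)" for i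
      proof -
        have "((\<lambda>z. ?P z i) has_derivative (\<lambda>k. S k i)) (at (?x t))" using S by simp
        from has_derivative_compose[OF xd this] show ?thesis .
      qed
    qed
    then have "((\<lambda>s. \<Sum>i\<in>Basis. (D s \<bullet> i) *\<^sub>R ?P (?x s) i) has_derivative
       (\<lambda>h. h *\<^sub>R (S (D t) (D t) + ?P ?y a))) (at t)"
    proof (rule has_derivative_eq_rhs, intro ext)
      fix h
      have Sl: "S (h *\<^sub>R D t) i = h *\<^sub>R S (D t) i" for i
        by (rule linear_scale[OF has_derivative_linear[OF S]])
      show "(\<Sum>i\<in>Basis. (D t \<bullet> i) *\<^sub>R S (h *\<^sub>R D t) i + (h *\<^sub>R a \<bullet> i) *\<^sub>R ?P (?x t) i) =
          h *\<^sub>R (S (D t) (D t) + ?P ?y a)"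
        unfolding Sl exp[OF xO, of a] Sexp[of "D t" "D t"]
        by (simp add: sum.distrib scaleR_sum_right scaleR_add_right mult.commute)
    qed
    then have "(E has_derivative (\<lambda>h. h *\<^sub>R (S (D t) (D t) + ?P ?y a))) (at t)"
      by (rule has_derivative_transform_within_open[OF _ T'])
         (unfold E_def, rule exp[symmetric], auto simp: T'_def)
    moreover have "S (D t) (D t) + ?P ?y a = - christoffel UNIV (gc c') (chart_map c' (\<gamma> t)) (E t) (E t)"
      unfolding E_def o_apply christoffel_transition[OF c(1) c'(1) c(2) c'(2)] a_def S_def
        linear_neg[OF linear_dtr[OF c(1) c'(1) c(2) c'(2)]] by simp
    ultimately show ?thesis unfolding has_vector_derivative_def by simp
  qed
  ultimately show "geod_in_chart c' \<gamma> t" unfolding geod_in_chart_def using T' by blast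
qed

end

section \<open>Extension of geodesics\<close>

context riemannian
begin

lemma geodesic_C1_curve:
  assumes I: "open I" and G: "geodesic_on UNIV A g I \<gamma>" and sub: "{s..t} \<subseteq> I"
  shows "C1_curve A s t \<gamma>"
  unfolding C1_curve_def
proof (intro conjI ballI)
  show "continuous_on {s..t} \<gamma>" using G sub unfolding geodesic_on_def by (blast intro: continuous_on_subset)
  fix c assume "c \<in> A"
  then obtain D where D: "\<forall>t\<in>I. \<gamma> t \<in> chart_dom c \<longrightarrow>
        ((chart_map c \<circ> \<gamma>) has_vector_derivative D t) (at t) \<and>
        (D has_vector_derivative - christoffel UNIV (gc c) (chart_map c (\<gamma> t)) (D t) (D t)) (at t)"
    using G unfolding geodesic_on_def by blast
  show "\<exists>D. (\<forall>u\<in>{s..t}. \<gamma> u \<in> chart_dom c \<longrightarrow>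
      ((chart_map c \<circ> \<gamma>) has_vector_derivative D u) (at u within {s..t})) \<and>
      continuous_on {u\<in>{s..t}. \<gamma> u \<in> chart_dom c} D"
  proof (intro exI[of _ D] conjI ballI impI)
    show "((chart_map c \<circ> \<gamma>) has_vector_derivative D u) (at u within {s..t})"
      if "u \<in> {s..t}" "\<gamma> u \<in> chart_dom c" for u
      using D sub that by (blast intro: has_vector_derivative_at_within)
    show "continuous_on {u\<in>{s..t}. \<gamma> u \<in> chart_dom c} D"
      using D sub by (intro continuous_at_imp_continuous_on) (blast intro: has_vector_derivative_continuous)
  qed
qed

lemma unit_speed_d_le:
  assumes I: "open I" and G: "geodesic_on UNIV A g I \<gamma>" and sub: "{s..t} \<subseteq> I" and st: "s \<le> t"
    and unit: "\<And>t. t \<in> I \<Longrightarrow> speed \<gamma> t = 1"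
  shows "d (\<gamma> s) (\<gamma> t) \<le> t - s"
proof -
  have "d (\<gamma> s) (\<gamma> t) \<le> len s t \<gamma>"
    by (rule d_le_len[OF pc1_C1[OF geodesic_C1_curve[OF I G sub]] st])
  also have "len s t \<gamma> = integral {s..t} (\<lambda>t. 1)"
    unfolding len_def by (rule integral_cong) (use unit sub in auto)
  finally show ?thesis using st by simp
qed

lemma spray_continuous:
  assumes c: "c \<in> A"
  shows "continuous_on (chart_image c \<times> UNIV) (spray c)"
proof -
  have "continuous_on (chart_image c \<times> UNIV) (\<lambda>z. snd (spray c z))"
    unfolding continuous_on_componentwise[of _ "\<lambda>z. snd (spray c z)"]
    using Ck_on_continuous[OF spray_Ck[OF c, of 0]] by blast
  from continuous_on_Pair[OF continuous_on_snd[OF continuous_on_id] this]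
  have "continuous_on (chart_image c \<times> UNIV) (\<lambda>z. (snd z, snd (spray c z)))" .
  then show ?thesis by (rule continuous_on_eq) (simp add: spray_def)
qed

lemma energy_constant:
  assumes c: "c \<in> A" and T: "open T" "t \<in> T"
    and Z: "\<And>s. s \<in> T \<Longrightarrow> (Z has_vector_derivative spray c (Z s)) (at s)"
    and im: "\<And>s. s \<in> T \<Longrightarrow> fst (Z s) \<in> chart_image c"
  shows "((\<lambda>s. gc c (fst (Z s)) (snd (Z s)) (snd (Z s))) has_real_derivative 0) (at t)"
proof -
  let ?x = "fst (Z t)" and ?u = "snd (Z t)"
  let ?a = "christoffel UNIV (gc c) ?x ?u ?u"
  have 1: "((\<lambda>s. fst (Z s)) has_derivative (\<lambda>h. h *\<^sub>R ?u)) (at t)"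
    using bounded_linear.has_vector_derivative[OF bounded_linear_fst Z[OF T(2)]]
    by (simp add: spray_def has_vector_derivative_def)
  have 2: "((\<lambda>s. snd (Z s)) has_derivative (\<lambda>h. h *\<^sub>R - ?a)) (at t)"
    using bounded_linear.has_vector_derivative[OF bounded_linear_snd Z[OF T(2)]]
    by (simp add: spray_def has_vector_derivative_def)
  have "((\<lambda>s. gc c (fst (Z s)) (snd (Z s)) (snd (Z s))) has_derivative
     (\<lambda>h. dgc c ?x (h *\<^sub>R ?u) ?u ?u + gc c ?x (h *\<^sub>R - ?a) ?u + gc c ?x ?u (h *\<^sub>R - ?a))) (at t)"
  proof (rule has_derivative_form[where F = "\<lambda>s. gc c (fst (Z s))" and DF = "\<lambda>h. dgc c ?x (h *\<^sub>R ?u)", OF T _ _ 2 2])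
    show "bilinear (gc c (fst (Z s)))" if "s \<in> T" for s by (rule bilinear_gc[OF c im[OF that]])
    show "((\<lambda>s. gc c (fst (Z s)) u v) has_derivative (\<lambda>h. dgc c ?x (h *\<^sub>R ?u) u v)) (at t)" for u v
      by (rule has_derivative_compose[OF 1 dgc_deriv[OF c im[OF T(2)]]])
  qed
  moreover have "dgc c ?x (h *\<^sub>R ?u) ?u ?u + gc c ?x (h *\<^sub>R - ?a) ?u + gc c ?x ?u (h *\<^sub>R - ?a) = 0" for h
  proof -
    note bl = bilinear_gc[OF c im[OF T(2)]]
    have "gc c ?x ?a ?u = dgc c ?x ?u ?u ?u - dgc c ?x ?u ?u ?u / 2"
      using christoffel_diag[OF c im[OF T(2)], of ?u ?a] by blast
    moreover have "gc c ?x ?u ?a = gc c ?x ?a ?u" by (rule inner_formD(2)[OF inner_form_gc[OF c im[OF T(2)]]])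
    ultimately show ?thesis
      unfolding bilinear_lmul[OF bl] bilinear_rmul[OF bl] bilinear_lneg[OF bl] bilinear_rneg[OF bl]
        linear_scale[OF linear_dgc[OF c im[OF T(2)]]] by (simp add: algebra_simps)
  qed
  ultimately have "((\<lambda>s. gc c (fst (Z s)) (snd (Z s)) (snd (Z s))) has_derivative (\<lambda>h. 0)) (at t)" by simp
  then show ?thesis unfolding has_field_derivative_def by (rule has_derivative_eq_rhs) (simp add: fun_eq_iff)
qed

lemma geod_at_reflect:
  assumes "geod_at \<gamma> (- t)"
  shows "geod_at (\<lambda>s. \<gamma> (- s)) t"
  unfolding geod_at_def
proof (intro conjI ballI impI)
  show "isCont (\<lambda>s. \<gamma> (- s)) t"
    using assms isCont_o2[of t uminus \<gamma>] by (simp add: geod_at_def)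
  fix c assume c: "c \<in> A" "\<gamma> (- t) \<in> chart_dom c"
  let ?x = "chart_map c (\<gamma> (- t))"
  obtain T D where T: "open T" "- t \<in> T" and D: "\<forall>s\<in>T. ((chart_map c \<circ> \<gamma>) has_vector_derivative D s) (at s)"
    "(D has_vector_derivative - christoffel UNIV (gc c) ?x (D (- t)) (D (- t))) (at (- t))"
    using assms c unfolding geod_at_def geod_in_chart_def by blast
  have um: "(uminus has_vector_derivative - 1) (at s)" for s :: real
    by (auto intro!: derivative_eq_intros)
  have "((chart_map c \<circ> (\<lambda>s. \<gamma> (- s))) has_vector_derivative - D (- s)) (at s)" if "s \<in> uminus -` T" for s
    using vector_diff_chain_at[OF um[of s], of "chart_map c \<circ> \<gamma>" "D (- s)"] D(1) that by (simp add: o_def)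
  moreover have "((\<lambda>s. - D (- s)) has_vector_derivative - christoffel UNIV (gc c) ?x (D (- t)) (D (- t))) (at t)"
    using has_vector_derivative_minus[OF vector_diff_chain_at[OF um D(2)]] by (simp add: o_def)
  moreover have "christoffel UNIV (gc c) ?x (D (- t)) (D (- t)) = christoffel UNIV (gc c) ?x (- D (- t)) (- D (- t))"
  proof -
    have xi: "?x \<in> chart_image c" using c(2) by blast
    note bd = bilinear_dgc[OF c(1) xi]
    have "dgc c ?x (- u) (- u) w = dgc c ?x u u w" "dgc c ?x w (- u) (- u) = dgc c ?x w u u" for u w
      unfolding linear_neg[OF linear_dgc[OF c(1) xi]] bilinear_lneg[OF bd] bilinear_rneg[OF bd] by simp_all
    then show ?thesis using christoffel_diag[OF c(1) xi] by metis
  qed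
  moreover have "open (uminus -` T)" by (intro open_vimage T continuous_intros)
  ultimately show "geod_in_chart c (\<lambda>s. \<gamma> (- s)) t"
    unfolding geod_in_chart_def using T(2)
    by (intro exI[of _ "uminus -` T"] exI[of _ "\<lambda>s. - D (- s)"]) auto
qed

lemma speed_reflect:
  assumes "geod_at \<gamma> (- t)"
  shows "speed (\<lambda>s. \<gamma> (- s)) t = speed \<gamma> (- t)"
proof -
  have "geod_in_chart (chart_at A (\<gamma> (- t))) \<gamma> (- t)" "isCont \<gamma> (- t)"
    using assms chart_at unfolding geod_at_def by auto
  then show ?thesis
    using speed_affine[where \<phi> = uminus and \<alpha> = "-1" and \<beta> = 0 and \<gamma> = \<gamma> and t = t] unfolding geod_in_chart_def by (auto simp: o_def)
qed

end

context connected_riemannian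
begin

text \<open>By compactness the curve has a cluster point q at time b, and since distances along the curve are
  bounded by elapsed time, it converges to q.\<close>

lemma confined_geodesic_limit:
  assumes I: "open I" and G: "geodesic_on UNIV A g I \<gamma>" and unit: "\<And>t. t \<in> I \<Longrightarrow> speed \<gamma> t = 1"
    and b: "t1 < b" "{t1..<b} \<subseteq> I" and K: "compact K" "\<And>t. t \<in> {t1..<b} \<Longrightarrow> \<gamma> t \<in> K"
  obtains q where "(\<gamma> \<longlongrightarrow> q) (at_left b)"
proof -
  have near: "\<forall>\<^sub>F t in at_left b. t \<in> {s<..<b}" if "s < b" for s
    using that by (auto simp: eventually_at_left[OF that])
  have "filtermap \<gamma> (at_left b) \<noteq> bot" by (simp add: filtermap_bot_iff)
  moreover have "\<forall>\<^sub>F p in filtermap \<gamma> (at_left b). p \<in> K"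
    unfolding eventually_filtermap using near[OF b(1)] by eventually_elim (use K(2) in auto)
  ultimately obtain q where q: "inf (nhds q) (filtermap \<gamma> (at_left b)) \<noteq> bot"
    using K(1) unfolding compact_filter by blast
  have le: "d (\<gamma> t) q \<le> b - t" if t: "t \<in> {t1<..<b}" for t
  proof (rule field_le_epsilon)
    fix e :: real assume e: "0 < e"
    have "open {y. d y q < e}" by (intro open_Collect_less d_continuous2 continuous_intros)
    then have n1: "\<forall>\<^sub>F y in nhds q. d y q < e"
      using eventually_nhds_in_open[of "{y. d y q < e}" q] e d_zero[of q q] by simp
    have "\<exists>s\<in>{t<..<b}. d (\<gamma> s) q < e"
    proof (rule ccontr)
      assume *: "\<not> ?thesis"
      have "\<forall>\<^sub>F s in at_left b. \<not> d (\<gamma> s) q < e"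
        using near[of t] t by (auto elim!: eventually_mono) (use * in auto)
      then have "\<forall>\<^sub>F y in filtermap \<gamma> (at_left b). \<not> d y q < e" by (simp add: eventually_filtermap)
      with n1 have "\<forall>\<^sub>F y in inf (nhds q) (filtermap \<gamma> (at_left b)). False"
        unfolding eventually_inf by blast
      then show False using q by (simp add: trivial_limit_def)
    qed
    then obtain s where s: "s \<in> {t<..<b}" "d (\<gamma> s) q < e" by blast
    have "{t..s} \<subseteq> I" using s t b(2) by auto
    then have "d (\<gamma> t) (\<gamma> s) \<le> s - t" using unit_speed_d_le[OF I G _ _ unit] s by auto
    then show "d (\<gamma> t) q \<le> b - t + e" using d_triangle[of "\<gamma> t" q "\<gamma> s"] s by simp
  qed
  have "((\<lambda>t. d (\<gamma> t) q) \<longlongrightarrow> 0) (at_left b)"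
  proof (rule tendsto_sandwich[of "\<lambda>_. 0" "\<lambda>t. d (\<gamma> t) q" _ "\<lambda>t. b - t"])
    show "\<forall>\<^sub>F t in at_left b. d (\<gamma> t) q \<le> b - t" using near[OF b(1)] by eventually_elim (rule le)
    show "((\<lambda>t. b - t) \<longlongrightarrow> 0) (at_left b)" by (auto intro!: tendsto_eq_intros)
  qed (auto simp: d_nonneg)
  then show ?thesis using that unfolding d_tendsto_iff[symmetric] by blast
qed

text \<open>In a chart around the limit point the coordinate velocity is bounded by the unit speed and the
  coordinate acceleration by the geodesic equation, so the velocity converges as well. Continuing with
  a solution of the geodesic equation from these limits gives a curve whose acceleration exists at the
  joint; its speed is preserved because energy is constant along solutions.\<close>

lemma geodesic_extend_right:
  assumes I: "open I" and G: "geodesic_on UNIV A g I \<gamma>" and unit: "\<And>t. t \<in> I \<Longrightarrow> speed \<gamma> t = 1"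
    and b: "t1 < b" "{t1..<b} \<subseteq> I" "\<And>t. t \<in> I \<Longrightarrow> t < b"
    and K: "compact K" "\<And>t. t \<in> {t1..<b} \<Longrightarrow> \<gamma> t \<in> K"
  obtains e \<delta> where "0 < e" "\<And>t. t \<in> I \<Longrightarrow> \<delta> t = \<gamma> t"
    "\<And>t. t \<in> I \<union> {b..<b + e} \<Longrightarrow> geod_at \<delta> t \<and> speed \<delta> t = 1"
proof -
  obtain q where q: "(\<gamma> \<longlongrightarrow> q) (at_left b)"
    by (rule confined_geodesic_limit[OF I G unit b(1,2) K])
  let ?c = "chart_at A q"
  note c = chart_at(1)[of q] and qc = chart_at(2)[of q]
  let ?x = "\<lambda>t. chart_map ?c (\<gamma> t)"
  obtain r l L Q where r: "0 < r" "cball (chart_map ?c q) r \<subseteq> chart_image ?c" "0 < l"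
    "\<And>z u. z \<in> cball (chart_map ?c q) r \<Longrightarrow> l * (norm u)\<^sup>2 \<le> gc ?c z u u"
    by (rule chart_bounds[OF c, of "chart_map ?c q"]) (use qc in blast)+
  let ?W = "chart_dom ?c \<inter> chart_map ?c -` ball (chart_map ?c q) r"
  have "open ?W" by (rule continuous_open_preimage[OF cont_chart[OF c] open_dom[OF c]]) simp
  moreover have "q \<in> ?W" using qc r(1) by simp
  ultimately have "\<forall>\<^sub>F t in at_left b. \<gamma> t \<in> ?W" by (rule topological_tendstoD[OF q])
  then obtain \<beta>0 where \<beta>0: "\<beta>0 < b" "\<And>t. \<beta>0 < t \<Longrightarrow> t < b \<Longrightarrow> \<gamma> t \<in> ?W"
    unfolding eventually_at_left[OF b(1)] by blast
  define \<beta> where "\<beta> = max \<beta>0 t1"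
  have \<beta>: "\<beta> < b" using \<beta>0 b by (simp add: \<beta>_def)
  have near: "t \<in> I" "\<gamma> t \<in> chart_dom ?c" "?x t \<in> cball (chart_map ?c q) r" "?x t \<in> chart_image ?c"
    if "t \<in> {\<beta><..<b}" for t
    using \<beta>0(2)[of t] b(2) that by (auto simp: \<beta>_def)
  obtain D where D: "\<And>t. t \<in> I \<Longrightarrow> \<gamma> t \<in> chart_dom ?c \<Longrightarrow>
      ((chart_map ?c \<circ> \<gamma>) has_vector_derivative D t) (at t) \<and>
      (D has_vector_derivative - christoffel UNIV (gc ?c) (?x t) (D t) (D t)) (at t)"
    using G c unfolding geodesic_on_def by blast
  have Dx: "(?x has_vector_derivative D t) (at t)" and
    DD: "(D has_vector_derivative - christoffel UNIV (gc ?c) (?x t) (D t) (D t)) (at t)"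
    if "t \<in> {\<beta><..<b}" for t
    using D[OF near(1,2)[OF that]] by (auto simp: o_def)
  have \<gamma>c: "isCont \<gamma> t" if "t \<in> I" for t
    using G I that unfolding geodesic_on_def by (simp add: continuous_on_eq_continuous_at)
  have unit_c: "gc ?c (?x t) (D t) (D t) = 1" if t: "t \<in> {\<beta><..<b}" for t
    using speed_chart[OF c near(2)[OF t] \<gamma>c[OF near(1)[OF t]], of "D t"] D[OF near(1,2)[OF t]]
      unit[OF near(1)[OF t]] by simp
  define M where "M = 1 / sqrt l"
  have DM: "norm (D t) \<le> M" if t: "t \<in> {\<beta><..<b}" for t
  proof -
    have "l * (norm (D t))\<^sup>2 \<le> 1" using r(4)[OF near(3)[OF t], of "D t"] unit_c[OF t] by simp
    then have "(sqrt l * norm (D t))\<^sup>2 \<le> 1\<^sup>2" using r(3) by (simp add: power_mult_distrib)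
    then have "sqrt l * norm (D t) \<le> 1" by (rule power2_le_imp_le) simp
    then show ?thesis using r(3) by (simp add: M_def field_simps)
  qed
  have sub: "cball (chart_map ?c q) r \<times> cball 0 M \<subseteq> chart_image ?c \<times> UNIV" using r(2) by auto
  have cpt: "compact (spray ?c ` (cball (chart_map ?c q) r \<times> cball 0 M))"
    by (intro compact_continuous_image continuous_on_subset[OF spray_continuous[OF c] sub] compact_Times compact_cball)
  obtain M2 where M2': "\<forall>y\<in>spray ?c ` (cball (chart_map ?c q) r \<times> cball 0 M). norm y \<le> M2"
    using compact_imp_bounded[OF cpt] unfolding bounded_iff ..
  have M2: "norm (spray ?c z) \<le> M2" if "z \<in> cball (chart_map ?c q) r \<times> cball 0 M" for z
    by (rule bspec[OF M2' imageI[OF that]])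
  have DDM: "norm (- christoffel UNIV (gc ?c) (?x t) (D t) (D t)) \<le> M2" if t: "t \<in> {\<beta><..<b}" for t
  proof -
    have "norm (snd (spray ?c (?x t, D t))) \<le> norm (spray ?c (?x t, D t))" by (metis norm_snd_le prod.collapse)
    also have "\<dots> \<le> M2" using near(3)[OF t] DM[OF t] by (intro M2) auto
    finally show ?thesis by (simp add: spray_def)
  qed
  obtain v where v: "(D \<longlongrightarrow> v) (at_left b)"
    by (rule bounded_derivative_left_limit[OF \<beta> DD DDM])
  have xq: "(?x \<longlongrightarrow> chart_map ?c q) (at_left b)"
    by (rule isCont_tendsto_compose[OF isCont_chart[OF c qc] q])
  let ?z0 = "(chart_map ?c q, v)"
  have "open (chart_image ?c \<times> (UNIV :: 'e set))" "?z0 \<in> chart_image ?c \<times> UNIV"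
    using open_image[OF c] qc by (auto intro: open_Times)
  then obtain r2 where r2: "0 < r2" "cball ?z0 r2 \<subseteq> chart_image ?c \<times> UNIV"
    using open_contains_cball by blast
  obtain Lp where Lp: "\<And>u v. u \<in> cball ?z0 r2 \<Longrightarrow> v \<in> cball ?z0 r2 \<Longrightarrow>
      norm (spray ?c u - spray ?c v) \<le> Lp * norm (u - v)"
    using spray_Lipschitz[OF c r2(2)] by blast
  obtain e Y where Y: "0 < e" "Y b = ?z0" "continuous_on {b..b + e} Y"
    "\<And>t. t \<in> {b..b + e} \<Longrightarrow> Y t \<in> cball ?z0 r2"
    "\<And>t. t \<in> {b<..<b + e} \<Longrightarrow> (Y has_vector_derivative spray ?c (Y t)) (at t)"
    by (rule ode_exists_right[where b = b and ?z0.0 = ?z0, OF r2(1) Lp]) (assumption | rule that)+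
  define Z where "Z t = (if t < b then (?x t, D t) else Y t)" for t
  define \<alpha> where "\<alpha> = (\<beta> + b) / 2"
  have \<alpha>: "\<beta> < \<alpha>" "\<alpha> < b" using \<beta> by (auto simp: \<alpha>_def)
  have im: "fst (Z t) \<in> chart_image ?c" if "t \<in> {\<alpha>..b + e}" for t
    using near(4)[of t] Y(4)[of t] r2(2) that \<alpha> by (auto simp: Z_def)
  have Zl: "(Z has_vector_derivative spray ?c (Z t)) (at t)" if t: "t \<in> {\<beta><..<b}" for t
  proof -
    have "((\<lambda>t. (?x t, D t)) has_vector_derivative spray ?c (Z t)) (at t)"
      using t Dx[OF t] DD[OF t] by (simp add: Z_def spray_def has_vector_derivative_Pair)
    then show ?thesis
      by (rule has_vector_derivative_transform_within_open[where S = "{\<beta><..<b}"]) (use t in \<open>auto simp: Z_def\<close>)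
  qed
  have Zr: "(Z has_vector_derivative spray ?c (Z t)) (at t)" if t: "t \<in> {b<..<b + e}" for t
  proof -
    have "Z t = Y t" using t by (simp add: Z_def)
    then have "(Y has_vector_derivative spray ?c (Z t)) (at t)" using Y(5)[OF t] by simp
    then show ?thesis
      by (rule has_vector_derivative_transform_within_open[where S = "{b<..<b + e}"]) (use t in \<open>auto simp: Z_def\<close>)
  qed
  have Zc: "continuous_on {\<alpha>..b + e} Z"
  proof -
    have "continuous_on {\<alpha>..b} Z"
      unfolding continuous_on_eq_continuous_within
    proof
      fix t assume t: "t \<in> {\<alpha>..b}"
      show "continuous (at t within {\<alpha>..b}) Z"
      proof (cases "t = b")
        case True
        have "((\<lambda>t. (?x t, D t)) \<longlongrightarrow> Z b) (at_left b)"
          using tendsto_Pair[OF xq v] Y(2) by (simp add: Z_def)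
        then have "(Z \<longlongrightarrow> Z b) (at_left b)"
          by (rule Lim_transform_eventually) (auto simp: Z_def eventually_at_filter)
        then show ?thesis using \<alpha> True by (simp add: continuous_within at_within_Icc_at_left)
      next
        case False
        then show ?thesis
          using has_vector_derivative_continuous[OF Zl[of t]] t \<alpha> by (auto intro: continuous_at_imp_continuous_within)
      qed
    qed
    moreover have "continuous_on {b..b + e} Z"
      by (rule continuous_on_eq[OF Y(3)]) (simp add: Z_def)
    ultimately have "continuous_on ({\<alpha>..b} \<union> {b..b + e}) Z" by (intro continuous_on_closed_Un) auto
    moreover have "{\<alpha>..b} \<union> {b..b + e} = {\<alpha>..b + e}" using \<alpha> Y(1) by auto
    ultimately show ?thesis by simp
  qed
  have Fc: "continuous_on {\<alpha>..b + e} (\<lambda>t. spray ?c (Z t))"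
    by (rule continuous_on_compose2[OF spray_continuous[OF c] Zc], rule image_subsetI) (simp add: mem_Times_iff im)
  let ?J = "{\<alpha><..<b + e}"
  have Zd: "(Z has_vector_derivative spray ?c (Z t)) (at t)" if t: "t \<in> ?J" for t
  proof (cases "t = b")
    case True
    have "(Z has_vector_derivative spray ?c (Z b)) (at b)"
    proof (rule has_vector_derivative_across[OF \<alpha>(2) _ Zc Fc])
      show "(Z has_vector_derivative spray ?c (Z t)) (at t)" if "t \<in> ?J - {b}" for t
        using Zl[of t] Zr[of t] that \<alpha> by (cases "t < b") auto
    qed (use Y(1) in simp)
    then show ?thesis using True by simp
  next
    case False
    then show ?thesis using Zl[of t] Zr[of t] t \<alpha> by (cases "t < b") auto
  qed
  define \<delta> where "\<delta> t = (if t < b then \<gamma> t else chart_inv ?c (fst (Y t)))" for t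
  have \<delta>Z: "\<delta> t = chart_inv ?c (fst (Z t))" if t: "t \<in> {\<alpha>..b + e}" for t
    using inv_chart[OF c near(2)[of t]] t \<alpha> by (auto simp: \<delta>_def Z_def)
  have \<delta>dom: "\<delta> t \<in> chart_dom ?c" "chart_map ?c (\<delta> t) = fst (Z t)" if t: "t \<in> {\<alpha>..b + e}" for t
    using \<delta>Z[OF t] inv_in_dom[OF c im[OF t]] chart_inv_inv[OF c im[OF t]] by auto
  have JJ: "t \<in> {\<alpha>..b + e}" if "t \<in> ?J" for t using that by auto
  have \<delta>c: "continuous_on ?J \<delta>"
  proof (rule continuous_on_eq)
    show "continuous_on ?J (\<lambda>t. chart_inv ?c (fst (Z t)))"
      by (rule continuous_on_compose2[OF cont_inv[OF c] continuous_on_fst[OF continuous_on_subset[OF Zc]]])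
         (use im in auto)
  qed (use \<delta>Z in auto)
  have \<delta>d: "((chart_map ?c \<circ> \<delta>) has_vector_derivative snd (Z t)) (at t)" if t: "t \<in> ?J" for t
  proof -
    have "((\<lambda>t. fst (Z t)) has_vector_derivative snd (Z t)) (at t)"
      using bounded_linear.has_vector_derivative[OF bounded_linear_fst Zd[OF t]] by (simp add: spray_def)
    then show ?thesis
      by (rule has_vector_derivative_transform_within_open[where S = ?J]) (use t \<delta>dom(2) in auto)
  qed
  have geo: "geod_at \<delta> t" if t: "t \<in> ?J" for t
  proof (rule geod_at_one_chart[OF c \<delta>dom(1)[OF JJ[OF t]] open_greaterThanLessThan t \<delta>c])
    have "((\<lambda>t. snd (Z t)) has_vector_derivative
        - christoffel UNIV (gc ?c) (chart_map ?c (\<delta> t)) (snd (Z t)) (snd (Z t))) (at t)"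
      using bounded_linear.has_vector_derivative[OF bounded_linear_snd Zd[OF t]] \<delta>dom(2)[OF JJ[OF t]]
      by (simp add: spray_def)
    then show "geod_in_chart ?c \<delta> t"
      unfolding geod_in_chart_def using \<delta>d t
      by (intro exI[of _ ?J] exI[of _ "\<lambda>t. snd (Z t)"]) auto
  qed
  have sp: "speed \<delta> t = 1" if t: "t \<in> ?J" for t
  proof -
    let ?h = "\<lambda>s. gc ?c (fst (Z s)) (snd (Z s)) (snd (Z s))"
    have h0: "(?h has_real_derivative 0) (at s)" if "s \<in> ?J" for s
      by (rule energy_constant[OF c open_greaterThanLessThan that Zd im[OF JJ]])
    let ?s = "(\<alpha> + b) / 2"
    have s: "?s \<in> ?J" "?s \<in> {\<beta><..<b}" using \<alpha> Y(1) by auto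
    have "?h t = ?h ?s"
      by (rule has_field_derivative_zero_constant[of ?J ?h, THEN exE])
         (use h0 t s in \<open>auto intro: has_field_derivative_at_within\<close>)
    also have "\<dots> = 1" using unit_c[OF s(2)] s(2) by (simp add: Z_def)
    finally have "?h t = 1" .
    moreover have "isCont \<delta> t" using \<delta>c t by (simp add: continuous_on_eq_continuous_at)
    ultimately show ?thesis
      using speed_chart[OF c \<delta>dom(1)[OF JJ[OF t]] _ \<delta>d[OF t]] \<delta>dom(2)[OF JJ[OF t]] by simp
  qed
  show ?thesis
  proof (rule that[OF Y(1)])
    show "\<delta> t = \<gamma> t" if "t \<in> I" for t using b(3)[OF that] by (simp add: \<delta>_def)
    show "geod_at \<delta> t \<and> speed \<delta> t = 1" if "t \<in> I \<union> {b..<b + e}" for t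
    proof (cases "t \<in> I")
      case True
      have "\<gamma> s = \<delta> s" if "s \<in> I" for s using b(3)[OF that] by (simp add: \<delta>_def)
      then show ?thesis
        using geod_at_cong[OF I True, of \<gamma> \<delta>] speed_cong[OF I True, of \<gamma> \<delta>] unit[OF True]
          geodesic_on_iff[OF I] G True by auto
    next
      case False
      then have "t \<in> ?J" using that \<alpha> by auto
      then show ?thesis using geo sp by blast
    qed
  qed
qed

definition unit_geodesic :: "real set \<Rightarrow> (real \<Rightarrow> 'a) \<Rightarrow> bool" where
  "unit_geodesic I \<gamma> \<longleftrightarrow> open I \<and> is_interval I \<and> I \<noteq> {} \<and> (\<forall>t\<in>I. geod_at \<gamma> t \<and> speed \<gamma> t = 1)"

lemma unit_geodesic_iff:
  "unit_geodesic I \<gamma> \<longleftrightarrow> open I \<and> is_interval I \<and> I \<noteq> {} \<and> geodesic_on UNIV A g I \<gamma> \<and>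
     (\<forall>t\<in>I. tangent_norm g (\<gamma> t) (velocity A \<gamma> t) = 1)"
  unfolding unit_geodesic_def using geodesic_on_iff by (auto simp: speed_def)

lemma unit_geodesic_extend_right:
  assumes G: "unit_geodesic I \<gamma>" and bdd: "bdd_above I"
    and K: "\<exists>K t1. compact K \<and> t1 \<in> I \<and> (\<forall>t\<in>I. t1 \<le> t \<longrightarrow> \<gamma> t \<in> K)"
  obtains J \<delta> where "unit_geodesic J \<delta>" "I \<subset> J" "\<And>t. t \<in> I \<Longrightarrow> \<delta> t = \<gamma> t"
proof -
  note G' = G[unfolded unit_geodesic_iff, folded speed_def]
  have I: "open I" "is_interval I" "I \<noteq> {}" using G' by auto
  obtain K t1 where K: "compact K" "t1 \<in> I" "\<And>t. t \<in> I \<Longrightarrow> t1 \<le> t \<Longrightarrow> \<gamma> t \<in> K" using K by blast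
  define b where "b = Sup I"
  have le: "t \<le> b" if "t \<in> I" for t unfolding b_def by (rule cSup_upper[OF that bdd])
  have lt: "t < b" if t: "t \<in> I" for t
  proof -
    obtain \<epsilon> where "0 < \<epsilon>" "ball t \<epsilon> \<subseteq> I" using I(1) t open_contains_ball by blast
    moreover have "t + \<epsilon> / 2 \<in> ball t \<epsilon>" using \<open>0 < \<epsilon>\<close> by (simp add: dist_real_def)
    ultimately show ?thesis using le[of "t + \<epsilon> / 2"] by auto
  qed
  have sub: "{t..<b} \<subseteq> I" if t: "t \<in> I" for t
  proof
    fix s assume s: "s \<in> {t..<b}"
    then obtain u where "u \<in> I" "s < u" using less_cSup_iff[OF I(3) bdd, of s] unfolding b_def by auto
    then show "s \<in> I" using I(2) t s unfolding is_interval_1 by (meson atLeastLessThan_iff less_imp_le)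
  qed
  obtain e \<delta> where \<delta>: "0 < e" "\<And>t. t \<in> I \<Longrightarrow> \<delta> t = \<gamma> t"
    "\<And>t. t \<in> I \<union> {b..<b + e} \<Longrightarrow> geod_at \<delta> t \<and> speed \<delta> t = 1"
  proof (rule geodesic_extend_right[OF I(1) _ _ lt[OF K(2)] sub[OF K(2)] lt K(1)])
    show "\<gamma> t \<in> K" if "t \<in> {t1..<b}" for t using K(3) that sub[OF K(2)] by auto
  qed (use G' in auto)
  let ?J = "I \<union> {b..<b + e}"
  have JI: "?J = I \<union> {t1<..<b + e}" using sub[OF K(2)] lt[OF K(2)] \<delta>(1) by force
  have "open ?J" unfolding JI by (intro open_Un I(1)) auto
  moreover have "is_interval ?J"
    unfolding is_interval_1
  proof (intro ballI allI impI)
    fix s u x assume s: "s \<in> ?J" and u: "u \<in> ?J" and x: "s \<le> x \<and> x \<le> u"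
    show "x \<in> ?J"
    proof (cases "x < b")
      case True
      then have "s \<in> I" using s x by auto
      then show ?thesis using sub[of s] x True by auto
    next
      case False
      then show ?thesis using u x lt[of u] by auto
    qed
  qed
  ultimately have "unit_geodesic ?J \<delta>" unfolding unit_geodesic_def using I(3) \<delta>(3) by auto
  moreover have "I \<subset> ?J"
  proof -
    have "b \<notin> I" using lt[of b] by blast
    moreover have "b \<in> ?J" using \<delta>(1) by simp
    ultimately show ?thesis by blast
  qed
  ultimately show ?thesis using \<delta>(2) by (rule that)
qed

lemma unit_geodesic_reflect:
  assumes "unit_geodesic I \<gamma>"
  shows "unit_geodesic (uminus ` I) (\<lambda>t. \<gamma> (- t))"
proof -
  have I: "open I" "connected I" "I \<noteq> {}" "\<And>t. t \<in> I \<Longrightarrow> geod_at \<gamma> t" "\<And>t. t \<in> I \<Longrightarrow> speed \<gamma> t = 1"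
    using assms by (auto simp: unit_geodesic_def is_interval_connected_1)
  have "connected (uminus ` I)" by (intro connected_continuous_image I(2) continuous_intros)
  moreover have "geod_at (\<lambda>t. \<gamma> (- t)) t \<and> speed (\<lambda>t. \<gamma> (- t)) t = 1" if "t \<in> uminus ` I" for t
  proof -
    have "- t \<in> I" using that by auto
    then show ?thesis using geod_at_reflect[OF I(4)] speed_reflect[OF I(4)] I(5) by simp
  qed
  ultimately show ?thesis
    using I(1,3) open_negations[of I] unfolding unit_geodesic_def is_interval_connected_1 by blast
qed

text \<open>Zorn's lemma is applied to graphs of extensions ordered by inclusion: a chain of graphs is
  single-valued, and being a geodesic is a local property, so unions of chains are again extensions.\<close>

lemma maximal_unit_geodesic:
  assumes G: "unit_geodesic I \<gamma>"
  obtains J \<delta> where "unit_geodesic J \<delta>" "I \<subseteq> J" "\<And>t. t \<in> I \<Longrightarrow> \<delta> t = \<gamma> t"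
    "\<forall>J' \<delta>'. unit_geodesic J' \<delta>' \<longrightarrow> J \<subseteq> J' \<longrightarrow> (\<forall>t\<in>J. \<delta>' t = \<delta> t) \<longrightarrow> J' = J"
proof -
  define gr where "gr J \<delta> = (\<lambda>t. (t, \<delta> t)) ` J" for J :: "real set" and \<delta> :: "real \<Rightarrow> 'a"
  have gr_iff: "(t, y) \<in> gr J \<delta> \<longleftrightarrow> t \<in> J \<and> y = \<delta> t" for t y J \<delta> by (auto simp: gr_def)
  have gr_sub: "gr J \<delta> \<subseteq> gr J' \<delta>' \<longleftrightarrow> J \<subseteq> J' \<and> (\<forall>t\<in>J. \<delta>' t = \<delta> t)" for J \<delta> J' \<delta>'
    by (auto simp: gr_def)
  define X where "X = {H. \<exists>J \<delta>. H = gr J \<delta> \<and> unit_geodesic J \<delta> \<and> gr I \<gamma> \<subseteq> H}"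
  have "\<exists>M\<in>X. \<forall>H\<in>X. M \<subseteq> H \<longrightarrow> H = M"
  proof (rule subset_Zorn_nonempty)
    show "X \<noteq> {}" using G unfolding X_def by blast
    fix \<C> assume ne: "\<C> \<noteq> {}" and ch: "subset.chain X \<C>"
    have \<C>: "\<exists>J \<delta>. H = gr J \<delta> \<and> unit_geodesic J \<delta> \<and> gr I \<gamma> \<subseteq> H" if "H \<in> \<C>" for H
      using ch that unfolding subset.chain_def X_def by blast
    define J where "J = fst ` \<Union>\<C>"
    define \<delta> where "\<delta> t = (THE y. (t, y) \<in> \<Union>\<C>)" for t
    have single: "y = y'" if ty: "(t, y) \<in> \<Union>\<C>" "(t, y') \<in> \<Union>\<C>" for t y y'
    proof -
      obtain H H' where H: "H \<in> \<C>" "(t, y) \<in> H" "H' \<in> \<C>" "(t, y') \<in> H'" using ty by blast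
      then have "H \<subseteq> H' \<or> H' \<subseteq> H" using ch unfolding subset.chain_def by blast
      then obtain H0 where "H0 \<in> \<C>" "(t, y) \<in> H0" "(t, y') \<in> H0" using H by blast
      then obtain J0 \<delta>0 where "H0 = gr J0 \<delta>0" "(t, y) \<in> H0" "(t, y') \<in> H0" using \<C> by blast
      then show ?thesis by (simp add: gr_iff)
    qed
    have \<delta>: "(t, y) \<in> \<Union>\<C> \<longleftrightarrow> t \<in> J \<and> y = \<delta> t" for t y
    proof -
      have "\<delta> t = y" if "(t, y) \<in> \<Union>\<C>" for y
      proof -
        have "(THE y. (t, y) \<in> \<Union>\<C>) = y"
          by (rule the_equality, rule that, rule single, assumption, rule that)
        then show ?thesis by (simp add: \<delta>_def)
      qed
      moreover have "t \<in> J \<longleftrightarrow> (\<exists>y. (t, y) \<in> \<Union>\<C>)" unfolding J_def by (force simp: image_iff)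
      ultimately show ?thesis by blast
    qed
    then have U: "\<Union>\<C> = gr J \<delta>" by (auto simp only: set_eq_iff split_paired_All gr_iff)
    have piece: "\<exists>J0. unit_geodesic J0 \<delta> \<and> J0 \<subseteq> J \<and> I \<subseteq> J0 \<and> t \<in> J0" if "t \<in> J" for t
    proof -
      have "(t, \<delta> t) \<in> \<Union>\<C>" using \<delta> that by blast
      then obtain H where H: "H \<in> \<C>" "(t, \<delta> t) \<in> H" by blast
      then obtain J0 \<delta>0 where J0: "H = gr J0 \<delta>0" "unit_geodesic J0 \<delta>0" "gr I \<gamma> \<subseteq> H" using \<C> by blast
      have "gr J0 \<delta>0 \<subseteq> gr J \<delta>" using H(1) J0(1) U by blast
      then have s: "J0 \<subseteq> J" "\<And>t. t \<in> J0 \<Longrightarrow> \<delta>0 t = \<delta> t" unfolding gr_sub by auto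
      have op: "open J0" using J0(2) by (simp add: unit_geodesic_def)
      have "unit_geodesic J0 \<delta>"
        using J0(2) geod_at_cong[OF op _ s(2)] speed_cong[OF op _ s(2)] unfolding unit_geodesic_def by auto
      moreover have "I \<subseteq> J0" using J0(1,3) gr_sub by blast
      moreover have "t \<in> J0" using H(2) J0(1) gr_iff by blast
      ultimately show ?thesis using s(1) by blast
    qed
    have "open J"
      unfolding open_subopen[of J] using piece unit_geodesic_def by metis
    moreover have "is_interval J"
    proof -
      have "J = \<Union>{J0. unit_geodesic J0 \<delta> \<and> J0 \<subseteq> J \<and> I \<subseteq> J0}" using piece by blast
      moreover have "connected \<dots>"
      proof (rule connected_Union)
        show "connected J0" if "J0 \<in> {J0. unit_geodesic J0 \<delta> \<and> J0 \<subseteq> J \<and> I \<subseteq> J0}" for J0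
          using that is_interval_connected_1 by (auto simp: unit_geodesic_def)
        show "\<Inter>{J0. unit_geodesic J0 \<delta> \<and> J0 \<subseteq> J \<and> I \<subseteq> J0} \<noteq> {}"
          using G unfolding unit_geodesic_def by blast
      qed
      ultimately show ?thesis using is_interval_connected_1 by metis
    qed
    moreover have IJ: "gr I \<gamma> \<subseteq> \<Union>\<C>" using ne \<C> by blast
    moreover have "J \<noteq> {}" using IJ G unfolding U gr_sub unit_geodesic_def by blast
    moreover have "geod_at \<delta> t \<and> speed \<delta> t = 1" if "t \<in> J" for t
      using piece[OF that] unfolding unit_geodesic_def by blast
    ultimately show "\<Union>\<C> \<in> X" unfolding X_def U unit_geodesic_def by blast
  qed
  then obtain M where M: "M \<in> X" "\<And>H. H \<in> X \<Longrightarrow> M \<subseteq> H \<Longrightarrow> H = M" by blast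
  obtain J \<delta> where J: "M = gr J \<delta>" "unit_geodesic J \<delta>" "gr I \<gamma> \<subseteq> M" using M(1) unfolding X_def by blast
  show ?thesis
  proof (rule that[OF J(2)])
    show "I \<subseteq> J" "\<And>t. t \<in> I \<Longrightarrow> \<delta> t = \<gamma> t" using J(1,3) gr_sub by auto
    show "\<forall>J' \<delta>'. unit_geodesic J' \<delta>' \<longrightarrow> J \<subseteq> J' \<longrightarrow> (\<forall>t\<in>J. \<delta>' t = \<delta> t) \<longrightarrow> J' = J"
    proof (intro allI impI)
      fix J' \<delta>' assume *: "unit_geodesic J' \<delta>'" "J \<subseteq> J'" "\<forall>t\<in>J. \<delta>' t = \<delta> t"
      have s: "M \<subseteq> gr J' \<delta>'" unfolding J(1) gr_sub using * by blast
      then have "gr J' \<delta>' \<in> X" unfolding X_def using * J(3) by blast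
      then have "gr J' \<delta>' = gr J \<delta>" using M(2) s J(1) by blast
      then show "J' = J" using gr_sub by blast
    qed
  qed
qed

text \<open>A maximal extension of bounded time would extend further, to the right by confinement and to the
  left by reversing time.\<close>

lemma geodesically_complete_if_confined:
  assumes conf: "\<And>I \<gamma>. unit_geodesic I \<gamma> \<Longrightarrow> bdd_above I \<Longrightarrow>
    \<exists>K t1. compact K \<and> t1 \<in> I \<and> (\<forall>t\<in>I. t1 \<le> t \<longrightarrow> \<gamma> t \<in> K)"
  shows "geodesically_complete UNIV A g"
  unfolding geodesically_complete_def unit_geodesic_iff[symmetric]
proof (intro allI impI)
  fix I \<gamma> assume G: "unit_geodesic I \<gamma>"
  obtain J \<delta> where J: "unit_geodesic J \<delta>" "I \<subseteq> J" "\<And>t. t \<in> I \<Longrightarrow> \<delta> t = \<gamma> t"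
    and max': "\<forall>J' \<delta>'. unit_geodesic J' \<delta>' \<longrightarrow> J \<subseteq> J' \<longrightarrow> (\<forall>t\<in>J. \<delta>' t = \<delta> t) \<longrightarrow> J' = J"
    by (rule maximal_unit_geodesic[OF G]) (rule that)
  have max: "J' = J" if "unit_geodesic J' \<delta>'" "J \<subseteq> J'" "\<And>t. t \<in> J \<Longrightarrow> \<delta>' t = \<delta> t" for J' \<delta>'
    using max' that by blast
  have above: "\<not> bdd_above J"
  proof
    assume b: "bdd_above J"
    show False
    proof (rule unit_geodesic_extend_right[OF J(1) b conf[OF J(1) b]])
      fix J' \<delta>' assume "unit_geodesic J' \<delta>'" "J \<subset> J'" "\<And>t. t \<in> J \<Longrightarrow> \<delta>' t = \<delta> t"
      then show False using max[of J' \<delta>'] by blast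
    qed
  qed
  have below: "\<not> bdd_below J"
  proof
    assume "bdd_below J"
    then have b: "bdd_above (uminus ` J)" by (simp add: bdd_above_uminus)
    note R = unit_geodesic_reflect[OF J(1)]
    show False
    proof (rule unit_geodesic_extend_right[OF R b conf[OF R b]])
      fix J' \<delta>' assume *: "unit_geodesic J' \<delta>'" "uminus ` J \<subset> J'" "\<And>t. t \<in> uminus ` J \<Longrightarrow> \<delta>' t = \<delta> (- t)"
      have "uminus ` J' = J"
      proof (rule max[OF unit_geodesic_reflect[OF *(1)]])
        have "uminus ` uminus ` J = J" by (simp add: image_image)
        then show "J \<subseteq> uminus ` J'" using *(2) by (metis image_mono psubset_imp_subset)
        show "\<delta>' (- t) = \<delta> t" if "t \<in> J" for t using *(3)[of "- t"] that by simp
      qed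
      then have "J' = uminus ` J" by (auto simp: image_image)
      then show False using *(2) by blast
    qed
  qed
  have "J = UNIV"
  proof -
    have "x \<in> J" for x
    proof -
      obtain u where "u \<in> J" "x < u" using above unfolding bdd_above_def by (meson not_le)
      moreover obtain s where "s \<in> J" "s < x" using below unfolding bdd_below_def by (meson not_le)
      ultimately show ?thesis
        using J(1) unfolding unit_geodesic_def is_interval_1 by (meson less_imp_le)
    qed
    then show ?thesis by blast
  qed
  then have "geodesic_on UNIV A g UNIV \<delta>" using J(1) unfolding unit_geodesic_iff by blast
  then show "\<exists>\<delta>. geodesic_on UNIV A g UNIV \<delta> \<and> (\<forall>t\<in>I. \<delta> t = \<gamma> t)" using J(3) by blast
qed

end

section \<open>The growth condition\<close>

text \<open>A bounded increasing antiderivative has a limit at infinity, and its finite total increment would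
  be the value of the divergent integral.\<close>

lemma unbounded_antiderivative:
  fixes W :: "real \<Rightarrow> real"
  assumes W: "continuous_on UNIV W" "\<And>x. 0 < W x"
    and div: "(\<integral>\<^sup>+x\<in>{0..}. ennreal (W x) \<partial>lborel) = \<infinity>"
    and \<Phi>: "\<And>x. 0 \<le> x \<Longrightarrow> (\<Phi> has_real_derivative W x) (at x)"
  shows "\<exists>R\<ge>0. C < \<Phi> R"
proof (rule ccontr)
  assume "\<not> ?thesis"
  then have bd: "\<Phi> x \<le> C" if "0 \<le> x" for x using that by (auto simp: not_less)
  have mono: "\<Phi> x \<le> \<Phi> y" if "0 \<le> x" "x \<le> y" for x y
    by (rule DERIV_nonneg_imp_nondecreasing[OF that(2)]) (use \<Phi> W(2) that(1) in \<open>meson less_imp_le order_trans\<close>)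
  have bdd: "bdd_above (\<Phi> ` {0..})" using bd by (intro bdd_aboveI[of _ C]) auto
  define T where "T = Sup (\<Phi> ` {0..})"
  have lim: "(\<Phi> \<longlongrightarrow> T) at_top"
  proof (rule increasing_tendsto)
    show "\<forall>\<^sub>F x in at_top. \<Phi> x \<le> T"
      using eventually_ge_at_top[of 0]
      by eventually_elim (auto simp: T_def intro!: cSup_upper bdd)
    fix y assume "y < T"
    then obtain x where x: "0 \<le> x" "y < \<Phi> x" unfolding T_def using less_cSup_iff[OF _ bdd] by auto
    show "\<forall>\<^sub>F z in at_top. y < \<Phi> z"
      using eventually_ge_at_top[of x] by eventually_elim (use mono x in \<open>force intro: less_le_trans\<close>)
  qed
  have "(\<integral>\<^sup>+x. ennreal (W x) * indicator {0..} x \<partial>lborel) = ennreal (T - \<Phi> 0)"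
    by (rule nn_integral_FTC_atLeast[OF _ \<Phi> _ lim])
       (use W in \<open>auto intro: borel_measurable_continuous_onI less_imp_le\<close>)
  then show False using div by simp
qed

context connected_riemannian
begin

text \<open>The function \<open>\<sigma>\<close> is the distance at time s plus the integral of the bound on the speed; it dominates
  the distance, so by monotonicity of V0 it satisfies \<open>\<sigma>' \<le> sqrt (V0 \<sigma>)\<close>, that is
  \<open>(\<Phi> \<circ> \<sigma>)' \<le> 1\<close>.\<close>

lemma growth_bound:
  fixes V0 :: "real \<Rightarrow> real"
  assumes V0: "continuous_on {0..} V0" "mono_on {0..} V0" "\<And>x. 0 \<le> x \<Longrightarrow> 0 < V0 x"
    and \<Phi>: "\<And>x. 0 \<le> x \<Longrightarrow> (\<Phi> has_real_derivative 1 / sqrt (V0 x)) (at x)"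
    and st: "s \<le> t" and C: "C1_curve A s t \<gamma>"
    and sp: "\<And>u. u \<in> {s..t} \<Longrightarrow> speed \<gamma> u \<le> sqrt (V0 (d (\<gamma> u) x0))"
  shows "\<Phi> (d (\<gamma> t) x0) \<le> \<Phi> (d (\<gamma> s) x0) + (t - s)"
proof -
  define h where "h u = sqrt (V0 (d (\<gamma> u) x0))" for u
  have \<gamma>c: "continuous_on {s..t} \<gamma>" using C unfolding C1_curve_def by blast
  have hc: "continuous_on {s..t} h"
    unfolding h_def
    by (intro continuous_on_real_sqrt continuous_on_compose2[OF V0(1) d_continuous2[OF \<gamma>c continuous_on_const]])
       (use d_nonneg in auto)
  have h0: "0 \<le> h u" for u using V0(3)[OF d_nonneg] unfolding h_def by (simp add: less_imp_le)
  define \<sigma> where "\<sigma> u = d (\<gamma> s) x0 + integral {s..u} h" for u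
  have \<sigma>': "(\<sigma> has_real_derivative h u) (at u within {s..t})" if "u \<in> {s..t}" for u
    unfolding \<sigma>_def has_real_derivative_iff_has_vector_derivative
    using has_vector_derivative_add[OF has_vector_derivative_const integral_has_vector_derivative[OF hc that]] by simp
  have hint: "h integrable_on {s..u}" if "u \<in> {s..t}" for u
    by (rule integrable_continuous_real[OF continuous_on_subset[OF hc]]) (use that in auto)
  have \<rho>\<sigma>: "d (\<gamma> u) x0 \<le> \<sigma> u" if u: "u \<in> {s..t}" for u
  proof -
    have P: "pc1 s u \<gamma>" by (rule pc1_subset[OF pc1_C1[OF C]]) (use u in auto)
    have "d (\<gamma> u) x0 \<le> d (\<gamma> s) (\<gamma> u) + d (\<gamma> s) x0"
      using d_triangle[of "\<gamma> u" x0 "\<gamma> s"] d_sym[of "\<gamma> s" "\<gamma> u"] by simp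
    also have "d (\<gamma> s) (\<gamma> u) \<le> len s u \<gamma>" by (rule d_le_len[OF P]) (use u in auto)
    also have "len s u \<gamma> \<le> integral {s..u} h"
      unfolding len_def by (rule integral_le[OF speed_integrable[OF P] hint[OF u]]) (use sp u in \<open>auto simp: h_def\<close>)
    finally show ?thesis by (simp add: \<sigma>_def)
  qed
  have \<sigma>0: "0 \<le> \<sigma> u" if "u \<in> {s..t}" for u using order_trans[OF d_nonneg \<rho>\<sigma>[OF that]] .
  have "((\<lambda>u. 1 / sqrt (V0 (\<sigma> u)) * h u) has_integral \<Phi> (\<sigma> t) - \<Phi> (\<sigma> s)) {s..t}"
  proof (rule fundamental_theorem_of_calculus[OF st])
    fix u assume u: "u \<in> {s..t}"
    have "((\<Phi> \<circ> \<sigma>) has_real_derivative 1 / sqrt (V0 (\<sigma> u)) * h u) (at u within {s..t})"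
      by (rule DERIV_chain[OF \<Phi>[OF \<sigma>0[OF u]] \<sigma>'[OF u]])
    then show "((\<lambda>u. \<Phi> (\<sigma> u)) has_vector_derivative 1 / sqrt (V0 (\<sigma> u)) * h u) (at u within {s..t})"
      by (simp add: has_real_derivative_iff_has_vector_derivative o_def)
  qed
  moreover have "((\<lambda>u. 1::real) has_integral (t - s)) {s..t}"
    using has_integral_const_real[of "1::real" s t] st by simp
  moreover have "1 / sqrt (V0 (\<sigma> u)) * h u \<le> 1" if u: "u \<in> {s..t}" for u
  proof -
    have "V0 (d (\<gamma> u) x0) \<le> V0 (\<sigma> u)"
      using mono_onD[OF V0(2)] \<rho>\<sigma>[OF u] d_nonneg \<sigma>0[OF u] by simp
    then show ?thesis using V0(3)[OF \<sigma>0[OF u]] by (simp add: h_def)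
  qed
  ultimately have le: "\<Phi> (\<sigma> t) - \<Phi> (\<sigma> s) \<le> t - s" by (rule has_integral_le)
  have "\<Phi> (d (\<gamma> t) x0) \<le> \<Phi> (\<sigma> t)"
  proof (rule DERIV_nonneg_imp_nondecreasing[where f = \<Phi>])
    show "d (\<gamma> t) x0 \<le> \<sigma> t" using \<rho>\<sigma> st by auto
    fix x assume "d (\<gamma> t) x0 \<le> x"
    then have x: "0 \<le> x" using d_nonneg order_trans by blast
    then show "\<exists>y. (\<Phi> has_real_derivative y) (at x) \<and> 0 \<le> y"
      using \<Phi>[OF x] V0(3)[OF x] by (intro exI[of _ "1 / sqrt (V0 x)"]) simp
  qed
  moreover have "\<sigma> s = d (\<gamma> s) x0" by (simp add: \<sigma>_def)
  ultimately show ?thesis using le by simp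
qed

text \<open>A unit-speed curve for the second metric has speed at most sqrt V0 for the first one, so in finite
  time it stays in a ball, which is compact by the completeness of the first metric.\<close>

theorem complete_of_growth:
  fixes V0 :: "real \<Rightarrow> real"
  assumes complete: "geodesically_complete UNIV A g" and g': "riemannian_metric UNIV A g'"
    and V0: "continuous_on {0..} V0" "mono_on {0..} V0" "\<And>x. 0 \<le> x \<Longrightarrow> 0 < V0 x"
    and div: "(\<integral>\<^sup>+x\<in>{0..}. ennreal (1 / sqrt (V0 x)) \<partial>lborel) = \<infinity>"
    and ge: "\<And>p v. g p v v \<le> V0 (d p x0) * g' p v v"
  shows "geodesically_complete UNIV A g'"
proof -
  interpret P: connected_riemannian A g'
    by unfold_locales (rule g', rule connected)
  show ?thesis
  proof (rule P.geodesically_complete_if_confined)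
    fix I \<gamma> assume G: "P.unit_geodesic I \<gamma>" and bdd: "bdd_above I"
    have I: "open I" "is_interval I" "I \<noteq> {}" and geo: "geodesic_on UNIV A g' I \<gamma>"
      and unit: "\<And>t. t \<in> I \<Longrightarrow> P.speed \<gamma> t = 1"
      using G unfolding P.unit_geodesic_iff P.speed_def by auto
    obtain t1 where t1: "t1 \<in> I" using I(3) by blast
    obtain b where b: "\<And>t. t \<in> I \<Longrightarrow> t \<le> b" using bdd unfolding bdd_above_def by blast
    \<comment> \<open>Extending V0 by a constant to negative arguments gives the antiderivative a two-sided
      derivative at 0.\<close>
    define W where "W x = 1 / sqrt (V0 (max 0 x))" for x
    have W0: "0 < W x" for x using V0(3)[of "max 0 x"] by (simp add: W_def)
    have Wc: "continuous_on UNIV W"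
    proof -
      have "continuous_on UNIV (\<lambda>x. V0 (max 0 x))"
        by (rule continuous_on_compose2[OF V0(1)]) (auto intro: continuous_intros)
      then show ?thesis unfolding W_def using V0(3) by (intro continuous_intros) (auto simp: less_imp_neq[symmetric])
    qed
    define \<Phi> where "\<Phi> x = integral {- 1..x} W" for x
    have \<Phi>W: "(\<Phi> has_real_derivative W x) (at x)" if x: "0 \<le> x" for x
    proof -
      have "((\<lambda>u. integral {- 1..u} W) has_vector_derivative W x) (at x within {- 1..x + 1})"
        by (rule integral_has_vector_derivative[OF continuous_on_subset[OF Wc]]) (use x in auto)
      then show ?thesis
        using at_within_interior[of x "{- 1..x + 1}"] x
        unfolding \<Phi>_def[abs_def] has_real_derivative_iff_has_vector_derivative by simp
    qed
    have "(\<integral>\<^sup>+x\<in>{0..}. ennreal (W x) \<partial>lborel) = \<infinity>"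
      unfolding div[symmetric] by (rule nn_integral_cong) (auto simp: W_def indicator_def)
    from unbounded_antiderivative[OF Wc W0 this \<Phi>W]
    obtain R where R: "0 \<le> R" "\<Phi> (d (\<gamma> t1) x0) + (b - t1) < \<Phi> R" by blast
    have "\<gamma> t \<in> cb x0 R" if t: "t \<in> I" "t1 \<le> t" for t
    proof (rule ccontr)
      assume "\<gamma> t \<notin> cb x0 R"
      then have far: "R \<le> d (\<gamma> t) x0" by simp
      have sub: "{t1..t} \<subseteq> I" using I(2) t1 t unfolding is_interval_1 by (meson atLeastAtMost_iff subsetI)
      have "\<Phi> (d (\<gamma> t) x0) \<le> \<Phi> (d (\<gamma> t1) x0) + (t - t1)"
      proof (rule growth_bound[OF V0 _ t(2)])
        show "(\<Phi> has_real_derivative 1 / sqrt (V0 x)) (at x)" if "0 \<le> x" for x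
          using \<Phi>W[OF that] that by (simp add: W_def max_def)
        show "C1_curve A t1 t \<gamma>" by (rule P.geodesic_C1_curve[OF I(1) geo sub])
        show "speed \<gamma> u \<le> sqrt (V0 (d (\<gamma> u) x0))" if u: "u \<in> {t1..t}" for u
        proof -
          let ?v = "velocity A \<gamma> u"
          have "g' (\<gamma> u) ?v ?v = 1"
            using unit[of u] sub u by (auto simp: P.speed_def tangent_norm_def)
          then have "g (\<gamma> u) ?v ?v \<le> V0 (d (\<gamma> u) x0)" using ge[of "\<gamma> u" ?v] by simp
          then show ?thesis by (simp add: speed_def tangent_norm_def)
        qed
      qed
      moreover have "\<Phi> R \<le> \<Phi> (d (\<gamma> t) x0)"
        by (rule DERIV_nonneg_imp_nondecreasing[OF far])
           (use \<Phi>W W0 R(1) in \<open>meson less_imp_le order_trans\<close>)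
      ultimately show False using R(2) b[OF t(1)] by linarith
    qed
    then show "\<exists>K t1. compact K \<and> t1 \<in> I \<and> (\<forall>t\<in>I. t1 \<le> t \<longrightarrow> \<gamma> t \<in> K)"
      using Hopf_Rinow_bounded_compact[OF complete] t1 by blast
  qed
qed

end

section \<open>Completeness of the perturbed metric\<close>

theorem mainTheorem1:
  fixes S :: "'e::euclidean_space set"
    and A :: "('a::{t2_space, second_countable_topology}, 'e) chart set"
    and V0 :: "real \<Rightarrow> real"
    and g :: "'a \<Rightarrow> 'e \<Rightarrow> 'e \<Rightarrow> real"
    and \<mu> :: "'a \<Rightarrow> 'e \<Rightarrow> real"
    and x0 :: 'a
  assumes "smooth_manifold S A"
    and "connected (UNIV :: 'a set)"
    and "continuous_on {0..} V0"
    and "mono_on {0..} V0"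
    and "\<And>x. 0 \<le> x \<Longrightarrow> 0 < V0 x"
    and "(\<integral>\<^sup>+x\<in>{0..}. ennreal (1 / sqrt (V0 x)) \<partial>lborel) = \<infinity>"
    and "riemannian_metric S A g"
    and "geodesically_complete S A g"
    and "smooth_one_form S A \<mu>"
    and "\<And>p. 1 + (tangent_norm g p (sharp S g \<mu> p))\<^sup>2 \<le> V0 (riemannian_dist A g p x0)"
  shows "riemannian_metric S A (perturbed_metric S g \<mu>) \<and>
         geodesically_complete S A (perturbed_metric S g \<mu>)"
proof -
  consider "S = {0}" | "S = UNIV" using assms(1) unfolding smooth_manifold_def by blast
  then show ?thesis
  proof cases
    case 1
    have R: "riemannian_metric {0} A (perturbed_metric {0} g \<mu>)"
      using zero_manifold_perturbed assms(1,7,9) unfolding 1 by blast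
    then have "bilinear (perturbed_metric {0} g \<mu> p)" for p unfolding riemannian_metric_def by blast
    then show ?thesis using R zero_manifold_complete assms(1) unfolding 1 by blast
  next
    case 2
    interpret riemannian_form A g \<mu>
      by unfold_locales (use assms(1,7,9) 2 in auto)
    interpret connected_riemannian A g
      by unfold_locales (rule assms(2))
    let ?g' = "perturbed_metric UNIV g \<mu>"
    have "g p v v \<le> V0 (d p x0) * ?g' p v v" for p v
    proof -
      have pos: "0 < 1 + N p" by (intro add_pos_nonneg) auto
      have "g p v v \<le> (1 + N p) * ?g' p v v"
        using perturbed_ge[of p v] pos by (simp add: field_simps)
      also have "\<dots> \<le> V0 (d p x0) * ?g' p v v"
      proof (rule mult_right_mono)
        show "1 + N p \<le> V0 (d p x0)" using assms(10)[of p] 2 by simp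
        have "0 \<le> g p v v / (1 + N p)" using inner_formD(4)[OF inner_form_g] pos by simp
        then show "0 \<le> ?g' p v v" using perturbed_ge[of p v] by linarith
      qed
      finally show ?thesis .
    qed
    from complete_of_growth[OF _ perturbed_riemannian assms(3,4,5,6) this]
    show ?thesis using perturbed_riemannian assms(8) 2 by simp
  qed
qed

end
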